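(* Suppose $q=p^v$ where $p$ is an odd prime and $v\ge1$. Then $\mathrm{QR}^{S}_{C_{1,4}}(X,Y,Z)$ is equal to $(q-1)^2q(q+1)$ times $$\sum_{\substack{t^2\le 4q\\ t\equiv 1\ (\mathrm{mod}\ 2)}} N_A(t)\,XY^{\frac{q-t}{2}}Z^{\frac{q+t}{2}}$$ $$+\sum_{\substack{t^2\le 4q\\ t\equiv 0\ (\mathrm{mod}\ 2)}}\Bigg(\big(N_A(t)-N_{A,2\times2}(t)\big)\left(\tfrac12X^2Y^{\frac{q-1-t}{2}}Z^{\frac{q-1+t}{2}}+\tfrac12Y^{\frac{q+1-t}{2}}Z^{\frac{q+1+t}{2}}\right)$$ $$\qquad\qquad+N_{A,2\times2}(t)\left(\tfrac14X^4Y^{\frac{q-3-t}{2}}Z^{\frac{q-3+t}{2}}+\tfrac34Y^{\frac{q+1-t}{2}}Z^{\frac{q+1+t}{2}}\right)\Bigg),$$ where $t$ runs over integers.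
   Context: For non-negative integers $i,j,k$ with $i+j+k=q+1$, let $A_{i,j,k}$ be the number of homogeneous quartic polynomials $f_4(x,y)$ over $\mathbb{F}_q$ having exactly $i$ roots in $\mathbb{P}^1(\mathbb{F}_q)$ and such that $w^2=f_4(x,y)$ has exactly $i+2j$ $\mathbb{F}_q$-points; that is, $f_4$ takes non-zero square values at $j$ points of $\mathbb{P}^1(\mathbb{F}_q)$ and non-square values at $k$ points (the value being well defined up to non-zero squares). Then $\mathrm{QR}_{C_{1,4}}(X,Y,Z)=\sum_{i+j+k=q+1}A_{i,j,k}X^iY^jZ^k$. $\mathrm{QR}^{S}_{C_{1,4}}(X,Y,Z)$ is the contribution to this sum from quartics $f_4$ having distinct roots over $\overline{\mathbb{F}}_q$ (four distinct roots in $\mathbb{P}^1(\overline{\mathbb{F}}_q)$). $N_A(t)=\sum_E 1/|\mathrm{Aut}_{\mathbb{F}_q}(E)|$, the sum over $\mathbb{F}_q$-isomorphism classes of elliptic curves $E/\mathbb{F}_q$ with $\#E(\mathbb{F}_q)=q+1-t$. $N_{A,2\times2}(t)$ is the same weighted sum restricted to those classes with $E(\mathbb{F}_q)[2]\cong\mathbb{Z}/2\mathbb{Z}\times\mathbb{Z}/2\mathbb{Z}$. Terms whose coefficient is $0$ are omitted. *)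

theory Defs
  imports
    "HOL-Algebra.Algebraic_Closure_Type"
    "HOL-Algebra.Elementary_Groups"
    "HOL-Library.Poly_Mapping"
    "HOL-Library.Cardinality"
    "HOL-Number_Theory.Cong"
begin

section \<open>The projective line\<close>

definition proj_rel :: "(('a::field \<times> 'a) \<times> ('a \<times> 'a)) set" where
  "proj_rel = {((x, y), (x', y')). (x, y) \<noteq> (0, 0) \<and> (\<exists>c. c \<noteq> 0 \<and> x' = c * x \<and> y' = c * y)}"

definition proj_line :: "('a::field \<times> 'a) set set" where
  "proj_line = (UNIV - {(0, 0)}) // proj_rel"

section \<open>Binary quartic forms\<close>

text \<open>\<open>Quartic a b c d e\<close> is the form
  \<open>a x\<^sup>4 + b x\<^sup>3 y + c x\<^sup>2 y\<^sup>2 + d x y\<^sup>3 + e y\<^sup>4\<close>; the zero form is included.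
  Extension of scalars to the algebraic closure is \<open>map_quartic to_ac\<close>.\<close>

datatype 'a quartic = Quartic 'a 'a 'a 'a 'a

fun quartic_eval :: "'a::comm_ring_1 quartic \<Rightarrow> 'a \<times> 'a \<Rightarrow> 'a" where
  "quartic_eval (Quartic a b c d e) (x, y) =
     a * x ^ 4 + b * x ^ 3 * y + c * x ^ 2 * y ^ 2 + d * x * y ^ 3 + e * y ^ 4"

text \<open>Scaling a representative by \<open>c\<close> multiplies the value by \<open>c\<^sup>4\<close>, so the following three
  sets do not depend on the representatives, and they partition the projective line.\<close>

definition quartic_roots :: "'a::field quartic \<Rightarrow> ('a \<times> 'a) set set" where
  "quartic_roots f = {P \<in> proj_line. \<forall>v\<in>P. quartic_eval f v = 0}"

definition quartic_squares :: "'a::field quartic \<Rightarrow> ('a \<times> 'a) set set" where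
  "quartic_squares f = {P \<in> proj_line. \<forall>v\<in>P. \<exists>w. w \<noteq> 0 \<and> quartic_eval f v = w ^ 2}"

definition quartic_nonsquares :: "'a::field quartic \<Rightarrow> ('a \<times> 'a) set set" where
  "quartic_nonsquares f = {P \<in> proj_line. \<forall>v\<in>P. \<not> (\<exists>w. quartic_eval f v = w ^ 2)}"

definition has_distinct_roots :: "'a::field quartic \<Rightarrow> bool" where
  "has_distinct_roots f \<longleftrightarrow> card (quartic_roots (map_quartic to_ac f)) = 4"

section \<open>Quadratic residue weight enumerators\<close>

text \<open>Polynomials with rational coefficients in indeterminates indexed by \<^typ>\<open>nat\<close>, of which only
  the first three are used. A monomial is its finitely supported exponent vector.\<close>

type_synonym qpoly = "(nat \<Rightarrow>\<^sub>0 nat) \<Rightarrow>\<^sub>0 rat"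

definition indet :: "nat \<Rightarrow> qpoly" where
  "indet n = Poly_Mapping.single (Poly_Mapping.single n 1) 1"

definition const_qpoly :: "rat \<Rightarrow> qpoly" where
  "const_qpoly c = Poly_Mapping.single 0 c"

abbreviation (input) X_var :: qpoly where "X_var \<equiv> indet 0"
abbreviation (input) Y_var :: qpoly where "Y_var \<equiv> indet 1"
abbreviation (input) Z_var :: qpoly where "Z_var \<equiv> indet 2"

definition QR_count :: "'a::{field,finite} quartic set \<Rightarrow> nat \<Rightarrow> nat \<Rightarrow> nat \<Rightarrow> nat" where
  "QR_count S i j k = card {f \<in> S. card (quartic_roots f) = i \<and>
     card (quartic_squares f) = j \<and> card (quartic_nonsquares f) = k}"

definition QR_enumerator :: "'a::{field,finite} quartic set \<Rightarrow> qpoly" where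
  "QR_enumerator S =
     (\<Sum>(i, j, k) \<in> {(i, j, k). i + j + k = CARD('a) + 1}.
        const_qpoly (of_nat (QR_count S i j k)) * X_var ^ i * Y_var ^ j * Z_var ^ k)"

text \<open>The enumerator of all quartics, and its contribution from quartics with distinct roots.\<close>

definition QR_C14 :: "'a::{field,finite} itself \<Rightarrow> qpoly" where
  "QR_C14 _ = QR_enumerator (UNIV :: 'a quartic set)"

definition QRS_C14 :: "'a::{field,finite} itself \<Rightarrow> qpoly" where
  "QRS_C14 _ = QR_enumerator {f :: 'a quartic. has_distinct_roots f}"

section \<open>Elliptic curves\<close>

text \<open>Affine part \<open>y\<^sup>2 + a\<^sub>1 x y + a\<^sub>3 y = x\<^sup>3 + a\<^sub>2 x\<^sup>2 + a\<^sub>4 x + a\<^sub>6\<close> of a projective Weierstrass cubic;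
  its only point at infinity is always smooth.\<close>

datatype 'a weierstrass =
  Weierstrass (a1: 'a) (a2: 'a) (a3: 'a) (a4: 'a) (a6: 'a)

definition w_poly :: "'a::comm_ring_1 weierstrass \<Rightarrow> 'a \<Rightarrow> 'a \<Rightarrow> 'a" where
  "w_poly E x y = y ^ 2 + a1 E * x * y + a3 E * y - (x ^ 3 + a2 E * x ^ 2 + a4 E * x + a6 E)"

text \<open>The two partial derivatives of \<open>w_poly E\<close>.\<close>

definition w_poly_dx :: "'a::comm_ring_1 weierstrass \<Rightarrow> 'a \<Rightarrow> 'a \<Rightarrow> 'a" where
  "w_poly_dx E x y = a1 E * y - (3 * x ^ 2 + 2 * a2 E * x + a4 E)"

definition w_poly_dy :: "'a::comm_ring_1 weierstrass \<Rightarrow> 'a \<Rightarrow> 'a \<Rightarrow> 'a" where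
  "w_poly_dy E x y = 2 * y + a1 E * x + a3 E"

text \<open>Geometric smoothness: no singular point over the algebraic closure.\<close>

definition elliptic :: "'a::field weierstrass \<Rightarrow> bool" where
  "elliptic E \<longleftrightarrow> (let E' = map_weierstrass to_ac E in
     \<not> (\<exists>x y. w_poly E' x y = 0 \<and> w_poly_dx E' x y = 0 \<and> w_poly_dy E' x y = 0))"

datatype 'a ec_point = Infinity | Affine 'a 'a

fun on_curve :: "'a::field weierstrass \<Rightarrow> 'a ec_point \<Rightarrow> bool" where
  "on_curve E Infinity \<longleftrightarrow> True"
| "on_curve E (Affine x y) \<longleftrightarrow> w_poly E x y = 0"

text \<open>Chord and tangent law: \<open>l\<close> is the slope of the line through the two points.\<close>

fun ec_add :: "'a::field weierstrass \<Rightarrow> 'a ec_point \<Rightarrow> 'a ec_point \<Rightarrow> 'a ec_point" where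
  "ec_add E Infinity Q = Q"
| "ec_add E (Affine x1 y1) Infinity = Affine x1 y1"
| "ec_add E (Affine x1 y1) (Affine x2 y2) =
     (if x1 = x2 \<and> y1 + y2 + a1 E * x2 + a3 E = 0 then Infinity
      else let l = (if x1 = x2
                    then (3 * x1 ^ 2 + 2 * a2 E * x1 + a4 E - a1 E * y1) / (2 * y1 + a1 E * x1 + a3 E)
                    else (y2 - y1) / (x2 - x1));
               x3 = l ^ 2 + a1 E * l - a2 E - x1 - x2;
               y3 = l * (x1 - x3) - y1 - a1 E * x3 - a3 E
           in Affine x3 y3)"

definition ec_group :: "'a::field weierstrass \<Rightarrow> 'a ec_point monoid" where
  "ec_group E = \<lparr>carrier = {P. on_curve E P}, monoid.mult = ec_add E, one = Infinity\<rparr>"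

definition two_torsion :: "'a::field weierstrass \<Rightarrow> 'a ec_point monoid" where
  "two_torsion E = (ec_group E)
     \<lparr>carrier := {P \<in> carrier (ec_group E). P [^]\<^bsub>ec_group E\<^esub> (2::nat) = \<one>\<^bsub>ec_group E\<^esub>}\<rparr>"

text \<open>Isomorphisms of Weierstrass curves over the base field are the substitutions
  \<open>x = u\<^sup>2 x' + r\<close>, \<open>y = u\<^sup>3 y' + s u\<^sup>2 x' + t\<close> with \<open>u \<noteq> 0\<close>; the next definition compares coefficients,
  see the lemma that follows it.\<close>

fun ec_iso :: "'a::field weierstrass \<Rightarrow> 'a weierstrass \<Rightarrow> 'a \<times> 'a \<times> 'a \<times> 'a \<Rightarrow> bool" where
  "ec_iso E E' (u, r, s, t) \<longleftrightarrow> u \<noteq> 0 \<and>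
     u * a1 E' = a1 E + 2 * s \<and>
     u ^ 2 * a2 E' = a2 E - s * a1 E + 3 * r - s ^ 2 \<and>
     u ^ 3 * a3 E' = a3 E + r * a1 E + 2 * t \<and>
     u ^ 4 * a4 E' = a4 E - s * a3 E + 2 * r * a2 E - (t + r * s) * a1 E + 3 * r ^ 2 - 2 * s * t \<and>
     u ^ 6 * a6 E' = a6 E + r * a4 E + r ^ 2 * a2 E + r ^ 3 - t * a3 E - t ^ 2 - r * t * a1 E"

lemma ec_iso_substitution:
  assumes "ec_iso E E' (u, r, s, t)"
  shows "w_poly E (u ^ 2 * x + r) (u ^ 3 * y + s * u ^ 2 * x + t) = u ^ 6 * w_poly E' x y"
proof -
  have "u ^ 6 * w_poly E' x y =
      u ^ 6 * y ^ 2 + u ^ 5 * x * y * (u * a1 E') + u ^ 3 * y * (u ^ 3 * a3 E')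
      - (u ^ 6 * x ^ 3 + u ^ 4 * x ^ 2 * (u ^ 2 * a2 E') + u ^ 2 * x * (u ^ 4 * a4 E')
         + u ^ 6 * a6 E')"
    by (simp add: w_poly_def algebra_simps eval_nat_numeral)
  also have "\<dots> = w_poly E (u ^ 2 * x + r) (u ^ 3 * y + s * u ^ 2 * x + t)"
    using assms unfolding ec_iso.simps
    by (simp only:) (simp add: w_poly_def algebra_simps eval_nat_numeral)
  finally show ?thesis by simp
qed

definition ec_isomorphic :: "('a::field weierstrass \<times> 'a weierstrass) set" where
  "ec_isomorphic = {(E, E'). elliptic E \<and> elliptic E' \<and> (\<exists>\<phi>. ec_iso E E' \<phi>)}"

definition ec_Aut :: "'a::field weierstrass \<Rightarrow> ('a \<times> 'a \<times> 'a \<times> 'a) set" where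
  "ec_Aut E = {\<phi>. ec_iso E E \<phi>}"

definition mass :: "'a::{field,finite} weierstrass set \<Rightarrow> rat" where
  "mass S = (\<Sum>C \<in> S // ec_isomorphic. 1 / of_nat (card (ec_Aut (SOME E. E \<in> C))))"

definition curves_of_trace :: "int \<Rightarrow> 'a::{field,finite} weierstrass set" where
  "curves_of_trace t =
     {E. elliptic E \<and> int (card (carrier (ec_group E))) = int CARD('a) + 1 - t}"

definition N_A :: "'a::{field,finite} itself \<Rightarrow> int \<Rightarrow> rat" where
  "N_A _ t = mass (curves_of_trace t :: 'a weierstrass set)"

definition N_A_2x2 :: "'a::{field,finite} itself \<Rightarrow> int \<Rightarrow> rat" where
  "N_A_2x2 _ t = mass {E :: 'a weierstrass. E \<in> curves_of_trace t \<and>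
     two_torsion E \<cong> integer_mod_group 2 \<times>\<times> integer_mod_group 2}"

text \<open>The exponents in the main statement are integers; when one of them is negative,
  the coefficient in front of the monomial vanishes, so truncation by \<^const>\<open>nat\<close> is harmless.\<close>

definition monom3 :: "int \<Rightarrow> int \<Rightarrow> int \<Rightarrow> qpoly" where
  "monom3 i j k = X_var ^ nat i * Y_var ^ nat j * Z_var ^ nat k"

end

theory Submission
  imports Defs "HOL-Number_Theory.Residues"
begin


text \<open>
  Fix \<open>q\<close> and a number \<open>N\<close>. Write \<open>S\<close> for the set of quartics \<open>f\<close> with distinct roots for which
  \<open>w\<^sup>2 = f(x, y)\<close> has \<open>N\<close> points, and \<open>W\<close> for the set of smooth Weierstrass equations with \<open>N\<close>
  points (the point at infinity included). Everything follows from comparing \<open>S\<close> with \<open>W\<close> and from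
  the Hasse bound.

  Mass and equations. The substitutions \<open>(u, r, s, t)\<close> form a group of order \<open>(q - 1) q\<^sup>3\<close>, so by
  orbit-stabilizer the sum of \<open>1 / |Aut|\<close> over the classes in an isomorphism-closed set of equations
  is the number of equations divided by \<open>(q - 1) q\<^sup>3\<close> (\<open>mass_eq_card\<close>).

  Quartics with a rational root. Counting pairs of a quartic and one of its roots, and moving the
  root to infinity, leaves the quartics without \<open>x\<^sup>4\<close> term. Up to scaling these are monic separable
  cubics, i.e. Weierstrass equations after completing the square, and \<open>i\<close> roots of the quartic
  become \<open>i - 1\<close> nontrivial two-torsion points of the curve. If \<open>S\<^sub>i\<close> and \<open>W\<^sub>i\<close> are the subsets with \<open>i\<close>
  rational roots and with \<open>i\<close> nontrivial rational two-torsion points, this gives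
  \<open>i |S\<^sub>i| q\<^sup>2 = (q\<^sup>2 - 1) |W\<^sub>i\<^sub>-\<^sub>1|\<close> (\<open>card_quartics_with_roots\<close>).

  All quartics. Count pairs of a quartic in \<open>S\<close> and a point of its curve. If \<open>w = 0\<close> at the point,
  the previous paragraph applies. If \<open>w \<noteq> 0\<close>, the point can be moved to infinity and the quartic
  scaled to be monic. A monic quartic is the discriminant of the equation that the line of slope
  \<open>m\<close> through the origin of a Weierstrass curve through the origin imposes on the two further
  intersections. This sets up a bijection between monic quartics with distinct roots and smooth
  equations with \<open>a\<^sub>6 = 0\<close> that preserves the number of points (\<open>card_monic\<close>), and a translation
  moves any affine point to the origin (\<open>sum_affine_points\<close>). Altogether
  \<open>N |S| q\<^sup>2 = (q\<^sup>2 - 1) (|W| + (N - 1) |W|)\<close>, so \<open>|S| q\<^sup>2 = (q\<^sup>2 - 1) |W|\<close> for \<open>N > 0\<close>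
  (\<open>card_quartics_with\<close>). For \<open>N = 0\<close> a quadratic twist would have \<open>2 q + 2\<close> points, which is more
  than a Weierstrass curve can have (\<open>quartics_with_0\<close>). The quartics without rational roots are
  what remains, and parity together with the fact that a separable cubic cannot have exactly two
  rational roots determines which \<open>i\<close> occur.

  The Hasse bound says that the traces outside of \<open>t\<^sup>2 \<le> 4 q\<close> do not contribute. The proof
  (\<open>hasse_bound\<close>) is Manin's: over the function field in one variable \<open>T\<close>, on the twist
  \<open>f(T) y\<^sup>2 = f(x)\<close>, consider the points \<open>(T\<^sup>q, f(T)\<^sup>(\<^sup>q\<^sup>-\<^sup>1\<^sup>)\<^sup>/\<^sup>2) + n (T, 1)\<close>. The degree of the numerator of
  the abscissa is a quadratic polynomial in \<open>n\<close> whose discriminant is \<open>t\<^sup>2 - 4 q\<close>, and it is never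
  negative. Only abscissae are used, so that the group law is not needed.
\<close>

section \<open>Abscissae of sums and differences\<close>

text \<open>
  Let \<open>P\<close> and \<open>Q\<close> be points of a (twist of a) curve \<open>y\<^sup>2 = x\<^sup>3 + a x\<^sup>2 + b x + c\<close> with abscissae
  \<open>n / d\<close> and \<open>t\<close>. The abscissae of \<open>P + Q\<close> and \<open>P - Q\<close> have product \<open>kumA / kumC\<close> and sum
  \<open>kumB / kumC\<close>. The three forms are quadratic in \<open>(n, d)\<close>, and \<open>d = 0\<close> stands for the point at
  infinity.
\<close>

definition kumA :: "'r::comm_ring_1 \<Rightarrow> 'r \<Rightarrow> 'r \<Rightarrow> 'r \<Rightarrow> 'r \<Rightarrow> 'r \<Rightarrow> 'r" where
  "kumA a b c t n d = (n * t - b * d)\<^sup>2 - 4 * c * d * (n + t * d + a * d)"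

definition kumB :: "'r::comm_ring_1 \<Rightarrow> 'r \<Rightarrow> 'r \<Rightarrow> 'r \<Rightarrow> 'r \<Rightarrow> 'r \<Rightarrow> 'r" where
  "kumB a b c t n d = 2 * ((n + t * d) * (n * t + b * d) + 2 * a * n * t * d + 2 * c * d\<^sup>2)"

definition kumC :: "'r::comm_ring_1 \<Rightarrow> 'r \<Rightarrow> 'r \<Rightarrow> 'r" where
  "kumC t n d = (n - t * d)\<^sup>2"

text \<open>The monic cubic on the right hand side, and its derivative.\<close>

definition cubic :: "'r::comm_ring_1 \<Rightarrow> 'r \<Rightarrow> 'r \<Rightarrow> 'r \<Rightarrow> 'r" where
  "cubic a b c x = x ^ 3 + a * x\<^sup>2 + b * x + c"

definition cubic' :: "'r::comm_ring_1 \<Rightarrow> 'r \<Rightarrow> 'r \<Rightarrow> 'r" where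
  "cubic' a b x = 3 * x\<^sup>2 + 2 * a * x + b"

text \<open>The quadratic form whose zeros \<open>x / y\<close> are the abscissae of \<open>P + Q\<close> and \<open>P - Q\<close>. It vanishes
  exactly if the three abscissae \<open>n / d\<close>, \<open>t\<close>, \<open>x / y\<close> belong to points with sum zero for some
  choice of signs, which explains the symmetry below.\<close>

definition kum_rel :: "'r::comm_ring_1 \<Rightarrow> 'r \<Rightarrow> 'r \<Rightarrow> 'r \<Rightarrow> 'r \<Rightarrow> 'r \<Rightarrow> 'r \<Rightarrow> 'r \<Rightarrow> 'r" where
  "kum_rel a b c t n d x y = kumA a b c t n d * y\<^sup>2 - kumB a b c t n d * x * y + kumC t n d * x\<^sup>2"

lemma kum_rel_sym: "kum_rel a b c t n d x y = kum_rel a b c t x y n d"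
  unfolding kum_rel_def kumA_def kumB_def kumC_def
  by (simp add: algebra_simps power2_eq_square)

text \<open>In the starting step \<open>n = t\<^sup>q\<close>, and the discriminant becomes a perfect square.\<close>

lemma kum_discriminant:
  "(kumB a b c t n 1)\<^sup>2 - 4 * kumA a b c t n 1 * kumC t n 1 = 16 * cubic a b c n * cubic a b c t"
  unfolding kumA_def kumB_def kumC_def cubic_def
  by (simp add: algebra_simps power2_eq_square power3_eq_cube)

text \<open>For a separable cubic the fraction formulas for sum and product are in lowest terms as soon as
  \<open>n / d\<close> is. If the third
  form vanishes then \<open>n / d = t\<close>, and the other two become numerator and denominator of the
  duplication formula.\<close>

lemma kum_no_common_zero:
  fixes a b c t n d :: "'r::field"
  assumes two: "(2::'r) \<noteq> 0"
    and sep: "\<not> (cubic a b c t = 0 \<and> cubic' a b t = 0)"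
    and nd: "\<not> (n = 0 \<and> d = 0)"
  shows "\<not> (kumA a b c t n d = 0 \<and> kumB a b c t n d = 0 \<and> kumC t n d = 0)"
proof
  assume *: "kumA a b c t n d = 0 \<and> kumB a b c t n d = 0 \<and> kumC t n d = 0"
  have n: "n = t * d" using * by (simp add: kumC_def)
  have d: "d \<noteq> 0" using n nd by auto
  have "kumB a b c t n d = 2 * (2 * d\<^sup>2 * cubic a b c t)"
    unfolding n kumB_def cubic_def by (simp add: algebra_simps power2_eq_square power3_eq_cube)
  hence f: "cubic a b c t = 0" using * two d by (metis mult_eq_0_iff zero_eq_power2)
  have "kumA a b c t n d = d\<^sup>2 * ((cubic' a b t)\<^sup>2 - (8 * t + 4 * a) * cubic a b c t)"
    unfolding n kumA_def cubic_def cubic'_def by (simp add: algebra_simps power2_eq_square power3_eq_cube)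
  hence "cubic' a b t = 0" using * d f by simp
  thus False using f sep by blast
qed

lemma poly_kum:
  "poly (kumA a b c t n d) z = kumA (poly a z) (poly b z) (poly c z) (poly t z) (poly n z) (poly d z)"
  "poly (kumB a b c t n d) z = kumB (poly a z) (poly b z) (poly c z) (poly t z) (poly n z) (poly d z)"
  "poly (kumC t n d) z = kumC (poly t z) (poly n z) (poly d z)"
  "poly (cubic a b c t) z = cubic (poly a z) (poly b z) (poly c z) (poly t z)"
  by (simp_all add: kumA_def kumB_def kumC_def cubic_def)

text \<open>A projective abscissa \<open>(N : D)\<close> over the rational function field with a pole at infinity. The point at
  infinity of the curve is represented with \<open>D = 0\<close>; it needs a separate clause because the degree
  of the zero polynomial is \<open>0\<close>.\<close>

definition proper_frac :: "'b::field poly \<Rightarrow> 'b poly \<Rightarrow> bool" where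
  "proper_frac N D \<longleftrightarrow> N \<noteq> 0 \<and> (D = 0 \<or> degree D < degree N)"

text \<open>Coprimality of numerator and denominator, in a form that can be checked by evaluation. It is
  meant for algebraically closed coefficient fields, see the next lemma.\<close>

definition no_common_root :: "'b::field poly \<Rightarrow> 'b poly \<Rightarrow> bool" where
  "no_common_root N D \<longleftrightarrow> \<not> (\<exists>z. poly N z = 0 \<and> poly D z = 0)"

lemma no_common_root_coprime:
  fixes N D :: "'b::{alg_closed_field, field_gcd} poly"
  assumes "no_common_root N D"
  shows "coprime N D"
proof (rule ccontr)
  assume "\<not> coprime N D"
  hence nu: "\<not> is_unit (gcd N D)" by (simp add: coprime_iff_gcd_eq_1)
  have "\<exists>z. poly (gcd N D) z = 0"
  proof (cases "gcd N D = 0")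
    case False
    hence "degree (gcd N D) > 0" using nu is_unit_iff_degree[OF False] by blast
    thus ?thesis using alg_closed_imp_poly_has_root by blast
  qed auto
  then obtain z where z: "poly (gcd N D) z = 0" by blast
  have "poly N z = 0" "poly D z = 0" using z by (meson gcd_dvd1 gcd_dvd2 dvdE poly_eq_0_iff_dvd dvd_trans)+
  thus False using assms by (auto simp: no_common_root_def)
qed

text \<open>From here on the second abscissa is the variable \<open>T\<close>, represented as \<open>[:0, 1:]\<close>.\<close>

context
  fixes a b c :: "'b::{alg_closed_field, field_gcd}"
begin

abbreviation "pA \<equiv> kumA [:a:] [:b:] [:c:] [:0,1:]"
abbreviation "pB \<equiv> kumB [:a:] [:b:] [:c:] [:0,1:]"
abbreviation "pC \<equiv> kumC ([:0,1:]:: 'b poly)"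
abbreviation "pR \<equiv> kum_rel [:a:] [:b:] [:c:] [:0,1:]"

lemma degree_pA:
  assumes "proper_frac N D"
  shows "degree (pA N D) = 2 * degree N + 2" "pA N D \<noteq> 0"
proof -
  have N: "N \<noteq> 0" and D: "D = 0 \<or> degree D < degree N" using assms by (auto simp: proper_frac_def)
  have 1: "degree (N * [:0,1:]) = degree N + 1" using N by (simp add: degree_mult_eq)
  have 2: "degree ([:b:] * D) < degree N + 1" using D by (auto simp: le_imp_less_Suc intro: order.strict_trans1[OF degree_smult_le] less_SucI)
  have 3: "degree (N * [:0,1:] - [:b:] * D) = degree N + 1"
    using degree_add_eq_left[of "- ([:b:] * D)" "N * [:0,1:]"] 1 2 by simp
  have 4: "degree ((N * [:0,1:] - [:b:] * D)\<^sup>2) = 2 * degree N + 2"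
  proof -
    have ne: "N * [:0,1:] - [:b:] * D \<noteq> 0" using 3 by (metis degree_0 Suc_eq_plus1 nat.distinct(1))
    show ?thesis using degree_mult_eq[OF ne ne] 3 by (simp only: power2_eq_square)
  qed
  have 5: "degree (4 * [:c:] * D * (N + [:0,1:] * D + [:a:] * D)) < 2 * degree N + 2"
  proof (cases "D = 0")
    case False
    hence dD: "degree D < degree N" using D by auto
    have "degree (N + [:0,1:] * D + [:a:] * D) \<le> degree N"
      using dD by (intro degree_add_le order.trans[OF degree_mult_le]) auto
    moreover have "degree (4 * [:c:] * D) \<le> degree D"
      by (simp add: numeral_poly)
    ultimately show ?thesis using dD degree_mult_le[of "4 * [:c:] * D" "N + [:0,1:] * D + [:a:] * D"] by linarith
  qed auto
  show A: "degree (pA N D) = 2 * degree N + 2"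
    unfolding kumA_def using degree_add_eq_left[of "- (4 * [:c:] * D * (N + [:0,1:] * D + [:a:] * D))" "(N * [:0,1:] - [:b:] * D)\<^sup>2"] 4 5
    by simp
  show "pA N D \<noteq> 0" using A by auto
qed

lemma degree_pB:
  assumes "proper_frac N D"
  shows "degree (pB N D) \<le> 2 * degree N + 1"
proof -
  have N: "N \<noteq> 0" and D: "D = 0 \<or> degree D < degree N" using assms by (auto simp: proper_frac_def)
  show ?thesis
  proof (cases "D = 0")
    case True
    have "degree (2 * (N * (N * [:0,1:]))) \<le> 2 * degree N + 1"
      using N by (intro order.trans[OF degree_mult_le]) (auto simp: numeral_poly degree_mult_eq)
    thus ?thesis using True by (simp add: kumB_def)
  next
    case False
    hence dD: "degree D < degree N" using D by auto
    have 1: "degree (N + [:0,1:] * D) \<le> degree N"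
      using dD by (intro degree_add_le order.trans[OF degree_mult_le]) auto
    have 2: "degree (N * [:0,1:] + [:b:] * D) \<le> degree N + 1"
      using dD by (intro degree_add_le order.trans[OF degree_mult_le]) auto
    have 3: "degree ((N + [:0,1:] * D) * (N * [:0,1:] + [:b:] * D)) \<le> 2 * degree N + 1"
      using degree_mult_le[of "N + [:0,1:] * D" "N * [:0,1:] + [:b:] * D"] 1 2 by linarith
    have "degree (2 * [:a:] * N * [:0,1:]) \<le> degree N + 1"
      by (intro order.trans[OF degree_mult_le]) (auto simp: numeral_poly)
    hence 4: "degree (2 * [:a:] * N * [:0,1:] * D) \<le> 2 * degree N + 1"
      using degree_mult_le[of "2 * [:a:] * N * [:0,1:]" D] dD by linarith
    have 5: "degree (2 * [:c:] * D\<^sup>2) \<le> 2 * degree N + 1"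
    proof -
      have "degree (2 * [:c:] * D\<^sup>2) \<le> degree (D\<^sup>2)" by (simp add: numeral_poly)
      also have "\<dots> \<le> 2 * degree D" using degree_power_le[of D 2] by (simp add: mult.commute)
      finally show ?thesis using dD by linarith
    qed
    show ?thesis unfolding kumB_def using 3 4 5
      by (intro order.trans[OF degree_mult_le]) (auto simp: numeral_poly intro!: degree_add_le)
  qed
qed

text \<open>Let \<open>(P : M)\<close> and \<open>(Q : E)\<close> be the abscissae obtained by adding and subtracting \<open>(T, 1)\<close> from a
  point with abscissa \<open>(N : D)\<close>. Because the factorizations hold exactly and not only up to a common
  factor, the degrees of the numerators satisfy the parallelogram law with increment \<open>2\<close>.\<close>

lemma kum_step_props:
  assumes two: "(2::'b) \<noteq> 0"
    and sep: "\<And>z. \<not> (cubic a b c z = 0 \<and> cubic' a b z = 0)"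
    and pf: "proper_frac N D" "no_common_root N D"
    and pf': "proper_frac Q E"
    and eq: "P * Q = pA N D" "P * E + Q * M = pB N D" "M * E = pC N D"
  shows "proper_frac P M" "no_common_root P M" "degree P + degree Q = 2 * degree N + 2"
proof -
  have Q: "Q \<noteq> 0" and E: "E = 0 \<or> degree E < degree Q" using pf' by (auto simp: proper_frac_def)
  have P: "P \<noteq> 0" using eq(1) degree_pA(2)[OF pf(1)] by auto
  show deg: "degree P + degree Q = 2 * degree N + 2"
    using degree_pA(1)[OF pf(1)] eq(1) P Q degree_mult_eq[of P Q] by simp
  show "no_common_root P M"
    unfolding no_common_root_def
  proof
    assume "\<exists>z. poly P z = 0 \<and> poly M z = 0"
    then obtain z where z: "poly P z = 0" "poly M z = 0" by blast
    have "poly (pA N D) z = 0" "poly (pB N D) z = 0" "poly (pC N D) z = 0"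
      unfolding eq[symmetric] using z by simp_all
    moreover have "\<not> (poly N z = 0 \<and> poly D z = 0)" using pf(2) by (auto simp: no_common_root_def)
    ultimately show False
      using kum_no_common_zero[OF two sep, of "poly N z" "poly D z" z] by (simp add: poly_kum)
  qed
  show "proper_frac P M"
  proof (rule ccontr)
    assume "\<not> proper_frac P M"
    hence M: "M \<noteq> 0" "degree M \<ge> degree P" using P by (auto simp: proper_frac_def)
    have QM: "degree (Q * M) \<ge> 2 * degree N + 2" using degree_mult_eq[OF Q M(1)] M(2) deg by simp
    have "degree (P * E) < degree (Q * M)"
      using E P QM degree_mult_le[of P E] deg by (cases "E = 0") auto
    hence "degree (pB N D) \<ge> 2 * degree N + 2"
      using QM degree_add_eq_right[of "P * E" "Q * M"] eq(2) by simp
    thus False using degree_pB[OF pf(1)] by simp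
  qed
qed

text \<open>One of the two neighbours \<open>(Q : E)\<close> in the arithmetic progression determines the other one
  \<open>(P : M)\<close>, by Vieta.\<close>

lemma kum_next:
  assumes pf: "proper_frac N D" "no_common_root N D"
    and pf': "proper_frac Q E" "no_common_root Q E"
    and R: "pR N D Q E = 0"
  obtains P M where "P * Q = pA N D" "P * E + Q * M = pB N D" "M * E = pC N D"
proof -
  have R': "pA N D * E\<^sup>2 - pB N D * Q * E + pC N D * Q\<^sup>2 = 0" using R by (simp add: kum_rel_def)
  have cop: "coprime Q E" using no_common_root_coprime[OF pf'(2)] .
  have Q: "Q \<noteq> 0" using pf' by (auto simp: proper_frac_def)
  have "Q * (pB N D * E - pC N D * Q) = pA N D * E\<^sup>2"
    using R' by (simp add: algebra_simps power2_eq_square)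
  hence "Q dvd pA N D * E\<^sup>2" by (metis dvd_triv_left)
  hence "Q dvd pA N D" using cop by (simp add: coprime_dvd_mult_left_iff)
  then obtain P where P: "pA N D = P * Q" by (metis dvdE mult.commute)
  have "E * (pB N D * Q - pA N D * E) = pC N D * Q\<^sup>2"
    using R' by (simp add: algebra_simps power2_eq_square)
  hence "E dvd pC N D * Q\<^sup>2" by (metis dvd_triv_left)
  hence "E dvd pC N D" using cop by (simp add: coprime_dvd_mult_left_iff coprime_commute)
  then obtain M where M: "pC N D = M * E" by (metis dvdE mult.commute)
  \<comment> \<open>If \<open>E = 0\<close> then \<open>Q\<close> is a unit, and the middle equation can be solved for \<open>M\<close> instead.\<close>
  show ?thesis
  proof (cases "E = 0")
    case False
    have "(P * E + Q * M - pB N D) * (Q * E) = 0"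
      using R' unfolding P M by (simp add: algebra_simps power2_eq_square)
    hence "P * E + Q * M = pB N D" using Q False by simp
    thus ?thesis using that P M by metis
  next
    case True
    have "is_unit Q" using cop True by simp
    then obtain M' where M': "pB N D = Q * M'" by (meson dvdE dvd_trans one_dvd)
    show ?thesis using that[of P M'] P M True M' by simp
  qed
qed

lemma kum_rel_next:
  assumes "P * Q = pA N D" "P * E + Q * M = pB N D" "M * E = pC N D"
  shows "pR P M N D = 0"
  unfolding kum_rel_sym[of _ _ _ _ P M] unfolding kum_rel_def assms[symmetric]
  by (simp add: algebra_simps power2_eq_square)

text \<open>Starting from two neighbours, the degrees along the progression are given by a quadratic
  polynomial, which is therefore nonnegative.\<close>

lemma kum_degree_nonneg:
  fixes q s :: int
  assumes two: "(2::'b) \<noteq> 0"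
    and sep: "\<And>z. \<not> (cubic a b c z = 0 \<and> cubic' a b z = 0)"
    and pf: "proper_frac N0 D0" "no_common_root N0 D0"
    and pf': "proper_frac N1 D1" "no_common_root N1 D1"
    and R: "pR N1 D1 N0 D0 = 0"
    and deg: "int (degree N0) = q" "int (degree N1) = q - s + 1"
  shows "q - s * int n + (int n)\<^sup>2 \<ge> 0"
proof -
  have "\<exists>N D P M. proper_frac N D \<and> no_common_root N D \<and> proper_frac P M \<and> no_common_root P M \<and>
     pR P M N D = 0 \<and> int (degree N) = q - s * int n + (int n)\<^sup>2 \<and>
     int (degree P) = q - s * int (Suc n) + (int (Suc n))\<^sup>2"
  proof (induction n)
    case 0
    show ?case by (rule exI[of _ N0], rule exI[of _ D0], rule exI[of _ N1], rule exI[of _ D1]) (use assms in simp)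
  next
    case (Suc n)
    then obtain Q E N D where IH: "proper_frac Q E" "no_common_root Q E" "proper_frac N D" "no_common_root N D"
     "pR N D Q E = 0" "int (degree Q) = q - s * int n + (int n)\<^sup>2"
     "int (degree N) = q - s * int (Suc n) + (int (Suc n))\<^sup>2" by blast
    obtain P M where PM: "P * Q = pA N D" "P * E + Q * M = pB N D" "M * E = pC N D"
      using kum_next[OF IH(3,4,1,2,5)] .
    note props = kum_step_props[OF two sep IH(3,4,1) PM]
    have "int (degree P) = q - s * int (Suc (Suc n)) + (int (Suc (Suc n)))\<^sup>2"
    proof -
      have "int (degree P) = 2 * int (degree N) + 2 - int (degree Q)" using props(3) by linarith
      thus ?thesis unfolding IH by (simp add: algebra_simps power2_eq_square)
    qed
    thus ?case using props IH kum_rel_next[OF PM] by blast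
  qed
  thus ?thesis by (metis of_nat_0_le_iff)
qed

end


text \<open>The algebraic closure has all ingredients of this class; the instance provides greatest common
  divisors of polynomials over it.\<close>

instance alg_closure :: (field) field_gcd ..

section \<open>Squares in a finite field of odd order\<close>

lemma finite_field_fermat:
  fixes x :: "'a::{field,finite}"
  assumes "x \<noteq> 0"
  shows "x ^ (CARD('a) - 1) = 1"
proof -
  let ?U = "UNIV - {0::'a}"
  have "(\<Prod>y\<in>?U. x * y) = (\<Prod>y\<in>?U. y)"
    by (rule prod.reindex_bij_witness[of _ "\<lambda>y. y / x" "\<lambda>y. x * y"]) (use assms in auto)
  moreover have "(\<Prod>y\<in>?U. x * y) = x ^ card ?U * (\<Prod>y\<in>?U. y)"
    by (simp only: prod.distrib prod_constant)
  moreover have "(\<Prod>y\<in>?U. y) \<noteq> 0" by simp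
  ultimately have "x ^ card ?U = 1" by simp
  thus ?thesis by (simp add: card_Diff_subset)
qed

lemma finite_field_power_card:
  fixes x :: "'a::{field,finite}"
  shows "x ^ CARD('a) = x"
proof (cases "x = 0")
  case False
  have "x ^ CARD('a) = x ^ Suc (CARD('a) - 1)" using zero_less_card_finite[where 'a='a] by simp
  thus ?thesis using finite_field_fermat[OF False] by (simp only: power_Suc mult_1_right)
qed simp

lemma odd_card_two_nonzero:
  assumes "odd (CARD('a::{field,finite}))"
  shows "(2::'a) \<noteq> 0"
proof
  assume "(2::'a) = 0"
  hence "CHAR('a) dvd 2" using of_nat_eq_0_iff_char_dvd[of 2, where 'a='a] by simp
  moreover have "CHAR('a) \<noteq> 1" by simp
  ultimately have "CHAR('a) = 2" using prime_nat_iff two_is_prime_nat by blast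
  thus False using CHAR_dvd_CARD[where 'a='a] assms by simp
qed

text \<open>Being a nonzero square.\<close>

definition nz_square :: "'a::field \<Rightarrow> bool" where
  "nz_square x \<longleftrightarrow> (\<exists>w. w \<noteq> 0 \<and> x = w ^ 2)"

lemma card_square_roots:
  fixes x :: "'a::{field,finite}"
  assumes "odd (CARD('a))"
  shows "card {w. w ^ 2 = x} = (if x = 0 then 1 else if nz_square x then 2 else 0)"
proof -
  consider "x = 0" | "x \<noteq> 0" "nz_square x" | "x \<noteq> 0" "\<not> nz_square x" by blast
  thus ?thesis
  proof cases
    case 1
    hence "{w. w ^ 2 = x} = {0}" by auto
    thus ?thesis using 1 by simp
  next
    case 2
    then obtain w where w: "w \<noteq> 0" "x = w ^ 2" by (auto simp: nz_square_def)
    have "{v. v ^ 2 = x} = {w, - w}" using w by (auto simp: power2_eq_iff)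
    moreover have "w \<noteq> - w"
    proof
      assume "w = - w"
      hence "2 * w = 0" by (metis add.right_inverse mult_2)
      thus False using odd_card_two_nonzero[OF assms] w by simp
    qed
    ultimately show ?thesis using 2 by simp
  next
    case 3
    hence "{w. w ^ 2 = x} = {}" by (auto simp: nz_square_def)
    thus ?thesis using 3 by (metis card.empty)
  qed
qed

lemma card_nz_squares:
  assumes "odd (CARD('a::{field,finite}))"
  shows "2 * card {x::'a. nz_square x} = CARD('a) - 1"
proof -
  have "CARD('a) - 1 = card (UNIV - {0::'a})" by (simp add: card_Diff_subset)
  also have "UNIV - {0::'a} = (\<Union>x\<in>{x. nz_square x}. {w. w ^ 2 = x})"
    by (auto simp: nz_square_def)
  also have "card \<dots> = (\<Sum>x\<in>{x::'a. nz_square x}. card {w. w ^ 2 = x})"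
    by (rule card_UN_disjoint) auto
  also have "\<dots> = (\<Sum>x\<in>{x::'a. nz_square x}. 2)"
    by (rule sum.cong) (auto simp: card_square_roots[OF assms], auto simp: nz_square_def)
  finally show ?thesis by simp
qed

lemma nz_square_power:
  fixes x :: "'a::{field,finite}"
  assumes "odd (CARD('a))" and "nz_square x"
  shows "x ^ ((CARD('a) - 1) div 2) = 1"
proof -
  obtain w where w: "w \<noteq> 0" "x = w ^ 2" using assms by (auto simp: nz_square_def)
  have "x ^ ((CARD('a) - 1) div 2) = w ^ (2 * ((CARD('a) - 1) div 2))" unfolding w by (simp add: power_mult)
  also have "2 * ((CARD('a) - 1) div 2) = CARD('a) - 1" using assms(1) by simp
  finally show ?thesis using finite_field_fermat[OF w(1)] by simp
qed

lemma euler_criterion: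
  fixes x :: "'a::{field,finite}"
  assumes odd: "odd (CARD('a))"
  shows "nz_square x \<longleftrightarrow> x \<noteq> 0 \<and> x ^ ((CARD('a) - 1) div 2) = 1"
proof -
  define m where "m = (CARD('a) - 1) div 2"
  have "card {0::'a, 1} \<le> CARD('a)" by (rule card_mono) auto
  hence "CARD('a) \<ge> 2" by simp
  hence m: "m > 0" using odd by (auto simp: m_def elim!: oddE)
  define p where "p = monom (1::'a) m - 1"
  have ev: "poly p y = y ^ m - 1" for y by (simp add: p_def poly_monom)
  have p0: "p \<noteq> 0" using ev[of 0] m by (auto simp: power_0_left)
  have "degree p \<le> m" unfolding p_def by (intro degree_diff_le degree_monom_le) auto
  hence "card {y. poly p y = 0} \<le> m" using card_poly_roots_bound[OF p0] by linarith
  moreover have "card {x::'a. nz_square x} = m" using card_nz_squares[OF odd] by (simp add: m_def)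
  moreover have sub: "{x::'a. nz_square x} \<subseteq> {y. poly p y = 0}"
    using nz_square_power[OF odd] by (auto simp: ev m_def)
  ultimately have "{x::'a. nz_square x} = {y. poly p y = 0}"
    by (metis (no_types, lifting) card_seteq finite)
  moreover have "nz_square x \<Longrightarrow> x \<noteq> 0" by (auto simp: nz_square_def)
  ultimately show ?thesis by (auto simp: ev m_def)
qed

lemma nonsquare_power:
  fixes x :: "'a::{field,finite}"
  assumes odd: "odd (CARD('a))" and "x \<noteq> 0" "\<not> nz_square x"
  shows "x ^ ((CARD('a) - 1) div 2) = - 1"
proof -
  have "(x ^ ((CARD('a) - 1) div 2)) ^ 2 = x ^ (2 * ((CARD('a) - 1) div 2))" by (simp add: power_mult[symmetric] mult.commute)
  also have "2 * ((CARD('a) - 1) div 2) = CARD('a) - 1" using odd by simp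
  finally have "(x ^ ((CARD('a) - 1) div 2)) ^ 2 = 1" using finite_field_fermat[OF assms(2)] by simp
  thus ?thesis using assms euler_criterion[OF odd, of x] by (simp add: power2_eq_1_iff)
qed

lemma nonsquare_mult_nonsquare:
  fixes x y :: "'a::{field,finite}"
  assumes odd: "odd (CARD('a))" and "x \<noteq> 0" "\<not> nz_square x" "y \<noteq> 0" "\<not> nz_square y"
  shows "nz_square (x * y)"
  using assms nonsquare_power[OF odd] by (simp add: euler_criterion[OF odd, of "x * y"] power_mult_distrib)

section \<open>The Hasse bound\<close>

lemma coprime_linear_powers:
  fixes x y :: "'b::{alg_closed_field, field_gcd}"
  assumes "x \<noteq> y"
  shows "coprime ([:-x,1:] ^ i) ([:-y,1:] ^ j)"
proof -
  have "coprime [:-x,1:] [:-y,1:]"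
    by (rule no_common_root_coprime) (use assms in \<open>auto simp: no_common_root_def\<close>)
  thus ?thesis by simp
qed

lemma prod_linear_powers_dvd:
  fixes g :: "'i \<Rightarrow> 'b::{alg_closed_field, field_gcd}"
  assumes "finite A" "inj_on g A" "\<And>x. x \<in> A \<Longrightarrow> [:- g x, 1:] ^ e x dvd h"
  shows "(\<Prod>x\<in>A. [:- g x, 1:] ^ e x) dvd h"
  using assms
proof (induction A rule: finite_induct)
  case (insert x A)
  have "coprime ([:- g x, 1:] ^ e x) (\<Prod>x\<in>A. [:- g x, 1:] ^ e x)"
    using insert by (intro prod_coprime_right coprime_linear_powers) (auto simp: inj_on_def)
  thus ?case using insert by (auto intro!: divides_mult)
qed simp

lemma degree_prod_linear_powers:
  "degree (\<Prod>x\<in>A. [:- g x, 1::'b::field:] ^ e x) = (\<Sum>x\<in>A. e x)"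
  by (subst degree_prod_sum_eq) (auto simp: degree_power_eq)

text \<open>The factorization of \<open>T\<^sup>q - T\<close>.\<close>

lemma prod_linear_finite_field:
  "(\<Prod>x\<in>(UNIV::'a::{field,finite} set). [:- to_ac x, 1:]) = [:0,1:] ^ CARD('a) - [:0,1:]"
proof -
  let ?P = "\<Prod>x\<in>(UNIV::'a set). [:- to_ac x, 1:]"
  let ?h = "[:0,1:] ^ CARD('a) - [:0,1:] :: 'a alg_closure poly"
  have "card {0::'a, 1} \<le> CARD('a)" by (rule card_mono) auto
  hence q: "CARD('a) > 1" by simp
  have "(\<Prod>x\<in>(UNIV::'a set). [:- to_ac x, 1:] ^ 1) dvd ?h"
  proof (rule prod_linear_powers_dvd)
    fix x :: 'a
    have "poly ?h (to_ac x) = 0" 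
      using finite_field_power_card[of x] by (simp flip: to_ac_power)
    thus "[:- to_ac x, 1:] ^ 1 dvd ?h" by (simp only: poly_eq_0_iff_dvd power_one_right)
  qed (auto simp: inj_on_def)
  then obtain k where k: "?h = ?P * k" by (auto elim: dvdE)
  have dh: "degree ?h = CARD('a)"
    using q by (subst diff_conv_add_uminus, subst degree_add_eq_left) (auto simp: degree_power_eq)
  have dP: "degree ?P = CARD('a)" using degree_prod_linear_powers[of to_ac "\<lambda>_. 1" UNIV] by simp
  have k0: "k \<noteq> 0" using k dh q by auto
  have P0: "?P \<noteq> 0" using dP q by auto
  have "degree k = 0" using k dh dP degree_mult_eq[OF P0 k0] by simp
  then obtain u where u: "k = [:u:]" by (rule degree_eq_zeroE)
  have "lead_coeff ?h = 1"
  proof -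
    have "coeff ?h CARD('a) = coeff ([:0,1:] ^ CARD('a) :: 'a alg_closure poly) CARD('a) - coeff [:0,1:] CARD('a)" by simp
    also have "coeff ([:0,1:] ^ CARD('a) :: 'a alg_closure poly) CARD('a) = 1"
      using lead_coeff_power[of "[:0,1:] :: 'a alg_closure poly" "CARD('a)"] by (simp add: degree_power_eq)
    also have "coeff [:0,1:] CARD('a) = (0::'a alg_closure)" using q by (simp add: coeff_pCons split: nat.splits)
    finally show ?thesis using dh by simp
  qed
  moreover have "lead_coeff ?P = 1" by (simp add: lead_coeff_prod)
  ultimately have "u = 1" using arg_cong[OF k, of lead_coeff] unfolding lead_coeff_mult u by simp
  thus ?thesis using k u by simp
qed

text \<open>Nonnegativity at integers only gives \<open>s\<^sup>2 \<le> 4 q + 1\<close>; the boundary case \<open>s\<^sup>2 = 4 q + 1\<close> would make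
  \<open>q\<close> a product of two consecutive integers.\<close>

lemma hasse_arith:
  fixes q s :: int
  assumes odd: "odd q" and nn: "\<And>n::nat. q - s * int n + (int n)\<^sup>2 \<ge> 0" "\<And>n::nat. q + s * int n + (int n)\<^sup>2 \<ge> 0"
  shows "s\<^sup>2 \<le> 4 * q"
proof -
  define m where "m = \<bar>s\<bar> div 2"
  have m: "m \<ge> 0" by (simp add: m_def)
  have *: "q - \<bar>s\<bar> * m + m\<^sup>2 \<ge> 0"
    using nn[of "nat m"] m by (cases "s \<ge> 0") (auto simp: abs_if)
  show ?thesis
  proof (cases "even s")
    case True
    hence s: "\<bar>s\<bar> = 2 * m" by (simp add: m_def)
    have "s\<^sup>2 = \<bar>s\<bar>\<^sup>2" by simp
    also have "\<dots> \<le> 4 * q" using * unfolding s by (simp add: power2_eq_square algebra_simps)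
    finally show ?thesis .
  next
    case False
    hence s: "\<bar>s\<bar> = 2 * m + 1" by (simp add: m_def)
    have "q \<ge> m\<^sup>2 + m" using * unfolding s by (simp add: power2_eq_square algebra_simps)
    moreover have "q \<noteq> m\<^sup>2 + m" using odd by auto
    ultimately have "q \<ge> m\<^sup>2 + m + 1" by simp
    moreover have "s\<^sup>2 = \<bar>s\<bar>\<^sup>2" by simp
    ultimately show ?thesis unfolding s by (simp add: power2_eq_square algebra_simps)
  qed
qed

lemma to_ac_cubic: "to_ac (cubic a b c x) = cubic (to_ac a) (to_ac b) (to_ac c) (to_ac x)"
  by (simp add: cubic_def)

text \<open>Here \<open>M\<close> is the number of affine points of \<open>y\<^sup>2 = x\<^sup>3 + a x\<^sup>2 + b x + c\<close>. With \<open>F = f(T)\<close>, the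
  neighbours of the abscissa \<open>T\<^sup>q\<close> have numerators \<open>h - G\<close> and \<open>h + G\<close> over the common denominator
  \<open>(T\<^sup>q - T)\<^sup>2\<close>. At a rational point \<open>x\<close> the two values are
  \<open>2 f(x) (1 - \<epsilon>)\<close> and \<open>2 f(x) (1 + \<epsilon>)\<close> where \<open>\<epsilon>\<close> is the quadratic character of \<open>f(x)\<close>. The amount of
  cancellation in the two fractions is therefore \<open>M\<close> and \<open>2 q - M\<close>, and the degrees of the reduced
  numerators are \<open>2 q + 1 - M\<close> and \<open>M + 1\<close>.\<close>

lemma hasse_bound:
  fixes a b c :: "'a::{field,finite}"
  assumes odd: "odd (CARD('a))" and char: "CARD('a) = CHAR('a) ^ v"
    and sep: "\<And>z. \<not> (cubic (to_ac a) (to_ac b) (to_ac c) z = 0 \<and> cubic' (to_ac a) (to_ac b) z = 0)"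
    and M: "M = card {x. cubic a b c x = 0} + 2 * card {x. nz_square (cubic a b c x)}"
  shows "(int CARD('a) - int M)\<^sup>2 \<le> 4 * int CARD('a)"
proof -
  define q where "q = CARD('a)"
  have "card {0::'a, 1} \<le> CARD('a)" by (rule card_mono) auto
  hence q3: "q \<ge> 3" using odd unfolding q_def by (auto elim!: oddE)
  have odq: "odd q" using odd by (simp add: q_def)
  define a' b' c' where "a' = to_ac a" and "b' = to_ac b" and "c' = to_ac c"
  have two: "(2::'a alg_closure) \<noteq> 0"
    using odd_card_two_nonzero[OF odd] by (metis to_ac_eq_0_iff to_ac_numeral)
  define T where "T = [:0,1::'a alg_closure:]"
  define F where "F = cubic [:a':] [:b':] [:c':] T"
  define A B C where "A = pA a' b' c' (T ^ q) 1" and "B = pB a' b' c' (T ^ q) 1" and "C = pC (T ^ q) 1"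
  define h where "h = (T ^ q + T) * (T ^ q * T + [:b':]) + 2 * [:a':] * T ^ q * T + 2 * [:c':]"
  define G where "G = 2 * F ^ ((q + 1) div 2)"
  have B2h: "B = 2 * h" by (simp add: B_def h_def kumB_def T_def)
  have sep': "\<And>z. \<not> (cubic a' b' c' z = 0 \<and> cubic' a' b' z = 0)"
    using sep by (simp add: a'_def b'_def c'_def)
  have primeC: "prime CHAR('a)" using prime_CHAR_semidom[where ?'a='a] finite_imp_CHAR_pos[where ?'a='a] by simp
  have frob: "(x + y) ^ q = x ^ q + y ^ q" for x y :: "'a alg_closure poly"
    unfolding q_def char by (rule freshmans_dream'[of _ v]) (use primeC in simp_all)
  have Fq: "cubic [:a':] [:b':] [:c':] (T ^ q) = F ^ q"
  proof -
    have const: "[:to_ac x:] ^ q = [:to_ac x:]" for x :: 'a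
      using finite_field_power_card[of x] unfolding q_def 
      by (simp add: poly_const_pow flip: to_ac_power)
    have sq: "(x ^ n) ^ q = (x ^ q) ^ n" for x :: "'a alg_closure poly" and n by (simp add: mult.commute flip: power_mult)
    show ?thesis unfolding F_def cubic_def frob power_mult_distrib a'_def b'_def c'_def const sq by simp
  qed
  have AC: "(h - G) * (h + G) = A * C"
  proof -
    have "B\<^sup>2 - 4 * A * C = 16 * F ^ q * F"
      using kum_discriminant[of "[:a':]" "[:b':]" "[:c':]" T "T ^ q"] unfolding Fq
      by (simp add: A_def B_def C_def T_def F_def)
    also have "\<dots> = 16 * F ^ ((q + 1) div 2 * 2)" using odq by (simp add: mult.commute)
    also have "\<dots> = 4 * G\<^sup>2" by (simp add: G_def power_mult_distrib power_mult)
    finally have "4 * ((h - G) * (h + G)) = 4 * (A * C)"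
      unfolding B2h by (simp add: algebra_simps power2_eq_square)
    moreover have "(4::'a alg_closure poly) \<noteq> 0"
    proof -
      have "(4::'a alg_closure) \<noteq> 0" using two by (metis mult_eq_0_iff num_double numeral_times_numeral)
      thus ?thesis by (simp add: numeral_poly)
    qed
    ultimately show ?thesis by simp
  qed
  \<comment> \<open>\<open>e x\<close> is the multiplicity of \<open>T - x\<close> that cancels in \<open>(h - G) / (T\<^sup>q - T)\<^sup>2\<close>, that is, the
    number of points of the curve above \<open>x\<close>.\<close>
  define e where "e x = (if cubic a b c x = 0 then 1 else if nz_square (cubic a b c x) then 2 else 0 :: nat)" for x
  have e2: "e x + (2 - e x) = 2" for x by (simp add: e_def)
  have e_le: "e x \<le> 2" for x by (simp add: e_def)
  define Mm where "Mm = (\<Prod>x\<in>UNIV. [:- to_ac x, 1:] ^ e x)"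
  define Mp where "Mp = (\<Prod>x\<in>UNIV. [:- to_ac x, 1:] ^ (2 - e x))"
  have sum_e: "sum e UNIV = M"
  proof -
    have *: "nz_square y \<Longrightarrow> y \<noteq> 0" for y :: 'a by (auto simp: nz_square_def)
    have "sum e UNIV = (\<Sum>x\<in>UNIV. (if cubic a b c x = 0 then 1 else 0) + 2 * (if nz_square (cubic a b c x) then 1 else 0))"
      by (rule sum.cong) (auto simp: e_def dest: *)
    also have "\<dots> = M" unfolding M
      by (simp add: sum.distrib sum_distrib_left[symmetric] flip: sum.inter_filter)
    finally show ?thesis .
  qed
  have Mle: "M \<le> 2 * q" unfolding sum_e[symmetric] q_def
    using sum_bounded_above[of UNIV e 2, OF e_le] by (simp add: mult.commute)
  have dMm: "degree Mm = M" unfolding Mm_def by (simp add: degree_prod_linear_powers sum_e)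
  have C: "C = Mp * Mm"
  proof -
    have "C = (T ^ q - T)\<^sup>2" by (simp add: C_def kumC_def T_def)
    also have "\<dots> = (\<Prod>x\<in>(UNIV::'a set). [:- to_ac x, 1:])\<^sup>2"
      unfolding prod_linear_finite_field by (simp add: T_def q_def)
    also have "\<dots> = (\<Prod>x\<in>(UNIV::'a set). [:- to_ac x, 1:] ^ (e x + (2 - e x)))"
      unfolding e2 by (simp add: prod_power_distrib)
    also have "\<dots> = Mp * Mm" unfolding Mm_def Mp_def by (simp add: power_add prod.distrib)
    finally show ?thesis .
  qed
  have C0: "C \<noteq> 0"
    unfolding C Mm_def Mp_def by simp
  have dMp: "degree Mp = 2 * q - M"
  proof -
    have "degree Mp = (\<Sum>x\<in>UNIV. 2 - e x)" unfolding Mp_def by (rule degree_prod_linear_powers)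
    moreover have "(\<Sum>x\<in>UNIV. 2 - e x) + sum e UNIV = 2 * q"
      by (simp add: sum.distrib[symmetric] q_def e2 add.commute)
    ultimately show ?thesis using sum_e by simp
  qed
  have lin2: "[:- to_ac x, 1:] ^ 2 dvd (h - G) * (h + G)" for x :: 'a
  proof -
    have "[:- to_ac x, 1:] dvd (\<Prod>x\<in>(UNIV::'a set). [:- to_ac x, 1:])" by (rule dvd_prodI) auto
    hence "[:- to_ac x, 1:] ^ 2 dvd (\<Prod>x\<in>(UNIV::'a set). [:- to_ac x, 1:]) ^ 2" by (rule dvd_power_same)
    also have "\<dots> = C" unfolding prod_linear_finite_field by (simp add: C_def kumC_def T_def q_def)
    finally show ?thesis unfolding AC by simp
  qed
  have ev: "poly h (to_ac x) = 2 * to_ac (cubic a b c x)"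
    "poly G (to_ac x) = 2 * to_ac (cubic a b c x * cubic a b c x ^ ((q - 1) div 2))" for x
  proof -
    have Tx: "poly (T ^ q) (to_ac x) = to_ac x" using finite_field_power_card[of x] by (simp add: T_def q_def flip: to_ac_power)
    show "poly h (to_ac x) = 2 * to_ac (cubic a b c x)"
      unfolding h_def poly_add poly_mult Tx
      by (simp add: T_def a'_def b'_def c'_def cubic_def algebra_simps power2_eq_square power3_eq_cube)
    have "(q + 1) div 2 = Suc ((q - 1) div 2)" using odq by (auto elim!: oddE)
    hence "F ^ ((q + 1) div 2) = F * F ^ ((q - 1) div 2)" by simp
    thus "poly G (to_ac x) = 2 * to_ac (cubic a b c x * cubic a b c x ^ ((q - 1) div 2))"
      by (simp add: G_def F_def poly_kum T_def a'_def b'_def c'_def to_ac_cubic)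
  qed
  have four: "(4::'a alg_closure) \<noteq> 0" using two by (metis mult_eq_0_iff num_double numeral_times_numeral)
  \<comment> \<open>Both factors cannot be cancelled at the same \<open>x\<close> unless \<open>f(x) = 0\<close>, as their sum is \<open>4 f(x)\<close>.\<close>
  have dvd: "[:- to_ac x, 1:] ^ e x dvd h - G" "[:- to_ac x, 1:] ^ (2 - e x) dvd h + G" for x
  proof -
    define y where "y = cubic a b c x"
    consider "y = 0" | "y \<noteq> 0" "nz_square y" | "y \<noteq> 0" "\<not> nz_square y" by blast
    hence "[:- to_ac x, 1:] ^ e x dvd h - G \<and> [:- to_ac x, 1:] ^ (2 - e x) dvd h + G"
    proof cases
      case 1
      hence "poly (h - G) (to_ac x) = 0" "poly (h + G) (to_ac x) = 0" "e x = 1"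
        by (simp_all add: ev flip: y_def) (simp add: e_def flip: y_def)
      hence "[:- to_ac x, 1:] dvd h - G" "[:- to_ac x, 1:] dvd h + G"
        by (simp_all only: poly_eq_0_iff_dvd)
      thus ?thesis using \<open>e x = 1\<close> by simp
    next
      case 2
      have "poly (h + G) (to_ac x) = 4 * to_ac y"
        using nz_square_power[OF odd 2(2)] by (simp add: ev q_def flip: y_def)
      hence "poly (h + G) (to_ac x) \<noteq> 0" using 2 four by simp
      hence "coprime ([:- to_ac x, 1:] ^ 2) (h + G)"
        by (intro coprime_power_left_iff[THEN iffD2] disjI1 no_common_root_coprime) (auto simp: no_common_root_def)
      hence "[:- to_ac x, 1:] ^ 2 dvd h - G" using lin2[of x] by (simp add: coprime_dvd_mult_left_iff)
      moreover have "e x = 2" using 2 by (simp add: e_def flip: y_def)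
      ultimately show ?thesis by simp
    next
      case 3
      have "poly (h - G) (to_ac x) = 4 * to_ac y"
        using nonsquare_power[OF odd 3] by (simp add: ev q_def flip: y_def)
      hence "poly (h - G) (to_ac x) \<noteq> 0" using 3 four by simp
      hence "coprime ([:- to_ac x, 1:] ^ 2) (h - G)"
        by (intro coprime_power_left_iff[THEN iffD2] disjI1 no_common_root_coprime) (auto simp: no_common_root_def)
      hence "[:- to_ac x, 1:] ^ 2 dvd h + G" using lin2[of x] by (simp add: coprime_dvd_mult_right_iff)
      moreover have "e x = 0" using 3 by (simp add: e_def flip: y_def)
      ultimately show ?thesis by simp
    qed
    thus "[:- to_ac x, 1:] ^ e x dvd h - G" "[:- to_ac x, 1:] ^ (2 - e x) dvd h + G" by auto
  qed
  have "Mm dvd h - G" unfolding Mm_def by (rule prod_linear_powers_dvd) (auto simp: inj_on_def dvd)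
  then obtain Nm where Nm: "h - G = Mm * Nm" by (auto elim: dvdE)
  have "Mp dvd h + G" unfolding Mp_def by (rule prod_linear_powers_dvd) (auto simp: inj_on_def dvd)
  then obtain Np where Np: "h + G = Mp * Np" by (auto elim: dvdE)
  have "(Nm * Np) * C = A * C" unfolding AC[symmetric] unfolding Nm Np C by (simp add: algebra_simps)
  hence eq1: "Nm * Np = A" using C0 by simp
  have eq2: "Nm * Mm + Np * Mp = B" using Nm Np B2h by (simp add: algebra_simps)
  have degT: "degree (T ^ q) = q" by (simp add: T_def degree_power_eq)
  \<comment> \<open>The leading term of \<open>h \<plusminus> G\<close> comes from \<open>h\<close>, since \<open>G\<close> has degree at most \<open>3 (q + 1) / 2\<close>.\<close>
  have degh: "degree h = 2 * q + 1"
  proof -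
    have 1: "degree (T ^ q + T) = q" using degT degree_add_eq_left[of T "T ^ q"] q3 by (simp add: T_def)
    have 2: "degree (T ^ q * T) = q + 1" using degT by (simp add: T_def degree_mult_eq)
    have 3: "degree (T ^ q * T + [:b':]) = q + 1" using 2 degree_add_eq_left[of "[:b':]" "T ^ q * T"] by simp
    have ne: "T ^ q + T \<noteq> 0" "T ^ q * T + [:b':] \<noteq> 0" using 1 3 q3 by auto
    have 4: "degree ((T ^ q + T) * (T ^ q * T + [:b':])) = 2 * q + 1" using degree_mult_eq[OF ne] 1 3 by simp
    have "degree (2 * [:a':] * (T ^ q * T)) \<le> q + 1" 
      using degree_mult_le[of "2 * [:a':]" "T ^ q * T"] 2 by (simp add: numeral_poly)
    moreover have "degree (2 * [:c':]) = 0" by (simp add: numeral_poly)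
    ultimately have "degree (2 * [:a':] * (T ^ q * T) + 2 * [:c':]) < 2 * q + 1"
      using degree_add_le[of "2 * [:a':] * (T ^ q * T)" "q + 1" "2 * [:c':]"] q3 by simp
    thus ?thesis unfolding h_def using 4 degree_add_eq_left[of "2 * [:a':] * (T ^ q * T) + 2 * [:c':]" "(T ^ q + T) * (T ^ q * T + [:b':])"]
      by (simp add: add.assoc mult.assoc)
  qed
  have degG: "degree G < 2 * q + 1"
  proof -
    have "degree F \<le> 3" unfolding F_def cubic_def T_def
      by (intro degree_add_le order.trans[OF degree_mult_le] order.trans[OF degree_power_le]) (auto simp: degree_power_eq)
    hence "degree (F ^ ((q + 1) div 2)) \<le> 3 * ((q + 1) div 2)"
      by (meson degree_power_le le_trans mult_le_mono1)
    moreover have "degree G \<le> degree (F ^ ((q + 1) div 2))" unfolding G_def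
      using degree_mult_le[of 2 "F ^ ((q + 1) div 2)"] by (simp add: numeral_poly)
    moreover have "3 * ((q + 1) div 2) < 2 * q + 1" using odq q3 by (auto elim!: oddE)
    ultimately show ?thesis by linarith
  qed
  have dm: "degree (h - G) = 2 * q + 1" using degree_add_eq_left[of "- G" h] degG degh by simp
  have dp: "degree (h + G) = 2 * q + 1" using degree_add_eq_left[of G h] degG degh by simp
  have nz: "Nm \<noteq> 0" "Np \<noteq> 0" "Mm \<noteq> 0" "Mp \<noteq> 0" using dm dp Nm Np by auto
  have dNm: "degree Nm = 2 * q + 1 - M" using dm Nm nz dMm degree_mult_eq[of Mm Nm] by simp
  have dNp: "degree Np = M + 1" using dp Np nz dMp Mle degree_mult_eq[of Mp Np] by simp
  have pm: "proper_frac Nm Mp" using nz dNm dMp Mle by (simp add: proper_frac_def)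
  have pp: "proper_frac Np Mm" using nz dNp dMm by (simp add: proper_frac_def)
  have p0: "proper_frac (T ^ q) 1" using degT q3 by (auto simp: proper_frac_def T_def)
  have c0: "no_common_root (T ^ q) 1" by (simp add: no_common_root_def)
  note em = eq1[unfolded A_def] eq2[unfolded B_def] C[symmetric, unfolded C_def]
  have ep: "Np * Nm = pA a' b' c' (T ^ q) 1" "Np * Mp + Nm * Mm = pB a' b' c' (T ^ q) 1" "Mm * Mp = pC (T ^ q) 1"
    using em by (simp_all add: algebra_simps)
  note cm = kum_step_props(2)[OF two sep' p0 c0 pp em]
  note cp = kum_step_props(2)[OF two sep' p0 c0 pm ep]
  have d0: "int (degree (T ^ q)) = int q" using degT by simp
  have "int q - (int M - int q) * int n + (int n)\<^sup>2 \<ge> 0" for n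
    by (rule kum_degree_nonneg[OF two sep' p0 c0 pm cm kum_rel_next[OF em] d0])
       (use dNm Mle in \<open>simp_all add: of_nat_diff\<close>)
  moreover have "int q + (int M - int q) * int n + (int n)\<^sup>2 \<ge> 0" for n
    using kum_degree_nonneg[OF two sep' p0 c0 pp cp kum_rel_next[OF ep] d0, of "- (int M - int q)" n] dNp
    by (simp add: algebra_simps)
  ultimately have "(int M - int q)\<^sup>2 \<le> 4 * int q"
    using odq by (intro hasse_arith) auto
  thus ?thesis by (simp add: q_def power2_commute)
qed


section \<open>Weierstrass equations and their masses\<close>

text \<open>The unique target of the substitution \<open>(u, r, s, t)\<close> applied to \<open>E\<close>, meaningful for \<open>u \<noteq> 0\<close>.\<close>

definition transport :: "'a::field \<times> 'a \<times> 'a \<times> 'a \<Rightarrow> 'a weierstrass \<Rightarrow> 'a weierstrass" where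
  "transport = (\<lambda>(u, r, s, t) E. Weierstrass
     ((a1 E + 2 * s) / u)
     ((a2 E - s * a1 E + 3 * r - s ^ 2) / u ^ 2)
     ((a3 E + r * a1 E + 2 * t) / u ^ 3)
     ((a4 E - s * a3 E + 2 * r * a2 E - (t + r * s) * a1 E + 3 * r ^ 2 - 2 * s * t) / u ^ 4)
     ((a6 E + r * a4 E + r ^ 2 * a2 E + r ^ 3 - t * a3 E - t ^ 2 - r * t * a1 E) / u ^ 6))"

lemma ec_iso_transport:
  "ec_iso E E' \<phi> \<longleftrightarrow> fst \<phi> \<noteq> 0 \<and> E' = transport \<phi> E"
  by (cases \<phi>; cases E') (auto simp: transport_def eq_divide_eq mult.commute)

text \<open>Composition of substitutions, the first argument being applied to the source curve first.\<close>

definition iso_comp :: "'a::field \<times> 'a \<times> 'a \<times> 'a \<Rightarrow> 'a \<times> 'a \<times> 'a \<times> 'a \<Rightarrow> 'a \<times> 'a \<times> 'a \<times> 'a" where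
  "iso_comp = (\<lambda>(u, r, s, t) (u', r', s', t').
     (u * u', u ^ 2 * r' + r, u * s' + s, u ^ 3 * t' + s * u ^ 2 * r' + t))"

lemma ec_iso_comp:
  assumes "ec_iso E E' \<phi>" "ec_iso E' E'' \<psi>"
  shows "ec_iso E E'' (iso_comp \<phi> \<psi>)"
proof -
  obtain u r s t where p: "\<phi> = (u, r, s, t)" by (metis prod_cases4)
  obtain u' r' s' t' where p': "\<psi> = (u', r', s', t')" by (metis prod_cases4)
  note e = assms[unfolded p p' ec_iso.simps]
  have e1: "u * a1 E' = a1 E + 2 * s" and e2: "u ^ 2 * a2 E' = a2 E - s * a1 E + 3 * r - s ^ 2"
    and e3: "u ^ 3 * a3 E' = a3 E + r * a1 E + 2 * t"
    and e4: "u ^ 4 * a4 E' = a4 E - s * a3 E + 2 * r * a2 E - (t + r * s) * a1 E + 3 * r ^ 2 - 2 * s * t"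
    and e6: "u ^ 6 * a6 E' = a6 E + r * a4 E + r ^ 2 * a2 E + r ^ 3 - t * a3 E - t ^ 2 - r * t * a1 E"
    using e(1) by auto
  have f1: "u' * a1 E'' = a1 E' + 2 * s'" and f2: "u' ^ 2 * a2 E'' = a2 E' - s' * a1 E' + 3 * r' - s' ^ 2"
    and f3: "u' ^ 3 * a3 E'' = a3 E' + r' * a1 E' + 2 * t'"
    and f4: "u' ^ 4 * a4 E'' = a4 E' - s' * a3 E' + 2 * r' * a2 E' - (t' + r' * s') * a1 E' + 3 * r' ^ 2 - 2 * s' * t'"
    and f6: "u' ^ 6 * a6 E'' = a6 E' + r' * a4 E' + r' ^ 2 * a2 E' + r' ^ 3 - t' * a3 E' - t' ^ 2 - r' * t' * a1 E'"
    using e(2) by auto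
  let ?r = "u ^ 2 * r' + r" and ?s = "u * s' + s" and ?t = "u ^ 3 * t' + s * u ^ 2 * r' + t"
  have "u * u' * a1 E'' = u * a1 E' + 2 * u * s'"
    by (simp only: mult.assoc f1) (simp add: algebra_simps)
  hence g1: "u * u' * a1 E'' = a1 E + 2 * ?s" unfolding e1 by (simp add: algebra_simps)
  have "(u * u') ^ 2 * a2 E'' = u ^ 2 * a2 E' - u * s' * (u * a1 E') + 3 * (u ^ 2 * r') - (u * s') ^ 2"
    by (simp only: power_mult_distrib mult.assoc f2) (simp add: algebra_simps power2_eq_square)
  hence g2: "(u * u') ^ 2 * a2 E'' = a2 E - ?s * a1 E + 3 * ?r - ?s ^ 2"
    unfolding e1 e2 by (simp add: algebra_simps power2_eq_square)
  have "(u * u') ^ 3 * a3 E'' = u ^ 3 * a3 E' + u ^ 2 * r' * (u * a1 E') + 2 * (u ^ 3 * t')"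
    by (simp only: power_mult_distrib mult.assoc f3) (simp add: algebra_simps eval_nat_numeral)
  hence g3: "(u * u') ^ 3 * a3 E'' = a3 E + ?r * a1 E + 2 * ?t"
    unfolding e1 e3 by (simp add: algebra_simps)
  have "(u * u') ^ 4 * a4 E'' = u ^ 4 * a4 E' - u * s' * (u ^ 3 * a3 E') + 2 * (u ^ 2 * r') * (u ^ 2 * a2 E')
      - (u ^ 3 * t' + u ^ 2 * r' * (u * s')) * (u * a1 E') + 3 * (u ^ 2 * r') ^ 2 - 2 * (u * s') * (u ^ 3 * t')"
    by (simp only: power_mult_distrib mult.assoc f4) (simp add: algebra_simps eval_nat_numeral)
  hence g4: "(u * u') ^ 4 * a4 E'' = a4 E - ?s * a3 E + 2 * ?r * a2 E - (?t + ?r * ?s) * a1 E + 3 * ?r ^ 2 - 2 * ?s * ?t"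
    unfolding e1 e2 e3 e4 by (simp add: algebra_simps eval_nat_numeral)
  have "(u * u') ^ 6 * a6 E'' = u ^ 6 * a6 E' + u ^ 2 * r' * (u ^ 4 * a4 E') + (u ^ 2 * r') ^ 2 * (u ^ 2 * a2 E') + (u ^ 2 * r') ^ 3
      - u ^ 3 * t' * (u ^ 3 * a3 E') - (u ^ 3 * t') ^ 2 - u ^ 2 * r' * (u ^ 3 * t') * (u * a1 E')"
    by (simp only: power_mult_distrib mult.assoc f6) (simp add: algebra_simps eval_nat_numeral)
  hence g6: "(u * u') ^ 6 * a6 E'' = a6 E + ?r * a4 E + ?r ^ 2 * a2 E + ?r ^ 3 - ?t * a3 E - ?t ^ 2 - ?r * ?t * a1 E"
    unfolding e1 e2 e3 e4 e6 by (simp add: algebra_simps eval_nat_numeral)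
  show ?thesis using g1 g2 g3 g4 g6 e unfolding p p' iso_comp_def by simp
qed

text \<open>The inverse substitution.\<close>

definition iso_inv :: "'a::field \<times> 'a \<times> 'a \<times> 'a \<Rightarrow> 'a \<times> 'a \<times> 'a \<times> 'a" where
  "iso_inv = (\<lambda>(u, r, s, t). (1 / u, - r / u ^ 2, - s / u, (r * s - t) / u ^ 3))"

lemma iso_comp_inv:
  assumes "fst \<phi> \<noteq> 0"
  shows "iso_comp \<phi> (iso_inv \<phi>) = (1, 0, 0, 0)" "iso_comp (iso_inv \<phi>) \<phi> = (1, 0, 0, 0)"
  using assms by (auto simp: iso_comp_def iso_inv_def field_simps eval_nat_numeral split: prod.splits)

lemma iso_comp_assoc: "iso_comp (iso_comp \<phi> \<psi>) \<chi> = iso_comp \<phi> (iso_comp \<psi> \<chi>)"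
  by (auto simp: iso_comp_def algebra_simps eval_nat_numeral split: prod.splits)

lemma iso_comp_id [simp]: "iso_comp (1, 0, 0, 0) \<phi> = \<phi>" "iso_comp \<phi> (1, 0, 0, 0) = \<phi>"
  by (auto simp: iso_comp_def split: prod.splits)

lemma ec_iso_refl: "ec_iso E E (1, 0, 0, 0)" by simp

lemma ec_iso_inv:
  assumes "ec_iso E E' \<phi>"
  shows "ec_iso E' E (iso_inv \<phi>)"
proof -
  have u: "fst \<phi> \<noteq> 0" using assms by (simp add: ec_iso_transport)
  define E'' where "E'' = transport (iso_inv \<phi>) E'"
  have "fst (iso_inv \<phi>) \<noteq> 0" using u by (auto simp: iso_inv_def split: prod.splits)
  hence *: "ec_iso E' E'' (iso_inv \<phi>)" by (simp add: ec_iso_transport E''_def)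
  have "ec_iso E E'' (1, 0, 0, 0)" using ec_iso_comp[OF assms *] iso_comp_inv[OF u] by simp
  hence "E'' = E" using ec_iso_refl[of E] by (simp only: ec_iso_transport)
  thus ?thesis using * by simp
qed

lemma w_poly_dx_iso:
  assumes "ec_iso E E' (u, r, s, t)"
  shows "u ^ 2 * w_poly_dx E (u ^ 2 * x + r) (u ^ 3 * y + s * u ^ 2 * x + t)
       + s * u ^ 2 * w_poly_dy E (u ^ 2 * x + r) (u ^ 3 * y + s * u ^ 2 * x + t) = u ^ 6 * w_poly_dx E' x y"
proof -
  have "u ^ 6 * w_poly_dx E' x y = u ^ 5 * y * (u * a1 E') - (3 * u ^ 6 * x ^ 2 + 2 * u ^ 4 * x * (u ^ 2 * a2 E') + u ^ 2 * (u ^ 4 * a4 E'))"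
    by (simp add: w_poly_dx_def algebra_simps eval_nat_numeral)
  also have "\<dots> = u ^ 2 * w_poly_dx E (u ^ 2 * x + r) (u ^ 3 * y + s * u ^ 2 * x + t)
       + s * u ^ 2 * w_poly_dy E (u ^ 2 * x + r) (u ^ 3 * y + s * u ^ 2 * x + t)"
    using assms unfolding ec_iso.simps
    by (simp only:) (simp add: w_poly_dx_def w_poly_dy_def algebra_simps eval_nat_numeral)
  finally show ?thesis by simp
qed

lemma w_poly_dy_iso:
  assumes "ec_iso E E' (u, r, s, t)"
  shows "w_poly_dy E (u ^ 2 * x + r) (u ^ 3 * y + s * u ^ 2 * x + t) = u ^ 3 * w_poly_dy E' x y"
proof -
  have "u ^ 3 * w_poly_dy E' x y = 2 * u ^ 3 * y + u ^ 2 * x * (u * a1 E') + u ^ 3 * a3 E'"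
    by (simp add: w_poly_dy_def algebra_simps eval_nat_numeral)
  also have "\<dots> = w_poly_dy E (u ^ 2 * x + r) (u ^ 3 * y + s * u ^ 2 * x + t)"
    using assms unfolding ec_iso.simps
    by (simp only:) (simp add: w_poly_dy_def algebra_simps eval_nat_numeral)
  finally show ?thesis by simp
qed

lemma ec_iso_map_to_ac:
  assumes "ec_iso E E' (u, r, s, t)"
  shows "ec_iso (map_weierstrass to_ac E) (map_weierstrass to_ac E') (to_ac u, to_ac r, to_ac s, to_ac t)"
proof -
  note [simp] = weierstrass.map_sel
  have "u \<noteq> 0" using assms by simp
  have *: "to_ac (u * a1 E') = to_ac (a1 E + 2 * s)"
     "to_ac (u ^ 2 * a2 E') = to_ac (a2 E - s * a1 E + 3 * r - s ^ 2)"
     "to_ac (u ^ 3 * a3 E') = to_ac (a3 E + r * a1 E + 2 * t)"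
     "to_ac (u ^ 4 * a4 E') = to_ac (a4 E - s * a3 E + 2 * r * a2 E - (t + r * s) * a1 E + 3 * r ^ 2 - 2 * s * t)"
     "to_ac (u ^ 6 * a6 E') = to_ac (a6 E + r * a4 E + r ^ 2 * a2 E + r ^ 3 - t * a3 E - t ^ 2 - r * t * a1 E)"
    using assms unfolding ec_iso.simps by (simp_all only:)
  show ?thesis unfolding ec_iso.simps using \<open>u \<noteq> 0\<close> * by simp
qed

lemma elliptic_iso:
  assumes iso: "ec_iso E E' \<phi>" and "elliptic E"
  shows "elliptic E'"
proof (rule ccontr)
  obtain u r s t where p: "\<phi> = (u, r, s, t)" by (metis prod_cases4)
  define F F' where "F = map_weierstrass to_ac E" and "F' = map_weierstrass to_ac E'"
  have iso': "ec_iso F F' (to_ac u, to_ac r, to_ac s, to_ac t)"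
    using ec_iso_map_to_ac iso unfolding p F_def F'_def by blast
  have u: "to_ac u \<noteq> 0" using iso' by simp
  assume "\<not> elliptic E'"
  then obtain x y where xy: "w_poly F' x y = 0" "w_poly_dx F' x y = 0" "w_poly_dy F' x y = 0"
    by (auto simp: elliptic_def Let_def F'_def)
  let ?x = "to_ac u ^ 2 * x + to_ac r" and ?y = "to_ac u ^ 3 * y + to_ac s * to_ac u ^ 2 * x + to_ac t"
  have "w_poly F ?x ?y = 0" "w_poly_dy F ?x ?y = 0"
    using ec_iso_substitution[OF iso', of x y] w_poly_dy_iso[OF iso', of x y] xy by simp_all
  moreover have "w_poly_dx F ?x ?y = 0"
    using w_poly_dx_iso[OF iso', of x y] xy \<open>w_poly_dy F ?x ?y = 0\<close> u by simp
  ultimately show False using \<open>elliptic E\<close> by (auto simp: elliptic_def Let_def F_def)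
qed

text \<open>All affine rational points, and those that are fixed by the inversion of the group law.\<close>

definition affine_points :: "'a::field weierstrass \<Rightarrow> ('a \<times> 'a) set" where
  "affine_points E = {(x, y). w_poly E x y = 0}"

definition two_points :: "'a::field weierstrass \<Rightarrow> ('a \<times> 'a) set" where
  "two_points E = {(x, y). w_poly E x y = 0 \<and> w_poly_dy E x y = 0}"

lemma card_points_iso:
  fixes E E' :: "'a::{field,finite} weierstrass"
  assumes iso: "ec_iso E E' \<phi>"
  shows "card (affine_points E) = card (affine_points E')" "card (two_points E) = card (two_points E')"
proof -
  have *: "card (affine_points E') \<le> card (affine_points E) \<and> card (two_points E') \<le> card (two_points E)"
    if iso: "ec_iso E E' \<phi>" for E E' :: "'a weierstrass" and \<phi>
  proof -
    obtain u r s t where p: "\<phi> = (u, r, s, t)" by (metis prod_cases4)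
    note iso' = iso[unfolded p]
    have u: "u \<noteq> 0" using iso' by simp
    let ?f = "\<lambda>(x, y). (u ^ 2 * x + r, u ^ 3 * y + s * u ^ 2 * x + t)"
    have inj: "inj_on ?f S" for S by (rule inj_onI) (use u in auto)
    have "?f ` affine_points E' \<subseteq> affine_points E"
      using ec_iso_substitution[OF iso'] by (auto simp: affine_points_def)
    moreover have "?f ` two_points E' \<subseteq> two_points E"
      using ec_iso_substitution[OF iso'] w_poly_dy_iso[OF iso'] by (auto simp: two_points_def)
    ultimately show ?thesis by (intro conjI card_inj_on_le[OF inj]) auto
  qed
  show "card (affine_points E) = card (affine_points E')" "card (two_points E) = card (two_points E')"
    using *[OF iso] *[OF ec_iso_inv[OF iso]] by auto
qed



lemma finite_weierstrass: "finite (UNIV :: 'a::finite weierstrass set)"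
proof -
  have "UNIV = (\<lambda>(a,b,c,d,e). Weierstrass a b c d (e::'a)) ` UNIV"
    by (auto simp: image_iff) (metis weierstrass.exhaust)
  thus ?thesis by (metis finite finite_imageI)
qed

lemma orbit_stabilizer:
  fixes E :: "'a::{field,finite} weierstrass"
  assumes "elliptic E"
  shows "card {E'. elliptic E' \<and> (\<exists>\<phi>. ec_iso E E' \<phi>)} * card (ec_Aut E) = (CARD('a) - 1) * CARD('a) ^ 3"
proof -
  let ?C = "{E'. elliptic E' \<and> (\<exists>\<phi>. ec_iso E E' \<phi>)}"
  let ?G = "{\<phi>::'a \<times> 'a \<times> 'a \<times> 'a. fst \<phi> \<noteq> 0}"
  have fib: "card {\<phi>. ec_iso E E' \<phi>} = card (ec_Aut E)" if E': "E' \<in> ?C" for E'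
  proof -
    obtain \<psi> where psi: "ec_iso E E' \<psi>" using E' by blast
    have u: "fst \<psi> \<noteq> 0" using psi by (simp add: ec_iso_transport)
    have "bij_betw (\<lambda>\<phi>. iso_comp \<phi> \<psi>) (ec_Aut E) {\<phi>. ec_iso E E' \<phi>}"
    proof (rule bij_betwI[where g = "\<lambda>\<phi>. iso_comp \<phi> (iso_inv \<psi>)"])
      show "(\<lambda>\<phi>. iso_comp \<phi> \<psi>) \<in> ec_Aut E \<rightarrow> {\<phi>. ec_iso E E' \<phi>}"
        unfolding ec_Aut_def Pi_def using ec_iso_comp[OF _ psi] by blast
      show "(\<lambda>\<phi>. iso_comp \<phi> (iso_inv \<psi>)) \<in> {\<phi>. ec_iso E E' \<phi>} \<rightarrow> ec_Aut E"
        unfolding ec_Aut_def Pi_def using ec_iso_comp[OF _ ec_iso_inv[OF psi]] by blast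
    qed (simp_all add: iso_comp_assoc iso_comp_inv[OF u])
    thus ?thesis by (simp add: bij_betw_same_card)
  qed
  have "?G = (\<Union>E'\<in>?C. {\<phi>. ec_iso E E' \<phi>})"
  proof -
    have "elliptic (transport \<phi> E)" if "fst \<phi> \<noteq> 0" for \<phi>
      using elliptic_iso[of E "transport \<phi> E" \<phi>] assms that by (simp add: ec_iso_transport)
    thus ?thesis unfolding ec_iso_transport by blast
  qed
  hence "card ?G = (\<Sum>E'\<in>?C. card {\<phi>. ec_iso E E' \<phi>})"
    by (simp only:) (rule card_UN_disjoint, auto simp: ec_iso_transport rev_finite_subset[OF finite_weierstrass] simp del: ec_iso.simps)
  also have "\<dots> = card ?C * card (ec_Aut E)" using fib by simp
  finally have "card ?G = card ?C * card (ec_Aut E)" .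
  moreover have "?G = (UNIV - {0}) \<times> UNIV" by auto
  moreover have "card ((UNIV - {0::'a}) \<times> (UNIV :: ('a \<times> 'a \<times> 'a) set)) = (CARD('a) - 1) * CARD('a) ^ 3"
    by (simp add: card_cartesian_product card_Diff_subset power3_eq_cube)
  ultimately show ?thesis by simp
qed

text \<open>A set of smooth equations that is closed under isomorphism is a disjoint union of orbits of the
  group of substitutions, so its mass is its cardinality divided by the order of that group.\<close>

lemma mass_eq_card:
  fixes S :: "'a::{field,finite} weierstrass set"
  assumes ell: "\<And>E. E \<in> S \<Longrightarrow> elliptic E"
    and closed: "\<And>E E' \<phi>. E \<in> S \<Longrightarrow> ec_iso E E' \<phi> \<Longrightarrow> E' \<in> S"
  shows "mass S * of_nat ((CARD('a) - 1) * CARD('a) ^ 3) = of_nat (card S)"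
proof -
  have fin: "finite A" for A :: "'a weierstrass set" using finite_weierstrass by (rule rev_finite_subset) simp
  define cl where "cl E = {E'. elliptic E' \<and> (\<exists>\<phi>. ec_iso E E' \<phi>)}" for E :: "'a weierstrass"
  have Q: "S // ec_isomorphic = cl ` S"
  proof -
    have "ec_isomorphic `` {E} = cl E" if "E \<in> S" for E
      using ell[OF that] unfolding ec_isomorphic_def cl_def by blast
    thus ?thesis by (auto simp: quotient_def)
  qed
  have self: "E \<in> cl E" if "E \<in> S" for E using ell[OF that] ec_iso_refl[of E] by (auto simp: cl_def simp del: ec_iso.simps)
  have sub: "cl E \<subseteq> S" if "E \<in> S" for E using closed[OF that] by (auto simp: cl_def simp del: ec_iso.simps)
  have eqc: "cl E' = cl E" if E': "E' \<in> cl E" for E E'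
  proof -
    obtain \<phi> where phi: "ec_iso E E' \<phi>" using E' unfolding cl_def by blast
    show ?thesis using ec_iso_comp[OF phi] ec_iso_comp[OF ec_iso_inv[OF phi]]
      unfolding cl_def by blast
  qed
  have weight: "1 / of_nat (card (ec_Aut (SOME E. E \<in> C))) * of_nat ((CARD('a) - 1) * CARD('a) ^ 3) = (of_nat (card C) :: rat)"
    if C: "C \<in> cl ` S" for C
  proof -
    obtain E where E: "E \<in> S" "C = cl E" using C by blast
    define E1 where "E1 = (SOME E. E \<in> C)"
    have "E1 \<in> C" unfolding E1_def using self[OF E(1)] E(2) by (metis someI)
    hence E1: "E1 \<in> S" "C = cl E1" using sub eqc E by auto
    have os: "card C * card (ec_Aut E1) = (CARD('a) - 1) * CARD('a) ^ 3"
      using orbit_stabilizer[OF ell[OF E1(1)]] E1(2) by (simp add: cl_def)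
    have "finite (ec_Aut E1)" by simp
    moreover have "(1, 0, 0, 0) \<in> ec_Aut E1" by (simp add: ec_Aut_def)
    ultimately have "card (ec_Aut E1) \<noteq> 0" by (metis card_0_eq empty_iff)
    thus ?thesis unfolding E1_def[symmetric] os[symmetric] of_nat_mult
      by (metis nonzero_mult_div_cancel_right of_nat_eq_0_iff mult.commute mult_1 times_divide_eq_left)
  qed
  have "mass S * of_nat ((CARD('a) - 1) * CARD('a) ^ 3) = (\<Sum>C\<in>cl ` S. of_nat (card C))"
    unfolding mass_def Q sum_distrib_right using weight by (rule sum.cong[OF refl])
  also have "\<dots> = of_nat (\<Sum>C\<in>cl ` S. card C)" by simp
  also have "(\<Sum>C\<in>cl ` S. card C) = card (\<Union> (cl ` S))"
  proof (rule card_Union_disjoint[symmetric])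
    show "pairwise disjnt (cl ` S)"
      unfolding pairwise_def disjnt_def using eqc by (metis (no_types, lifting) disjoint_iff imageE)
  qed (rule fin)
  also have "\<Union> (cl ` S) = S" using self sub by blast
  finally show ?thesis .
qed

lemma card_ec_group:
  fixes E :: "'a::{field,finite} weierstrass"
  shows "card (carrier (ec_group E)) = card (affine_points E) + 1"
proof -
  have "carrier (ec_group E) = insert Infinity ((\<lambda>(x, y). Affine x y) ` affine_points E)"
    by (auto simp: ec_group_def affine_points_def image_iff elim: on_curve.elims)
  moreover have "card ((\<lambda>(x, y). Affine x y) ` affine_points E) = card (affine_points E)"
    by (rule card_image) (auto simp: inj_on_def)
  moreover have "Infinity \<notin> (\<lambda>(x, y). Affine x y) ` affine_points E" by auto
  ultimately show ?thesis by (simp add: card_insert_if)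
qed


section \<open>Separable cubics\<close>

lemma four_nonzero: "(2::'a::field) \<noteq> 0 \<Longrightarrow> (4::'a) \<noteq> 0"
  by (metis mult_eq_0_iff num_double numeral_times_numeral)

text \<open>The cubic has no multiple root over the algebraic closure.\<close>

definition separable_cubic :: "'a::field \<Rightarrow> 'a \<Rightarrow> 'a \<Rightarrow> bool" where
  "separable_cubic a b c \<longleftrightarrow>
     (\<forall>z. \<not> (cubic (to_ac a) (to_ac b) (to_ac c) z = 0 \<and> cubic' (to_ac a) (to_ac b) z = 0))"

lemma separable_cubicD:
  assumes "separable_cubic a b c" "cubic a b c x = 0"
  shows "cubic' a b x \<noteq> 0"
proof
  assume "cubic' a b x = 0"
  hence "to_ac (cubic a b c x) = 0" "to_ac (cubic' a b x) = 0" using assms(2) by simp_all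
  thus False using assms(1) unfolding separable_cubic_def by (simp add: cubic_def cubic'_def) 
qed

lemma cubic_vieta:
  fixes a b c :: "'a::field"
  assumes e: "cubic a b c e1 = 0" "cubic a b c e2 = 0" "e1 \<noteq> e2"
  shows "b = e1 * e2 + (e1 + e2) * (- a - e1 - e2)" "c = - e1 * e2 * (- a - e1 - e2)"
proof -
  define \<beta> where "\<beta> = b - (e1 * e2 + (e1 + e2) * (- a - e1 - e2))"
  define \<gamma> where "\<gamma> = c + e1 * e2 * (- a - e1 - e2)"
  have "\<beta> * e1 + \<gamma> = cubic a b c e1" "\<beta> * e2 + \<gamma> = cubic a b c e2"
    by (simp_all add: \<beta>_def \<gamma>_def cubic_def algebra_simps power2_eq_square power3_eq_cube)
  hence *: "\<beta> * e1 + \<gamma> = 0" "\<beta> * e2 + \<gamma> = 0" using e by simp_all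
  have "\<beta> * (e1 - e2) = (\<beta> * e1 + \<gamma>) - (\<beta> * e2 + \<gamma>)" by (simp add: algebra_simps)
  hence "\<beta> = 0" unfolding * using e(3) by simp
  moreover from this have "\<gamma> = 0" using * by simp
  ultimately show "b = e1 * e2 + (e1 + e2) * (- a - e1 - e2)" "c = - e1 * e2 * (- a - e1 - e2)"
    by (simp_all add: \<beta>_def \<gamma>_def add_eq_0_iff2)
qed

text \<open>A separable cubic with two rational roots has a third one.\<close>

lemma cubic_two_roots:
  fixes a b c :: "'a::field"
  assumes sep: "separable_cubic a b c" and e: "cubic a b c e1 = 0" "cubic a b c e2 = 0" "e1 \<noteq> e2"
  defines "e3 \<equiv> - a - e1 - e2"
  shows "{x. cubic a b c x = 0} = {e1, e2, e3}" "e3 \<noteq> e1" "e3 \<noteq> e2"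
proof -
  have bc: "b = e1 * e2 + (e1 + e2) * e3" "c = - e1 * e2 * e3" and a: "a = - e1 - e2 - e3"
    using cubic_vieta[OF e] by (simp_all add: e3_def)
  have f: "cubic a b c x = (x - e1) * (x - e2) * (x - e3)" for x
    unfolding a bc cubic_def by (simp add: algebra_simps power2_eq_square power3_eq_cube)
  show "{x. cubic a b c x = 0} = {e1, e2, e3}" unfolding f by auto
  have "cubic' a b e1 = (e1 - e2) * (e1 - e3)" "cubic' a b e2 = (e2 - e1) * (e2 - e3)"
    unfolding a bc cubic'_def by (simp_all add: algebra_simps power2_eq_square)
  thus "e3 \<noteq> e1" "e3 \<noteq> e2" using separable_cubicD[OF sep] e by auto
qed

lemma card_cubic_roots:
  fixes a b c :: "'a::{field,finite}"
  assumes "separable_cubic a b c"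
  shows "card {x. cubic a b c x = 0} \<in> {0, 1, 3}"
proof (cases "card {x. cubic a b c x = 0} \<le> 1")
  case False
  then obtain e1 e2 where "cubic a b c e1 = 0" "cubic a b c e2 = 0" "e1 \<noteq> e2"
    by (auto simp: card_le_Suc0_iff_eq)
  from cubic_two_roots[OF assms this] this(3) show ?thesis by simp
next
  case True
  hence "card {x. cubic a b c x = 0} = 0 \<or> card {x. cubic a b c x = 0} = 1" by linarith
  thus ?thesis by (metis insert_iff)
qed

section \<open>Completing the square and two-torsion\<close>

text \<open>Completing the square turns \<open>y\<^sup>2 + a\<^sub>1 x y + a\<^sub>3 y = x\<^sup>3 + a\<^sub>2 x\<^sup>2 + a\<^sub>4 x + a\<^sub>6\<close> into \<open>z\<^sup>2 = g(x)\<close> with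
  \<open>z = y + (a\<^sub>1 x + a\<^sub>3) / 2\<close>. These are the coefficients of the monic cubic \<open>g\<close>.\<close>

definition sq_coeff2 :: "'a::field weierstrass \<Rightarrow> 'a" where "sq_coeff2 E = a2 E + a1 E ^ 2 / 4"
definition sq_coeff1 :: "'a::field weierstrass \<Rightarrow> 'a" where "sq_coeff1 E = a4 E + a1 E * a3 E / 2"
definition sq_coeff0 :: "'a::field weierstrass \<Rightarrow> 'a" where "sq_coeff0 E = a6 E + a3 E ^ 2 / 4"

abbreviation sq_cubic :: "'a::field weierstrass \<Rightarrow> 'a \<Rightarrow> 'a" where
  "sq_cubic E \<equiv> cubic (sq_coeff2 E) (sq_coeff1 E) (sq_coeff0 E)"

text \<open>The new coordinate \<open>z\<close>; it is half of the partial derivative by \<open>y\<close>.\<close>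

definition half_dy :: "'a::field weierstrass \<Rightarrow> 'a \<Rightarrow> 'a \<Rightarrow> 'a" where
  "half_dy E x y = y + (a1 E * x + a3 E) / 2"

lemma complete_square:
  fixes E :: "'a::field weierstrass"
  assumes two: "(2::'a) \<noteq> 0"
  shows "w_poly E x y = (half_dy E x y)\<^sup>2 - sq_cubic E x"
    and "w_poly_dx E x y = a1 E * half_dy E x y - cubic' (sq_coeff2 E) (sq_coeff1 E) x"
    and "w_poly_dy E x y = 2 * half_dy E x y"
proof -
  define A B where "A = a1 E / 2" and "B = a3 E / 2"
  have a: "a1 E = 2 * A" "a3 E = 2 * B" using two by (simp_all add: A_def B_def)
  have c: "sq_coeff2 E = a2 E + A\<^sup>2" "sq_coeff1 E = a4 E + 2 * A * B" "sq_coeff0 E = a6 E + B\<^sup>2"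
    using two four_nonzero[OF two]
    by (simp_all add: sq_coeff2_def sq_coeff1_def sq_coeff0_def a power2_eq_square)
  have h: "half_dy E x y = y + A * x + B"
    using two by (simp add: half_dy_def a add_divide_distrib)
  show "w_poly E x y = (half_dy E x y)\<^sup>2 - sq_cubic E x"
    "w_poly_dx E x y = a1 E * half_dy E x y - cubic' (sq_coeff2 E) (sq_coeff1 E) x"
    "w_poly_dy E x y = 2 * half_dy E x y"
    unfolding h c w_poly_def w_poly_dx_def w_poly_dy_def cubic_def cubic'_def a
    by (simp_all add: algebra_simps power2_eq_square power3_eq_cube)
qed

lemma elliptic_iff_separable:
  fixes E :: "'a::field weierstrass"
  assumes two: "(2::'a) \<noteq> 0"
  shows "elliptic E \<longleftrightarrow> separable_cubic (sq_coeff2 E) (sq_coeff1 E) (sq_coeff0 E)"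
proof -
  define F where "F = map_weierstrass to_ac E"
  have two': "(2::'a alg_closure) \<noteq> 0" using two by (metis to_ac_eq_0_iff to_ac_numeral)
  have F: "sq_coeff2 F = to_ac (sq_coeff2 E)" "sq_coeff1 F = to_ac (sq_coeff1 E)" "sq_coeff0 F = to_ac (sq_coeff0 E)"
    by (simp_all add: F_def sq_coeff2_def sq_coeff1_def sq_coeff0_def weierstrass.map_sel)
  have "(\<exists>y. w_poly F x y = 0 \<and> w_poly_dx F x y = 0 \<and> w_poly_dy F x y = 0) \<longleftrightarrow>
     sq_cubic F x = 0 \<and> cubic' (sq_coeff2 F) (sq_coeff1 F) x = 0" for x
  proof -
    have "half_dy F x (- ((a1 F * x + a3 F) / 2)) = 0" by (simp add: half_dy_def)
    thus ?thesis unfolding complete_square[OF two'] using two' by auto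
  qed
  hence "(\<exists>x y. w_poly F x y = 0 \<and> w_poly_dx F x y = 0 \<and> w_poly_dy F x y = 0) \<longleftrightarrow>
     (\<exists>x. sq_cubic F x = 0 \<and> cubic' (sq_coeff2 F) (sq_coeff1 F) x = 0)" by (simp only:)
  thus ?thesis by (simp only: elliptic_def Let_def F_def[symmetric] separable_cubic_def F[symmetric] not_ex[symmetric])
qed

text \<open>Points of \<open>w\<^sup>2 = h(x)\<close>.\<close>

lemma card_double_cover:
  fixes h :: "'i::finite \<Rightarrow> 'a::{field,finite}"
  assumes "odd (CARD('a))"
  shows "card {(x, w). w\<^sup>2 = h x} = card {x. h x = 0} + 2 * card {x. nz_square (h x)}"
proof -
  have "{(x, w). w\<^sup>2 = h x} = (SIGMA x:UNIV. {w. w\<^sup>2 = h x})" by auto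
  hence "card {(x, w). w\<^sup>2 = h x} = (\<Sum>x\<in>UNIV. card {w. w\<^sup>2 = h x})" by simp
  also have "\<dots> = (\<Sum>x\<in>UNIV. (if h x = 0 then 1 else 0) + 2 * (if nz_square (h x) then 1 else 0))"
    by (rule sum.cong[OF refl]) (simp add: card_square_roots[OF assms], simp add: nz_square_def)
  also have "\<dots> = card {x. h x = 0} + 2 * card {x. nz_square (h x)}"
    by (simp add: sum.distrib sum_distrib_left[symmetric] flip: sum.inter_filter)
  finally show ?thesis .
qed

lemma card_affine_points:
  fixes E :: "'a::{field,finite} weierstrass"
  assumes odd: "odd (CARD('a))"
  shows "card (affine_points E) = card {x. sq_cubic E x = 0} + 2 * card {x. nz_square (sq_cubic E x)}"
proof -
  have ap: "affine_points E = {(x, y). (half_dy E x y)\<^sup>2 = sq_cubic E x}"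
    by (simp add: affine_points_def complete_square(1)[OF odd_card_two_nonzero[OF odd]])
  have "bij_betw (\<lambda>(x, y). (x, half_dy E x y)) (affine_points E) {(x, w). w\<^sup>2 = sq_cubic E x}"
    unfolding ap by (rule bij_betwI[where g = "\<lambda>(x, w). (x, w - (a1 E * x + a3 E) / 2)"]) (auto simp: half_dy_def)
  from bij_betw_same_card[OF this] show ?thesis using card_double_cover[OF odd, of "sq_cubic E"] by simp
qed

lemma two_points_eq:
  fixes E :: "'a::field weierstrass"
  assumes two: "(2::'a) \<noteq> 0"
  shows "two_points E = (\<lambda>x. (x, - ((a1 E * x + a3 E) / 2))) ` {x. sq_cubic E x = 0}"
proof -
  have "half_dy E x y = 0 \<longleftrightarrow> y = - ((a1 E * x + a3 E) / 2)" for x y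
    by (simp add: half_dy_def add_eq_0_iff2)
  moreover have "w_poly E x y = 0 \<and> w_poly_dy E x y = 0 \<longleftrightarrow> half_dy E x y = 0 \<and> sq_cubic E x = 0" for x y
    unfolding complete_square[OF two] using two by auto
  ultimately show ?thesis unfolding two_points_def by auto
qed

lemma card_two_points:
  fixes E :: "'a::field weierstrass"
  assumes two: "(2::'a) \<noteq> 0"
  shows "card (two_points E) = card {x. sq_cubic E x = 0}"
  unfolding two_points_eq[OF two] by (rule card_image) (auto simp: inj_on_def)

lemma carrier_two_torsion:
  "carrier (two_torsion E) = insert Infinity ((\<lambda>(x, y). Affine x y) ` two_points E)"
proof -
  have "P [^]\<^bsub>ec_group E\<^esub> (2::nat) = ec_add E P P" for P
    unfolding nat_pow_def numeral_2_eq_2 ec_group_def by simp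
  moreover have "ec_add E (Affine x y) (Affine x y) = Infinity \<longleftrightarrow> w_poly_dy E x y = 0" for x y
  proof -
    have "w_poly_dy E x y = y + y + a1 E * x + a3 E" by (simp only: w_poly_dy_def mult_2)
    thus ?thesis by (cases "y + y + a1 E * x + a3 E = 0")
      (simp_all only: ec_add.simps Let_def if_True if_False simp_thms ec_point.distinct)
  qed
  ultimately have "P \<in> carrier (two_torsion E) \<longleftrightarrow> P \<in> insert Infinity ((\<lambda>(x, y). Affine x y) ` two_points E)" for P
    by (cases P) (auto simp: two_torsion_def ec_group_def two_points_def image_iff simp del: ec_add.simps(3))
  thus ?thesis by blast
qed

text \<open>The group structure is determined by the number of points because the chord through two points
  with \<open>z = 0\<close> meets the curve in the third such point.\<close>

lemma two_torsion_klein: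
  fixes E :: "'a::{field,finite} weierstrass"
  assumes odd: "odd (CARD('a))" and "elliptic E"
  shows "two_torsion E \<cong> integer_mod_group 2 \<times>\<times> integer_mod_group 2 \<longleftrightarrow> card (two_points E) = 3"
proof
  let ?K = "integer_mod_group 2 \<times>\<times> integer_mod_group 2"
  have carK: "carrier ?K = {0, 1} \<times> {0, 1}"
    by (auto simp: DirProd_def carrier_integer_mod_group)
  have card_car: "card (carrier (two_torsion E)) = card (two_points E) + 1"
  proof -
    have "inj_on (\<lambda>(x, y). Affine x y) (two_points E)" by (auto simp: inj_on_def)
    hence "card ((\<lambda>(x, y). Affine x y) ` two_points E) = card (two_points E)" by (rule card_image)
    thus ?thesis unfolding carrier_two_torsion by (subst card_insert_disjoint) auto
  qed
  {
    assume "two_torsion E \<cong> ?K"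
    then obtain h where "bij_betw h (carrier (two_torsion E)) (carrier ?K)"
      by (auto simp: is_iso_def iso_def)
    hence "card (carrier (two_torsion E)) = card (carrier ?K)" by (rule bij_betw_same_card)
    also have "\<dots> = 4" unfolding carK by (simp add: card_cartesian_product)
    finally show "card (two_points E) = 3" using card_car by simp
  }
  assume c3: "card (two_points E) = 3"
  note two = odd_card_two_nonzero[OF odd]
  define R where "R = {x. sq_cubic E x = 0}"
  have "card R = 3" using c3 card_two_points[OF two] by (simp add: R_def)
  then obtain e1 e2 e3 where R3: "R = {e1, e2, e3}" "e1 \<noteq> e2" "e1 \<noteq> e3" "e2 \<noteq> e3"
    by (auto simp: card_3_iff)
  have sep: "separable_cubic (sq_coeff2 E) (sq_coeff1 E) (sq_coeff0 E)"
    using assms(2) by (simp add: elliptic_iff_separable[OF two])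
  have roots: "sq_cubic E e1 = 0" "sq_cubic E e2 = 0" "sq_cubic E e3 = 0" using R3(1) by (auto simp: R_def)
  have e_sum: "e3 = - sq_coeff2 E - e1 - e2"
    using cubic_two_roots[OF sep roots(1,2) R3(2)] R3 unfolding R_def by auto
  define P where "P e = Affine e (- ((a1 E * e + a3 E) / 2))" for e
  have add_self: "ec_add E (P e) (P e) = Infinity" for e
  proof -
    let ?y = "- ((a1 E * e + a3 E) / 2)"
    have "?y + ?y + a1 E * e + a3 E = - (2 * ((a1 E * e + a3 E) / 2)) + (a1 E * e + a3 E)"
      by (simp only: mult_2 minus_add_distrib add.assoc)
    also have "\<dots> = 0" using two by simp
    finally show ?thesis by (simp only: P_def ec_add.simps if_True simp_thms)
  qed
  have add_other: "ec_add E (P e) (P e') = P (- sq_coeff2 E - e - e')" if ne: "e \<noteq> e'" for e e'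
  proof -
    define A B where "A = a1 E / 2" and "B = a3 E / 2"
    have a: "a1 E = 2 * A" "a3 E = 2 * B" using two by (simp_all add: A_def B_def)
    have c: "sq_coeff2 E = a2 E + A\<^sup>2"
      using four_nonzero[OF two] by (simp add: sq_coeff2_def a power2_eq_square)
    have P: "P e = Affine e (- A * e - B)" for e using two by (simp add: P_def a add_divide_distrib)
    have l: "(- A * e' - B - (- A * e - B)) / (e' - e) = - A"
      using ne by (simp add: divide_eq_eq algebra_simps)
    show ?thesis unfolding P ec_add.simps Let_def l a c
      using ne by (simp add: algebra_simps power2_eq_square)
  qed
  have s: "- sq_coeff2 E - e1 - e2 = e3" "- sq_coeff2 E - e2 - e1 = e3" "- sq_coeff2 E - e1 - e3 = e2"
     "- sq_coeff2 E - e3 - e1 = e2" "- sq_coeff2 E - e2 - e3 = e1" "- sq_coeff2 E - e3 - e2 = e1"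
    unfolding e_sum by (simp_all add: algebra_simps)
  have adds: "ec_add E (P e1) (P e2) = P e3" "ec_add E (P e2) (P e1) = P e3"
      "ec_add E (P e1) (P e3) = P e2" "ec_add E (P e3) (P e1) = P e2"
      "ec_add E (P e2) (P e3) = P e1" "ec_add E (P e3) (P e2) = P e1"
    using add_other R3 s by metis+
  have addI: "ec_add E Infinity Q = Q" "ec_add E Q Infinity = Q" for Q by (cases Q; simp)+
  have car: "carrier (two_torsion E) = {Infinity, P e1, P e2, P e3}"
    unfolding carrier_two_torsion two_points_eq[OF two] R_def[symmetric] R3(1) by (auto simp: P_def)
  have dist: "P e1 \<noteq> P e2" "P e1 \<noteq> P e3" "P e2 \<noteq> P e3" "P e \<noteq> Infinity" for e
    using R3 by (simp_all add: P_def)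
  define h :: "'a ec_point \<Rightarrow> int \<times> int" where
    "h Q = (if Q = P e1 then (1, 0) else if Q = P e2 then (0, 1) else if Q = P e3 then (1, 1) else (0, 0))" for Q
  have h: "h (P e1) = (1, 0)" "h (P e2) = (0, 1)" "h (P e3) = (1, 1)" "h Infinity = (0, 0)"
    using dist dist(4)[symmetric] by (simp_all add: h_def)
  have mT: "x \<otimes>\<^bsub>two_torsion E\<^esub> y = ec_add E x y" for x y by (simp add: two_torsion_def ec_group_def)
  have mK: "(a, b) \<otimes>\<^bsub>?K\<^esub> (c, d) = ((a + c) mod 2, (b + d) mod 2)" for a b c d
    by (simp add: mult_DirProd mult_integer_mod_group)
  have "h \<in> iso (two_torsion E) ?K"
  proof (rule isoI)
    show "h \<in> hom (two_torsion E) ?K"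
    proof (rule homI)
      fix x y assume "x \<in> carrier (two_torsion E)" "y \<in> carrier (two_torsion E)"
      thus "h (x \<otimes>\<^bsub>two_torsion E\<^esub> y) = h x \<otimes>\<^bsub>?K\<^esub> h y"
        unfolding car mT by (auto simp: adds addI add_self h mK simp del: ec_add.simps)
    qed (auto simp: car carK h)
    show "bij_betw h (carrier (two_torsion E)) (carrier ?K)"
      unfolding bij_betw_def car carK using dist by (auto simp: inj_on_def h)
  qed
  thus "two_torsion E \<cong> ?K" by (auto simp: is_iso_def)
qed


section \<open>Points of the projective line\<close>

text \<open>The points \<open>(1 : 0)\<close> and \<open>(s : 1)\<close> of the projective line.\<close>

definition pt_inf :: "('a::field \<times> 'a) set" where "pt_inf = proj_rel `` {(1, 0)}"
definition pt :: "'a::field \<Rightarrow> ('a \<times> 'a) set" where "pt s = proj_rel `` {(s, 1)}"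

lemma proj_class: "v \<noteq> (0, 0) \<Longrightarrow> proj_rel `` {v} = {(c * fst v, c * snd v) |c. c \<noteq> 0}"
  by (cases v) (auto simp: proj_rel_def)

lemma proj_line_iff: "P \<in> proj_line \<longleftrightarrow> (\<exists>v. v \<noteq> (0, 0) \<and> P = proj_rel `` {v})"
  by (auto simp: proj_line_def quotient_def)

lemma mem_pt_inf: "(x, y) \<in> pt_inf \<longleftrightarrow> x \<noteq> 0 \<and> y = 0"
  by (auto simp: pt_inf_def proj_class)

lemma mem_pt: "(x, y) \<in> pt s \<longleftrightarrow> y \<noteq> 0 \<and> x = y * s"
  by (auto simp: pt_def proj_class)

lemma proj_line_eq: "proj_line = insert pt_inf (range pt)"
proof (rule Set.set_eqI)
  fix P :: "('a \<times> 'a) set"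
  show "P \<in> proj_line \<longleftrightarrow> P \<in> insert pt_inf (range pt)"
  proof
    assume "P \<in> proj_line"
    then obtain x y where v: "(x, y) \<noteq> (0, 0)" "P = proj_rel `` {(x, y)}" by (auto simp: proj_line_iff)
    have mem: "(a, b) \<in> P \<longleftrightarrow> (\<exists>c. c \<noteq> 0 \<and> a = c * x \<and> b = c * y)" for a b
      unfolding v(2) proj_class[OF v(1)] by auto
    show "P \<in> insert pt_inf (range pt)"
    proof (cases "y = 0")
      case True
      have "P = pt_inf"
      proof (rule Set.set_eqI, clarify)
        fix a b
        have x: "x \<noteq> 0" using v(1) True by simp
        have "(a, b) \<in> P" if "a \<noteq> 0" "b = 0"
          unfolding mem by (rule exI[of _ "a / x"]) (use that x True in simp)
        thus "(a, b) \<in> P \<longleftrightarrow> (a, b) \<in> pt_inf" using x True unfolding mem mem_pt_inf by auto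
      qed
      thus ?thesis by simp
    next
      case False
      have "P = pt (x / y)"
      proof (rule Set.set_eqI, clarify)
        fix a b
        have "(a, b) \<in> P" if "b \<noteq> 0" "a = b * (x / y)"
          unfolding mem by (rule exI[of _ "b / y"]) (use that False in simp)
        thus "(a, b) \<in> P \<longleftrightarrow> (a, b) \<in> pt (x / y)" using False unfolding mem mem_pt by auto
      qed
      thus ?thesis by simp
    qed
  next
    assume "P \<in> insert pt_inf (range pt)"
    moreover have "pt_inf \<in> proj_line" unfolding proj_line_iff pt_inf_def by (intro exI[of _ "(1, 0)"]) simp
    moreover have "pt s \<in> proj_line" for s unfolding proj_line_iff pt_def by (intro exI[of _ "(s, 1)"]) simp
    ultimately show "P \<in> proj_line" by auto
  qed
qed

lemma inj_pt: "inj pt"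
proof (rule injI)
  fix s t :: 'a
  assume "pt s = pt t"
  moreover have "(s, 1) \<in> pt s" by (simp add: mem_pt)
  ultimately show "s = t" by (simp add: mem_pt)
qed

lemma pt_neq_inf: "pt s \<noteq> pt_inf"
  using mem_pt[of s 1 s] mem_pt_inf[of s 1] by auto

lemma finite_proj_line: "finite (proj_line :: ('a::{field,finite} \<times> 'a) set set)"
  by (simp add: proj_line_eq)

lemma card_proj_line: "card (proj_line :: ('a::{field,finite} \<times> 'a) set set) = CARD('a) + 1"
  unfolding proj_line_eq using pt_neq_inf by (subst card_insert_disjoint) (auto simp: card_image inj_pt)

text \<open>The points of the projective line all of whose representatives satisfy a predicate. For
  predicates that do not depend on the representative (the second definition) it suffices to look at
  one representative.\<close>

definition proj_set :: "('a::field \<times> 'a \<Rightarrow> bool) \<Rightarrow> ('a \<times> 'a) set set" where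
  "proj_set Q = {P \<in> proj_line. \<forall>v\<in>P. Q v}"

definition homogeneous_pred :: "('a::field \<times> 'a \<Rightarrow> bool) \<Rightarrow> bool" where
  "homogeneous_pred Q \<longleftrightarrow> (\<forall>c x y. c \<noteq> 0 \<longrightarrow> Q (c * x, c * y) = Q (x, y))"

lemma proj_set_eq:
  assumes "homogeneous_pred Q"
  shows "proj_set Q = (if Q (1, 0) then {pt_inf} else {}) \<union> pt ` {s. Q (s, 1)}"
proof -
  have h: "c \<noteq> 0 \<Longrightarrow> Q (c * x, c * y) = Q (x, y)" for c x y using assms by (simp add: homogeneous_pred_def)
  have "Q v = Q (1, 0)" if "v \<in> pt_inf" for v
    using that h[of "fst v" 1 0] by (cases v) (simp add: mem_pt_inf)
  moreover have "(1, 0) \<in> pt_inf" by (simp add: mem_pt_inf)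
  ultimately have 1: "(\<forall>v\<in>pt_inf. Q v) \<longleftrightarrow> Q (1, 0)" by blast
  have "Q v = Q (s, 1)" if "v \<in> pt s" for v s
    using that h[of "snd v" s 1] by (cases v) (simp add: mem_pt)
  moreover have "(s, 1) \<in> pt s" for s by (simp add: mem_pt)
  ultimately have 2: "(\<forall>v\<in>pt s. Q v) \<longleftrightarrow> Q (s, 1)" for s by blast
  show ?thesis unfolding proj_set_def proj_line_eq using 1 2 by auto
qed

lemma card_proj_set:
  assumes "homogeneous_pred Q" "finite {s. Q (s, 1)}"
  shows "card (proj_set Q) = (if Q (1, 0) then 1 else 0) + card {s. Q (s, 1)}"
proof -
  have "card (pt ` {s. Q (s, 1)}) = card {s. Q (s, 1)}" by (rule card_image) (meson inj_pt inj_on_subset subset_UNIV)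
  thus ?thesis unfolding proj_set_eq[OF assms(1)] using assms(2) pt_neq_inf
    by (subst card_Un_disjoint) auto
qed

text \<open>An invertible linear map that takes \<open>(1, 0)\<close> to \<open>(s, 1)\<close>.\<close>

definition move_vec :: "'a::field \<Rightarrow> 'a \<times> 'a \<Rightarrow> 'a \<times> 'a" where
  "move_vec s = (\<lambda>(x, y). (s * x + y, x))"

lemma card_proj_set_move:
  fixes Q :: "'a::field \<times> 'a \<Rightarrow> bool"
  shows "card (proj_set (\<lambda>v. Q (move_vec s v))) = card (proj_set Q)"
proof (rule bij_betw_same_card)
  define unmove where "unmove = (\<lambda>(x, y). (y, x - s * y))"
  have i: "unmove (move_vec s v) = v" "move_vec s (unmove v) = v" for v
    by (cases v; simp add: unmove_def move_vec_def)+
  have z: "move_vec s v \<noteq> (0, 0)" "unmove v \<noteq> (0, 0)" if "v \<noteq> (0, 0)" for v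
  proof -
    have "move_vec s (0, 0) = (0, 0)" "unmove (0, 0) = (0, 0)" by (simp_all add: unmove_def move_vec_def)
    thus "move_vec s v \<noteq> (0, 0)" "unmove v \<noteq> (0, 0)" using that i[of v] by metis+
  qed
  have cl: "move_vec s ` (proj_rel `` {v}) = proj_rel `` {move_vec s v}"
     "unmove ` (proj_rel `` {v}) = proj_rel `` {unmove v}" if v: "v \<noteq> (0, 0)" for v
  proof -
    have l: "move_vec s (c * fst v, c * snd v) = (c * fst (move_vec s v), c * snd (move_vec s v))"
      "unmove (c * fst v, c * snd v) = (c * fst (unmove v), c * snd (unmove v))" for c
      by (cases v; simp add: unmove_def move_vec_def algebra_simps)+
    have im: "{(c * fst v, c * snd v) |c. c \<noteq> 0} = (\<lambda>c. (c * fst v, c * snd v)) ` {c. c \<noteq> 0}" for v :: "'a \<times> 'a"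
      by auto
    show "move_vec s ` (proj_rel `` {v}) = proj_rel `` {move_vec s v}"
     "unmove ` (proj_rel `` {v}) = proj_rel `` {unmove v}"
      unfolding proj_class[OF v] proj_class[OF z(1)[OF v]] proj_class[OF z(2)[OF v]] im image_image l by simp_all
  qed
  have line: "move_vec s ` P \<in> proj_line" "unmove ` P \<in> proj_line" if P: "P \<in> proj_line" for P
  proof -
    obtain v where v: "v \<noteq> (0, 0)" "P = proj_rel `` {v}" using P unfolding proj_line_iff by blast
    show "move_vec s ` P \<in> proj_line" "unmove ` P \<in> proj_line"
      unfolding v(2) cl[OF v(1)] proj_line_iff using z[OF v(1)] by blast+
  qed
  show "bij_betw (\<lambda>P. move_vec s ` P) (proj_set (\<lambda>v. Q (move_vec s v))) (proj_set Q)"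
  proof (rule bij_betwI[where g = "\<lambda>P. unmove ` P"])
    show "(`) (move_vec s) \<in> proj_set (\<lambda>v. Q (move_vec s v)) \<rightarrow> proj_set Q"
    proof
      fix P assume "P \<in> proj_set (\<lambda>v. Q (move_vec s v))"
      thus "move_vec s ` P \<in> proj_set Q" using line(1)[of P] unfolding proj_set_def by blast
    qed
    show "(`) unmove \<in> proj_set Q \<rightarrow> proj_set (\<lambda>v. Q (move_vec s v))"
    proof
      fix P assume "P \<in> proj_set Q"
      thus "unmove ` P \<in> proj_set (\<lambda>v. Q (move_vec s v))"
        using line(2)[of P] i(2) unfolding proj_set_def by auto
    qed
  qed (simp_all add: image_image i)
qed

section \<open>Substitutions in binary quartics\<close>

lemma finite_quartics: "finite (S :: 'a::finite quartic set)"
proof -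
  have "UNIV = (\<lambda>(a,b,c,d,e). Quartic a b c d (e::'a)) ` UNIV"
    by (auto simp: image_iff) (metis quartic.exhaust)
  thus ?thesis by (metis finite finite_imageI rev_finite_subset subset_UNIV)
qed

lemma quartic_eval_scale: "quartic_eval f (c * x, c * y) = c ^ 4 * quartic_eval f (x, y)"
  by (cases f) (simp add: algebra_simps eval_nat_numeral)

lemma nz_square_mult_power4:
  assumes "(c::'a::field) \<noteq> 0" shows "nz_square (c ^ 4 * x) \<longleftrightarrow> nz_square x"
proof
  assume "nz_square (c ^ 4 * x)"
  then obtain w where w: "w \<noteq> 0" "c ^ 4 * x = w\<^sup>2" by (auto simp: nz_square_def)
  have "x = (w / c\<^sup>2)\<^sup>2" using w(2) assms by (simp add: power_divide field_simps flip: power_mult)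
  thus "nz_square x" using w(1) assms by (auto simp: nz_square_def intro!: exI[of _ "w / c\<^sup>2"])
next
  assume "nz_square x"
  then obtain w where w: "w \<noteq> 0" "x = w\<^sup>2" by (auto simp: nz_square_def)
  show "nz_square (c ^ 4 * x)" unfolding nz_square_def
    by (rule exI[of _ "c\<^sup>2 * w"]) (use w assms in \<open>simp add: power_mult_distrib flip: power_mult\<close>)
qed

lemma quartic_sets:
  "quartic_roots f = proj_set (\<lambda>v. quartic_eval f v = 0)"
  "quartic_squares f = proj_set (\<lambda>v. nz_square (quartic_eval f v))"
  "quartic_nonsquares f = proj_set (\<lambda>v. quartic_eval f v \<noteq> 0 \<and> \<not> nz_square (quartic_eval f v))"
proof -
  have "(\<not> (\<exists>w. x = w\<^sup>2)) \<longleftrightarrow> x \<noteq> 0 \<and> \<not> nz_square x" for x :: 'a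
    by (auto simp: nz_square_def) 
  thus "quartic_nonsquares f = proj_set (\<lambda>v. quartic_eval f v \<noteq> 0 \<and> \<not> nz_square (quartic_eval f v))"
    by (simp add: quartic_nonsquares_def proj_set_def)
qed (simp_all add: quartic_roots_def quartic_squares_def proj_set_def nz_square_def)

lemma homogeneous_quartic_eval:
  assumes "\<And>c x. c \<noteq> 0 \<Longrightarrow> R (c ^ 4 * x) = R x"
  shows "homogeneous_pred (\<lambda>v. R (quartic_eval f v))"
  using assms by (simp add: homogeneous_pred_def quartic_eval_scale)

lemma homogeneous_quartic:
  "homogeneous_pred (\<lambda>v. quartic_eval f v = 0)"
  "homogeneous_pred (\<lambda>v. nz_square (quartic_eval f v))"
  "homogeneous_pred (\<lambda>v. quartic_eval f v \<noteq> 0 \<and> \<not> nz_square (quartic_eval f v))"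
  using homogeneous_quartic_eval[of "\<lambda>x. x = 0" f] homogeneous_quartic_eval[of nz_square f]
    homogeneous_quartic_eval[of "\<lambda>x. x \<noteq> 0 \<and> \<not> nz_square x" f]
  by (simp_all add: nz_square_mult_power4)

text \<open>The coefficient of \<open>x\<^sup>4\<close>, which is the value at the point \<open>(1 : 0)\<close>.\<close>

fun lead :: "'a quartic \<Rightarrow> 'a" where "lead (Quartic a b c d e) = a"

lemma quartic_eval_lead: "quartic_eval f (1, 0) = lead f"
  by (cases f) simp

lemma card_quartic_sets:
  fixes f :: "'a::{field,finite} quartic"
  shows "card (quartic_roots f) = (if lead f = 0 then 1 else 0) + card {s. quartic_eval f (s, 1) = 0}"
    and "card (quartic_squares f) = (if nz_square (lead f) then 1 else 0) + card {s. nz_square (quartic_eval f (s, 1))}"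
  unfolding quartic_sets by (subst card_proj_set; simp add: homogeneous_quartic quartic_eval_lead)+

lemma card_quartic_sets_sum:
  fixes f :: "'a::{field,finite} quartic"
  shows "card (quartic_roots f) + card (quartic_squares f) + card (quartic_nonsquares f) = CARD('a) + 1"
proof -
  have nz: "\<not> nz_square (0::'a)" by (simp add: nz_square_def)
  have eq: "proj_line = quartic_roots f \<union> quartic_squares f \<union> quartic_nonsquares f"
    unfolding quartic_sets homogeneous_quartic[THEN proj_set_eq] proj_line_eq by auto
  have fin: "finite (quartic_roots f)" "finite (quartic_squares f)" "finite (quartic_nonsquares f)"
    using finite_proj_line by (auto simp: quartic_sets proj_set_def)
  have ne: "P \<noteq> {}" if "P \<in> proj_line" for P :: "('a \<times> 'a) set"
  proof -
    have "(1, 0) \<in> (pt_inf :: ('a \<times> 'a) set)" "(s, 1) \<in> pt s" for s :: 'a by (simp_all add: mem_pt_inf mem_pt)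
    thus ?thesis using that unfolding proj_line_eq by blast
  qed
  have disj: "proj_set Q \<inter> proj_set Q' = {}" if "\<And>v. Q v \<Longrightarrow> \<not> Q' v" for Q Q' :: "'a \<times> 'a \<Rightarrow> bool"
    using that ne unfolding proj_set_def by blast
  have dis: "quartic_roots f \<inter> quartic_squares f = {}" "(quartic_roots f \<union> quartic_squares f) \<inter> quartic_nonsquares f = {}"
  proof -
    show "quartic_roots f \<inter> quartic_squares f = {}"
      unfolding quartic_sets by (rule disj) (simp add: nz)
    have "quartic_roots f \<inter> quartic_nonsquares f = {}" "quartic_squares f \<inter> quartic_nonsquares f = {}"
      unfolding quartic_sets by (rule disj; simp)+
    thus "(quartic_roots f \<union> quartic_squares f) \<inter> quartic_nonsquares f = {}" by blast
  qed
  show ?thesis unfolding card_proj_line[symmetric] eq using fin dis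
    by (simp add: card_Un_disjoint)
qed

text \<open>The quartic \<open>f(s x + y, x)\<close>; its value at \<open>(1 : 0)\<close> is the value of \<open>f\<close> at \<open>(s : 1)\<close>.\<close>

fun move :: "'a::field \<Rightarrow> 'a quartic \<Rightarrow> 'a quartic" where
  "move s (Quartic a b c d e) = Quartic
     (a * s ^ 4 + b * s ^ 3 + c * s ^ 2 + d * s + e)
     (4 * a * s ^ 3 + 3 * b * s ^ 2 + 2 * c * s + d)
     (6 * a * s ^ 2 + 3 * b * s + c)
     (4 * a * s + b)
     a"

lemma quartic_eval_move: "quartic_eval (move s f) v = quartic_eval f (move_vec s v)"
proof (cases f)
  case (Quartic a b c d e)
  obtain x y where "v = (x, y)" by (cases v)
  thus ?thesis unfolding Quartic by (simp add: move_vec_def algebra_simps eval_nat_numeral)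
qed

lemma lead_move: "lead (move s f) = quartic_eval f (s, 1)"
  using quartic_eval_move[of s f "(1, 0)"] by (simp add: quartic_eval_lead move_vec_def)

lemma map_quartic_move: "map_quartic to_ac (move s f) = move (to_ac s) (map_quartic to_ac f)"
  by (cases f) simp

lemma bij_move: "bij (move (s :: 'a::{field,finite}))"
proof -
  have "inj (move s)"
  proof (rule injI)
    fix f g :: "'a quartic" assume "move s f = move s g"
    thus "f = g" by (cases f; cases g) auto
  qed
  thus ?thesis by (simp add: finite_quartics finite_UNIV_inj_surj bij_def)
qed

lemma quartic_invariants_move:
  "card (quartic_roots (move s f)) = card (quartic_roots f)"
  "card (quartic_squares (move s f)) = card (quartic_squares f)"
  "card (quartic_nonsquares (move s f)) = card (quartic_nonsquares f)"
  "has_distinct_roots (move s f) = has_distinct_roots f"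
  unfolding has_distinct_roots_def map_quartic_move quartic_sets quartic_eval_move
  using card_proj_set_move[of "\<lambda>v. quartic_eval f v = 0" s]
    card_proj_set_move[of "\<lambda>v. nz_square (quartic_eval f v)" s]
    card_proj_set_move[of "\<lambda>v. quartic_eval f v \<noteq> 0 \<and> \<not> nz_square (quartic_eval f v)" s]
    card_proj_set_move[of "\<lambda>v. quartic_eval (map_quartic to_ac f) v = 0" "to_ac s"]
  by simp_all

lemma quartic_eval_mult: "quartic_eval (map_quartic ((*) k) f) v = k * quartic_eval f v"
proof (cases f)
  case (Quartic a b c d e)
  thus ?thesis by (cases v) (simp add: algebra_simps)
qed

lemma map_quartic_mult_to_ac: "map_quartic to_ac (map_quartic ((*) k) f) = map_quartic ((*) (to_ac k)) (map_quartic to_ac f)"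
  by (cases f) simp

lemma has_distinct_roots_mult:
  "k \<noteq> 0 \<Longrightarrow> has_distinct_roots (map_quartic ((*) k) f) = has_distinct_roots f"
  unfolding has_distinct_roots_def map_quartic_mult_to_ac quartic_sets quartic_eval_mult by simp

lemma quartic_roots_mult:
  "k \<noteq> 0 \<Longrightarrow> quartic_roots (map_quartic ((*) k) f) = quartic_roots f"
  unfolding quartic_sets quartic_eval_mult by simp

lemma nz_square_mult_square:
  assumes "(u::'a::field) \<noteq> 0" shows "nz_square (u\<^sup>2 * x) \<longleftrightarrow> nz_square x"
proof
  assume "nz_square (u\<^sup>2 * x)"
  then obtain w where w: "w \<noteq> 0" "u\<^sup>2 * x = w\<^sup>2" by (auto simp: nz_square_def)
  have "x = (w / u)\<^sup>2" using w(2) assms by (simp add: power_divide field_simps)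
  thus "nz_square x" using w(1) assms by (auto simp: nz_square_def intro!: exI[of _ "w / u"])
next
  assume "nz_square x"
  then obtain w where w: "w \<noteq> 0" "x = w\<^sup>2" by (auto simp: nz_square_def)
  show "nz_square (u\<^sup>2 * x)" unfolding nz_square_def
    by (rule exI[of _ "u * w"]) (use w assms in \<open>simp add: power_mult_distrib\<close>)
qed

lemma quartic_squares_mult:
  "u \<noteq> 0 \<Longrightarrow> quartic_squares (map_quartic ((*) (u\<^sup>2)) f) = quartic_squares f"
  unfolding quartic_sets quartic_eval_mult by (simp add: nz_square_mult_square)

text \<open>In a set of quartics that is closed under these substitutions, every point of the projective
  line contributes as much as \<open>(1 : 0)\<close> does.\<close>

lemma double_count_points:
  fixes S :: "'a::{field,finite} quartic set"
  assumes closed: "\<And>s f. move s f \<in> S \<longleftrightarrow> f \<in> S"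
    and hom: "\<And>c x. c \<noteq> 0 \<Longrightarrow> R (c ^ 4 * x) = R x"
  shows "(\<Sum>f\<in>S. card (proj_set (\<lambda>v. R (quartic_eval f v)))) = (CARD('a) + 1) * card {f \<in> S. R (lead f)}"
proof -
  note [simp] = finite_quartics
  let ?L = "{f \<in> S. R (lead f)}"
  have fib: "card {f \<in> S. R (quartic_eval f (s, 1))} = card ?L" for s
  proof (rule bij_betw_same_card[of "move s"])
    show "bij_betw (move s) {f \<in> S. R (quartic_eval f (s, 1))} ?L"
      unfolding bij_betw_def
    proof
      show "inj_on (move s) {f \<in> S. R (quartic_eval f (s, 1))}"
        using bij_move[of s] by (meson bij_is_inj inj_on_subset subset_UNIV)
      show "move s ` {f \<in> S. R (quartic_eval f (s, 1))} = ?L"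
      proof (intro equalityI subsetI)
        fix g assume g: "g \<in> ?L"
        obtain f where "g = move s f" using bij_move[of s] by (meson bij_pointE)
        thus "g \<in> move s ` {f \<in> S. R (quartic_eval f (s, 1))}" using g by (auto simp: closed lead_move)
      qed (auto simp: closed lead_move)
    qed
  qed
  have "(\<Sum>f\<in>S. card (proj_set (\<lambda>v. R (quartic_eval f v)))) =
    (\<Sum>f\<in>S. (if R (lead f) then 1 else 0) + card {s. R (quartic_eval f (s, 1))})"
    using card_proj_set[OF homogeneous_quartic_eval[of R, OF hom]] by (simp add: quartic_eval_lead)
  also have "\<dots> = card ?L + (\<Sum>f\<in>S. \<Sum>s\<in>UNIV. if R (quartic_eval f (s, 1)) then 1 else 0)"
    by (simp add: sum.distrib flip: sum.inter_filter)
  also have "(\<Sum>f\<in>S. \<Sum>s\<in>UNIV. if R (quartic_eval f (s, 1)) then 1 else (0::nat)) =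
     (\<Sum>s\<in>UNIV. \<Sum>f\<in>S. if R (quartic_eval f (s, 1)) then 1 else 0)" by (rule sum.swap)
  also have "\<dots> = (\<Sum>s\<in>(UNIV::'a set). card {f \<in> S. R (quartic_eval f (s, 1))})"
    by (simp flip: sum.inter_filter)
  also have "\<dots> = CARD('a) * card ?L" by (simp add: fib)
  finally show ?thesis by simp
qed


section \<open>Quartics with distinct roots\<close>

text \<open>A multiset has as many different elements as elements if and only if it has no repetition.\<close>

lemma card_set_mset_eq_size:
  "card (set_mset A) = size A \<longleftrightarrow> (\<forall>x B. A = add_mset x B \<longrightarrow> x \<notin># B)"
proof
  assume "card (set_mset A) = size A"
  hence "size (mset_set (set_mset A)) = size A" by simp
  moreover have "mset_set (set_mset A) \<subseteq># A" by (simp add: mset_set_set_mset_msubset)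
  ultimately have "mset_set (set_mset A) = A" by (metis mset_subset_size nless_le subset_mset.less_le)
  hence "count A x \<le> 1" for x by (metis count_mset_set' le_refl zero_le_one)
  thus "\<forall>x B. A = add_mset x B \<longrightarrow> x \<notin># B" by (metis count_add_mset count_eq_zero_iff le_zero_eq Suc_le_mono One_nat_def)
next
  assume "\<forall>x B. A = add_mset x B \<longrightarrow> x \<notin># B"
  thus "card (set_mset A) = size A"
  proof (induction A)
    case (add x A)
    have "x \<notin># A" using add.prems by blast
    moreover have "y \<notin># B" if "A = add_mset y B" for y B
      using add.prems that by (metis add_mset_commute union_iff add_mset_add_single)
    ultimately show ?case using add.IH by simp
  qed simp
qed

lemma card_roots_eq_degree_iff:
  fixes p :: "'b::alg_closed_field poly"
  assumes "p \<noteq> 0"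
  shows "card {z. poly p z = 0} = degree p \<longleftrightarrow> (\<forall>z. \<not> (poly p z = 0 \<and> poly (pderiv p) z = 0))"
proof -
  obtain A where A: "size A = degree p" "p = smult (lead_coeff p) (\<Prod>x\<in>#A. [:- x, 1:])"
    using alg_closed_imp_factorization[OF assms] by blast
  define c where "c = lead_coeff p"
  have c: "c \<noteq> 0" using assms by (simp add: c_def)
  have p: "p = smult c (\<Prod>x\<in>#A. [:- x, 1:])" using A(2) by (simp add: c_def)
  have z: "poly (\<Prod>x\<in>#B. [:- x, 1:]) z = 0 \<longleftrightarrow> z \<in># B" for B and z :: 'b
    by (induction B) auto
  have roots: "poly p z = 0 \<longleftrightarrow> z \<in># A" for z using c by (subst p) (simp add: z)
  have der: "poly (pderiv p) x = 0 \<longleftrightarrow> x \<in># B" if "A = add_mset x B" for x B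
  proof -
    have "p = smult c ([:- x, 1:] * (\<Prod>x\<in>#B. [:- x, 1:]))" using p that by simp
    hence "poly (pderiv p) x = c * poly (\<Prod>x\<in>#B. [:- x, 1:]) x"
      unfolding pderiv_smult pderiv_mult by (simp only: pderiv_smult pderiv_mult) (simp add: pderiv_pCons)
    thus ?thesis using c z by simp
  qed
  have "card {z. poly p z = 0} = card (set_mset A)" by (simp add: roots)
  moreover have "(\<forall>z. \<not> (poly p z = 0 \<and> poly (pderiv p) z = 0)) \<longleftrightarrow> (\<forall>x B. A = add_mset x B \<longrightarrow> x \<notin># B)"
  proof
    assume l: "\<forall>z. \<not> (poly p z = 0 \<and> poly (pderiv p) z = 0)"
    show "\<forall>x B. A = add_mset x B \<longrightarrow> x \<notin># B"
      using l der roots by (metis union_single_eq_member add_mset_add_single)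
  next
    assume r: "\<forall>x B. A = add_mset x B \<longrightarrow> x \<notin># B"
    show "\<forall>z. \<not> (poly p z = 0 \<and> poly (pderiv p) z = 0)"
      using r der roots by (metis insert_DiffM)
  qed
  ultimately show ?thesis using card_set_mset_eq_size[of A] A(1) by simp
qed

lemma infinite_UNIV_alg_closed: "infinite (UNIV :: 'b::alg_closed_field set)"
proof
  assume fin: "finite (UNIV :: 'b set)"
  define p where "p = (\<Prod>x\<in>(UNIV :: 'b set). [:- x, 1:]) + 1"
  have "degree (\<Prod>x\<in>(UNIV :: 'b set). [:- x, 1:]) = card (UNIV :: 'b set)"
    using degree_prod_linear_powers[of "\<lambda>x. x" "\<lambda>_. 1" "UNIV :: 'b set"] by simp
  hence "degree p = card (UNIV :: 'b set)"
    unfolding p_def by (subst degree_add_eq_left) (use fin in \<open>auto simp: finite_UNIV_card_ge_0\<close>)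
  then obtain z where "poly p z = 0" using alg_closed_imp_poly_has_root[of p] fin finite_UNIV_card_ge_0 by metis
  moreover have "poly p z = 1" using fin by (simp add: p_def poly_prod)
  ultimately show False by simp
qed

text \<open>Over an infinite field, the cardinality of the root set of the zero form is zero by the convention
  for infinite sets, so that the zero form is not counted as having four roots.\<close>

lemma card_quartic_roots_infinite:
  assumes "infinite {s. quartic_eval f (s, 1) = 0}"
  shows "card (quartic_roots f) = 0"
proof -
  have "infinite (pt ` {s. quartic_eval f (s, 1) = 0})"
    using assms inj_pt by (metis finite_imageD inj_on_subset subset_UNIV)
  hence "infinite (quartic_roots f)"
    unfolding quartic_sets homogeneous_quartic(1)[THEN proj_set_eq] by simp
  thus ?thesis by simp
qed

lemma quartic_eval_poly: "quartic_eval (Quartic a b c d e) (s, 1) = poly [:e, d, c, b, a:] s"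
  by (simp add: algebra_simps eval_nat_numeral)

lemma card_quartic_roots_poly:
  fixes f :: "'b::field quartic"
  assumes f: "f = Quartic a b c d e" and nz: "[:e, d, c, b, a:] \<noteq> 0"
  shows "card (quartic_roots f) = (if a = 0 then 1 else 0) + card {s. poly [:e, d, c, b, a:] s = 0}"
proof -
  have *: "{s. quartic_eval f (s, 1) = 0} = {s. poly [:e, d, c, b, a:] s = 0}"
    unfolding f quartic_eval_poly ..
  have "finite {s. quartic_eval f (s, 1) = 0}" unfolding * by (rule poly_roots_finite[OF nz])
  thus ?thesis unfolding quartic_sets using card_proj_set[OF homogeneous_quartic(1)[of f]]
    unfolding * quartic_eval_lead by (simp add: f)
qed

lemma distinct_roots_monic:
  fixes b c d e :: "'b::alg_closed_field"
  shows "card (quartic_roots (Quartic 1 b c d e)) = 4 \<longleftrightarrow>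
     (\<forall>z. \<not> (poly [:e, d, c, b, 1:] z = 0 \<and> poly (pderiv [:e, d, c, b, 1:]) z = 0))"
  using card_quartic_roots_poly[of "Quartic 1 b c d e" 1 b c d e] card_roots_eq_degree_iff[of "[:e, d, c, b, 1:]"]
  by (simp add: eval_nat_numeral)

lemma distinct_roots_lead_zero:
  fixes b c d e :: "'b::alg_closed_field"
  shows "card (quartic_roots (Quartic 0 b c d e)) = 4 \<longleftrightarrow> b \<noteq> 0 \<and>
     (\<forall>z. \<not> (poly [:e, d, c, b:] z = 0 \<and> poly (pderiv [:e, d, c, b:]) z = 0))"
proof (cases "[:e, d, c, b:] = 0")
  case True
  hence "{s. quartic_eval (Quartic 0 b c d e) (s, 1) = 0} = UNIV" by simp
  hence "card (quartic_roots (Quartic 0 b c d e)) = 0"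
    using card_quartic_roots_infinite[of "Quartic 0 b c d e"] infinite_UNIV_alg_closed by (metis card.infinite)
  thus ?thesis using True by simp
next
  case False
  have 1: "card (quartic_roots (Quartic 0 b c d e)) = 1 + card {s. poly [:e, d, c, b:] s = 0}"
    using card_quartic_roots_poly[of "Quartic 0 b c d e" 0 b c d e] False by simp
  show ?thesis
  proof (cases "b = 0")
    case True
    have "degree [:e, d, c, b:] \<le> 2" using True by simp
    thus ?thesis using 1 card_poly_roots_bound[OF False] True by simp
  next
    case b: False
    thus ?thesis using 1 card_roots_eq_degree_iff[OF False] by (simp add: eval_nat_numeral)
  qed
qed

text \<open>Multiplying \<open>b x\<^sup>3 + c x\<^sup>2 + d x + e\<close> by \<open>b\<^sup>2\<close> gives a monic cubic in \<open>b x\<close>, with the same quadratic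
  residue behaviour.\<close>

lemma has_distinct_roots_lead_zero:
  "has_distinct_roots (Quartic 0 b c d e) \<longleftrightarrow> b \<noteq> 0 \<and> separable_cubic c (b * d) (b\<^sup>2 * e)"
proof (cases "b = 0")
  case False
  define b' c' d' e' where "b' = to_ac b" and "c' = to_ac c" and "d' = to_ac d" and "e' = to_ac e"
  have b': "b' \<noteq> 0" using False by (simp add: b'_def)
  have 1: "b'\<^sup>2 * poly [:e', d', c', b':] z = cubic c' (b' * d') (b'\<^sup>2 * e') (b' * z)"
    and 2: "b' * poly (pderiv [:e', d', c', b':]) z = cubic' c' (b' * d') (b' * z)" for z
    by (simp_all add: cubic_def cubic'_def pderiv_pCons algebra_simps power2_eq_square power3_eq_cube)
  have "poly [:e', d', c', b':] z = 0 \<longleftrightarrow> cubic c' (b' * d') (b'\<^sup>2 * e') (b' * z) = 0"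
    "poly (pderiv [:e', d', c', b':]) z = 0 \<longleftrightarrow> cubic' c' (b' * d') (b' * z) = 0" for z
    unfolding 1[symmetric] 2[symmetric] using b' by auto
  moreover have "(\<forall>z. P (b' * z)) \<longleftrightarrow> (\<forall>z. P z)" for P
  proof
    assume "\<forall>z. P (b' * z)"
    hence "P (b' * (z / b'))" for z by blast
    thus "\<forall>z. P z" using b' by simp
  qed auto
  ultimately have "(\<forall>z. \<not> (poly [:e', d', c', b':] z = 0 \<and> poly (pderiv [:e', d', c', b':]) z = 0)) \<longleftrightarrow>
      (\<forall>z. \<not> (cubic c' (b' * d') (b'\<^sup>2 * e') z = 0 \<and> cubic' c' (b' * d') z = 0))" by simp
  thus ?thesis using False b' distinct_roots_lead_zero[of b' c' d' e']
    unfolding has_distinct_roots_def separable_cubic_def b'_def c'_def d'_def e'_def by simp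
qed (simp add: has_distinct_roots_def distinct_roots_lead_zero)

section \<open>Quartics with a marked root\<close>

text \<open>The statement is formulated for an arbitrary condition \<open>P\<close> on the numbers of roots and of nonzero
  square values; the additional root is the one at infinity. The factor \<open>q - 1\<close> accounts for the
  coefficient of \<open>x\<^sup>3 y\<close>.\<close>

lemma card_lead_zero:
  "card {f :: 'a::{field,finite} quartic. has_distinct_roots f \<and> P (card (quartic_roots f)) (card (quartic_squares f)) \<and> lead f = 0}
   = (CARD('a) - 1) * card {(a, b, c). separable_cubic a b c \<and>
        P (card {x::'a. cubic a b c x = 0} + 1) (card {x. nz_square (cubic a b c x)})}"
  (is "card ?L = _ * card ?R")
proof -
  define F :: "'a \<times> 'a \<times> 'a \<times> 'a \<Rightarrow> 'a quartic" where "F = (\<lambda>(u, a, b, c). Quartic 0 u a (b / u) (c / u\<^sup>2))"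
  define D :: "('a \<times> 'a \<times> 'a \<times> 'a) set" where "D = (UNIV - {0}) \<times> UNIV"
  have inv1: "card (quartic_roots (F (u, a, b, c))) = card {x. cubic a b c x = 0} + 1"
    and inv2: "card (quartic_squares (F (u, a, b, c))) = card {x. nz_square (cubic a b c x)}"
    and inv3: "has_distinct_roots (F (u, a, b, c)) = separable_cubic a b c"
    if u: "u \<noteq> 0" for u a b c
  proof -
    have ev: "u\<^sup>2 * quartic_eval (F (u, a, b, c)) (s, 1) = cubic a b c (u * s)" for s
      using u by (simp add: F_def cubic_def algebra_simps power2_eq_square power3_eq_cube)
    have b: "bij_betw (\<lambda>s. u * s) {s. R (u * s)} {x. R x}" for R
      by (rule bij_betwI[where g = "\<lambda>x. x / u"]) (use u in auto)
    have "quartic_eval (F (u, a, b, c)) (s, 1) = 0 \<longleftrightarrow> cubic a b c (u * s) = 0" for s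
      unfolding ev[symmetric] using u by simp
    hence 1: "card {s. quartic_eval (F (u, a, b, c)) (s, 1) = 0} = card {x. cubic a b c x = 0}"
      using bij_betw_same_card[OF b[of "\<lambda>x. cubic a b c x = 0"]] by simp
    have "nz_square (quartic_eval (F (u, a, b, c)) (s, 1)) \<longleftrightarrow> nz_square (cubic a b c (u * s))" for s
      unfolding ev[symmetric] nz_square_mult_square[OF u] ..
    hence 2: "card {s. nz_square (quartic_eval (F (u, a, b, c)) (s, 1))} = card {x. nz_square (cubic a b c x)}"
      using bij_betw_same_card[OF b[of "\<lambda>x. nz_square (cubic a b c x)"]] by simp
    have l: "lead (F (u, a, b, c)) = 0" "\<not> nz_square (0::'a)" by (simp_all add: F_def nz_square_def)
    show "card (quartic_roots (F (u, a, b, c))) = card {x. cubic a b c x = 0} + 1"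
      "card (quartic_squares (F (u, a, b, c))) = card {x. nz_square (cubic a b c x)}"
      unfolding card_quartic_sets 1 2 l(1) using l(2) by simp_all
    show "has_distinct_roots (F (u, a, b, c)) = separable_cubic a b c"
      using u by (simp add: F_def has_distinct_roots_lead_zero)
  qed
  have "bij_betw F ((UNIV - {0}) \<times> ?R) ?L"
    unfolding bij_betw_def
  proof
    show "inj_on F ((UNIV - {0}) \<times> ?R)" by (auto simp: inj_on_def F_def)
    show "F ` ((UNIV - {0}) \<times> ?R) = ?L"
    proof (intro equalityI subsetI)
      fix f assume "f \<in> F ` ((UNIV - {0}) \<times> ?R)"
      then obtain u a b c where f: "f = F (u, a, b, c)" "u \<noteq> 0" "(a, b, c) \<in> ?R" by auto
      have "lead f = 0" by (simp add: f(1) F_def)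
      thus "f \<in> ?L" using f(3) unfolding f(1) by (simp add: inv1 inv2 inv3 f(2))
    next
      fix f assume f: "f \<in> ?L"
      obtain b c d e where q: "f = Quartic 0 b c d e" using f by (cases f) auto
      have b: "b \<noteq> 0" using f by (simp add: q has_distinct_roots_lead_zero)
      have F: "f = F (b, c, b * d, b\<^sup>2 * e)" using b by (simp add: q F_def)
      have "(c, b * d, b\<^sup>2 * e) \<in> ?R" using f unfolding F by (simp add: inv1 inv2 inv3 b)
      thus "f \<in> F ` ((UNIV - {0}) \<times> ?R)" using F b by blast
    qed
  qed
  hence "card ((UNIV - {0::'a}) \<times> ?R) = card ?L" by (rule bij_betw_same_card)
  thus ?thesis by (simp add: card_cartesian_product card_Diff_subset)
qed

text \<open>Completing the square loses \<open>a\<^sub>1\<close> and \<open>a\<^sub>3\<close>, which are arbitrary.\<close>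

lemma card_weierstrass:
  assumes two: "(2::'a::{field,finite}) \<noteq> 0"
  shows "card {E :: 'a weierstrass. elliptic E \<and> P (card {x. sq_cubic E x = 0}) (card {x. nz_square (sq_cubic E x)})}
   = (CARD('a))\<^sup>2 * card {(a, b, c). separable_cubic a b c \<and>
        P (card {x::'a. cubic a b c x = 0}) (card {x. nz_square (cubic a b c x)})}"
  (is "card ?L = _ * card ?R")
proof -
  define G :: "'a weierstrass \<Rightarrow> ('a \<times> 'a) \<times> 'a \<times> 'a \<times> 'a" where
    "G E = ((a1 E, a3 E), sq_coeff2 E, sq_coeff1 E, sq_coeff0 E)" for E
  have "bij_betw G ?L (UNIV \<times> ?R)"
    unfolding bij_betw_def
  proof
    show "inj_on G ?L"
    proof (rule inj_onI)
      fix E E' assume "G E = G E'"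
      thus "E = E'" by (cases E; cases E') (auto simp: G_def sq_coeff2_def sq_coeff1_def sq_coeff0_def)
    qed
    show "G ` ?L = UNIV \<times> ?R"
    proof (intro equalityI subsetI)
      fix z :: "('a \<times> 'a) \<times> 'a \<times> 'a \<times> 'a" assume z: "z \<in> UNIV \<times> ?R"
      obtain s t a b c where zz: "z = ((s, t), a, b, c)" by (metis surj_pair)
      define E where "E = Weierstrass s (a - s\<^sup>2 / 4) t (b - s * t / 2) (c - t\<^sup>2 / 4)"
      have "G E = z" by (simp add: G_def E_def zz sq_coeff2_def sq_coeff1_def sq_coeff0_def)
      moreover have "E \<in> ?L" using z zz calculation by (auto simp: elliptic_iff_separable[OF two] G_def)
      ultimately show "z \<in> G ` ?L" by blast
    qed (auto simp: G_def elliptic_iff_separable[OF two])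
  qed
  hence "card ?L = card ((UNIV :: ('a \<times> 'a) set) \<times> ?R)" by (rule bij_betw_same_card)
  thus ?thesis by (simp add: card_cartesian_product power2_eq_square)
qed


section \<open>Monic quartics and curves through the origin\<close>

text \<open>Let \<open>E\<close> be a Weierstrass curve through the origin. On the line \<open>y = m x\<close> the equation of \<open>E\<close> becomes
  \<open>- x (x\<^sup>2 + B(m) x + C(m)) = 0\<close>, and \<open>slope_quartic E\<close> is the discriminant \<open>B\<^sup>2 - 4 C\<close> as a (homogenized)
  polynomial in the slope \<open>m\<close>. The curve \<open>w\<^sup>2 = B(m)\<^sup>2 - 4 C(m)\<close> is birational to \<open>E\<close>.\<close>

definition slope_quartic :: "'a::field weierstrass \<Rightarrow> 'a quartic" where
  "slope_quartic E = Quartic 1 (2 * a1 E) (a1 E ^ 2 - 2 * a2 E) (4 * a3 E - 2 * a1 E * a2 E) (a2 E ^ 2 - 4 * a4 E)"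

definition slope_B :: "'a::field weierstrass \<Rightarrow> 'a \<Rightarrow> 'a" where
  "slope_B E m = a2 E - m\<^sup>2 - a1 E * m"

definition slope_C :: "'a::field weierstrass \<Rightarrow> 'a \<Rightarrow> 'a" where
  "slope_C E m = a4 E - a3 E * m"

text \<open>The quadratic equation for the two further intersections with the line of slope \<open>m\<close>.\<close>

definition slope_F :: "'a::field weierstrass \<Rightarrow> 'a \<Rightarrow> 'a \<Rightarrow> 'a" where
  "slope_F E m x = x\<^sup>2 + slope_B E m * x + slope_C E m"

lemma slope_quartic_eval: "quartic_eval (slope_quartic E) (m, 1) = (slope_B E m)\<^sup>2 - 4 * slope_C E m"
  by (simp add: slope_quartic_def slope_B_def slope_C_def algebra_simps eval_nat_numeral)

lemma w_poly_line:
  assumes "a6 E = 0"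
  shows "w_poly E x (m * x) = - x * slope_F E m x"
  using assms by (simp add: w_poly_def slope_F_def slope_B_def slope_C_def algebra_simps eval_nat_numeral)

lemma w_poly_dy_line: "w_poly_dy E x (m * x) = x * (2 * m + a1 E) + a3 E"
  by (simp add: w_poly_dy_def algebra_simps)

text \<open>The derivative of \<open>w_poly_line\<close> by \<open>x\<close>, for constant \<open>m\<close>.\<close>

lemma w_poly_dx_line:
  "w_poly_dx E x (m * x) + m * w_poly_dy E x (m * x) = - slope_F E m x - x * (2 * x + slope_B E m)"
  by (simp add: w_poly_dx_def w_poly_dy_def slope_F_def slope_B_def slope_C_def algebra_simps eval_nat_numeral)

text \<open>The right hand side says that the discriminant \<open>B\<^sup>2 - 4 C\<close> and its derivative have a common zero \<open>m\<close>.
  A singular point \<open>(x, m x)\<close> corresponds to such an \<open>m\<close> with \<open>x = - B(m) / 2\<close>. If the origin is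
  singular then \<open>C = 0\<close>, and one has to take \<open>m\<close> with \<open>B(m) = 0\<close>.\<close>

lemma singular_iff_double_slope:
  fixes E :: "'b::alg_closed_field weierstrass"
  assumes two: "(2::'b) \<noteq> 0" and a6: "a6 E = 0"
  shows "(\<exists>x y. w_poly E x y = 0 \<and> w_poly_dx E x y = 0 \<and> w_poly_dy E x y = 0) \<longleftrightarrow>
    (\<exists>m. (slope_B E m)\<^sup>2 - 4 * slope_C E m = 0 \<and>
         2 * slope_B E m * (- 2 * m - a1 E) + 4 * a3 E = 0)"
    (is "?L \<longleftrightarrow> ?R")
proof
  assume ?L
  then obtain x y where xy: "w_poly E x y = 0" "w_poly_dx E x y = 0" "w_poly_dy E x y = 0" by blast
  show ?R
  proof (cases "x = 0")
    case False
    define m where "m = y / x"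
    have y: "y = m * x" using False by (simp add: m_def)
    have F: "slope_F E m x = 0" using xy(1) False unfolding y w_poly_line[OF a6] by simp
    have B: "2 * x + slope_B E m = 0"
      using w_poly_dx_line[of E x m] xy False F unfolding y by simp
    hence B': "slope_B E m = - 2 * x" by (simp add: add_eq_0_iff)
    have "slope_C E m = x\<^sup>2" using F unfolding slope_F_def B' by (simp add: algebra_simps power2_eq_square add_eq_0_iff)
    moreover have "a3 E = - x * (2 * m + a1 E)" using xy(3) unfolding y w_poly_dy_line by (simp only: add_eq_0_iff mult_minus_left)
    ultimately show ?thesis
      by (intro exI[of _ m]) (simp only: B', simp add: algebra_simps power2_eq_square)
  next
    case True
    have a3: "a3 E = - 2 * y" using xy(3) True by (simp add: w_poly_dy_def add_eq_0_iff)
    have "y = 0" using xy(1) a6 True by (simp add: w_poly_def a3 power2_eq_square)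
    hence z: "a3 E = 0" "a4 E = 0" using a3 xy(2) True by (simp_all add: w_poly_dx_def)
    obtain m where "poly [:a2 E, - a1 E, - 1:] m = 0"
      using alg_closed_imp_poly_has_root[of "[:a2 E, - a1 E, - 1:]"] by auto
    hence "slope_B E m = 0" by (simp add: slope_B_def algebra_simps power2_eq_square)
    thus ?thesis using z by (intro exI[of _ m]) (simp add: slope_C_def)
  qed
next
  assume ?R
  then obtain m where m: "(slope_B E m)\<^sup>2 - 4 * slope_C E m = 0" "2 * slope_B E m * (- 2 * m - a1 E) + 4 * a3 E = 0" by blast
  define x where "x = - slope_B E m / 2"
  have B: "slope_B E m = - 2 * x" using two by (simp add: x_def)
  note four = four_nonzero[OF two]
  have "4 * (slope_C E m - x\<^sup>2) = - ((slope_B E m)\<^sup>2 - 4 * slope_C E m)"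
    unfolding B by (simp add: algebra_simps power2_eq_square)
  hence "4 * (slope_C E m - x\<^sup>2) = 0" unfolding m(1) by simp
  hence C: "slope_C E m = x\<^sup>2" using four by (metis mult_eq_0_iff eq_iff_diff_eq_0)
  have "4 * (x * (2 * m + a1 E) + a3 E) = 0" using m(2) unfolding B by (simp add: algebra_simps)
  hence dy: "w_poly_dy E x (m * x) = 0" using four unfolding w_poly_dy_line by (metis mult_eq_0_iff)
  have F: "slope_F E m x = 0" by (simp add: slope_F_def B C power2_eq_square)
  have "w_poly E x (m * x) = 0" unfolding w_poly_line[OF a6] F by simp
  moreover have "w_poly_dx E x (m * x) = 0" using w_poly_dx_line[of E x m] dy F by (simp add: B)
  ultimately show ?L using dy by blast
qed

lemma has_distinct_roots_slope_quartic:
  fixes E :: "'a::field weierstrass"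
  assumes two: "(2::'a) \<noteq> 0" and a6: "a6 E = 0"
  shows "has_distinct_roots (slope_quartic E) \<longleftrightarrow> elliptic E"
proof -
  define F where "F = map_weierstrass to_ac E"
  have two': "(2::'a alg_closure) \<noteq> 0" using two by (metis to_ac_eq_0_iff to_ac_numeral)
  have a6': "a6 F = 0" using a6 by (simp add: F_def weierstrass.map_sel)
  have map: "map_quartic to_ac (slope_quartic E) = slope_quartic F"
    by (simp add: slope_quartic_def F_def weierstrass.map_sel)
  have 1: "poly [:a2 F ^ 2 - 4 * a4 F, 4 * a3 F - 2 * a1 F * a2 F, a1 F ^ 2 - 2 * a2 F, 2 * a1 F, 1:] m
     = (slope_B F m)\<^sup>2 - 4 * slope_C F m" for m
    by (simp add: slope_B_def slope_C_def algebra_simps eval_nat_numeral)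
  have 2: "poly (pderiv [:a2 F ^ 2 - 4 * a4 F, 4 * a3 F - 2 * a1 F * a2 F, a1 F ^ 2 - 2 * a2 F, 2 * a1 F, 1:]) m
     = 2 * slope_B F m * (- 2 * m - a1 F) + 4 * a3 F" for m
    by (simp add: slope_B_def slope_C_def pderiv_pCons algebra_simps eval_nat_numeral)
  have "has_distinct_roots (slope_quartic E) \<longleftrightarrow> \<not> (\<exists>m. (slope_B F m)\<^sup>2 - 4 * slope_C F m = 0 \<and>
         2 * slope_B F m * (- 2 * m - a1 F) + 4 * a3 F = 0)"
    unfolding has_distinct_roots_def map unfolding slope_quartic_def distinct_roots_monic 1 2 by blast
  also have "\<dots> \<longleftrightarrow> elliptic E"
    unfolding elliptic_def Let_def F_def[symmetric] singular_iff_double_slope[OF two' a6'] ..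
  finally show ?thesis .
qed

text \<open>The quartic is monic, so its curve has two points at infinity. The points with \<open>x \<noteq> 0\<close> on \<open>E\<close>
  correspond to pairs \<open>(m, x)\<close> with \<open>x \<noteq> 0\<close>. The pairs with \<open>x = 0\<close> belong to the tangent at the
  origin, and there is one less of them than of points of \<open>E\<close> with \<open>x = 0\<close>.\<close>

lemma card_points_slope_quartic:
  fixes E :: "'a::{field,finite} weierstrass"
  assumes odd: "odd (CARD('a))" and a6: "a6 E = 0" and ell: "elliptic E"
  shows "card (quartic_roots (slope_quartic E)) + 2 * card (quartic_squares (slope_quartic E)) = card (affine_points E) + 1"
proof -
  note two = odd_card_two_nonzero[OF odd]
  define V where "V = {(m, x). slope_F E m x = 0}"
  define X1 where "X1 = {(m, x). slope_F E m x = 0 \<and> x \<noteq> 0}"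
  define X0 where "X0 = {m. slope_C E m = 0}"
  define Y1 where "Y1 = {(x, y). w_poly E x y = 0 \<and> x \<noteq> 0}"
  define Y0 where "Y0 = {y. w_poly E 0 y = 0}"
  have lead: "lead (slope_quartic E) = 1" by (simp add: slope_quartic_def)
  have sq1: "nz_square (1::'a)" by (auto simp: nz_square_def intro: exI[of _ 1])
  let ?D = "\<lambda>m. quartic_eval (slope_quartic E) (m, 1)"
  have "card {(m, w). w\<^sup>2 = ?D m} = card {m. ?D m = 0} + 2 * card {m. nz_square (?D m)}"
    by (rule card_double_cover[OF odd])
  hence 1: "card (quartic_roots (slope_quartic E)) + 2 * card (quartic_squares (slope_quartic E)) = 2 + card {(m, w). w\<^sup>2 = ?D m}"
    unfolding card_quartic_sets lead using sq1 by simp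
  have sqr: "(2 * x + slope_B E m)\<^sup>2 - ?D m = 4 * slope_F E m x" for m x
    unfolding slope_quartic_eval slope_F_def by (simp add: algebra_simps power2_eq_square)
  have iff: "(2 * x + slope_B E m)\<^sup>2 = ?D m \<longleftrightarrow> slope_F E m x = 0" for m x
    using sqr[of x m] four_nonzero[OF two] by (metis eq_iff_diff_eq_0 mult_eq_0_iff)
  have half: "2 * ((w - slope_B E m) / 2) + slope_B E m = w" for w m
  proof -
    have "2 * ((w - slope_B E m) / 2) = w - slope_B E m" using two by (metis nonzero_mult_div_cancel_left times_divide_eq_right)
    thus ?thesis by (simp only: diff_add_cancel)
  qed
  have "bij_betw (\<lambda>(m, x). (m, 2 * x + slope_B E m)) V {(m, w). w\<^sup>2 = ?D m}"
  proof (rule bij_betwI[where g = "\<lambda>(m, w). (m, (w - slope_B E m) / 2)"])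
    show "(\<lambda>(m, x). (m, 2 * x + slope_B E m)) \<in> V \<rightarrow> {(m, w). w\<^sup>2 = ?D m}"
      using iff by (auto simp: V_def)
    show "(\<lambda>(m, w). (m, (w - slope_B E m) / 2)) \<in> {(m, w). w\<^sup>2 = ?D m} \<rightarrow> V"
    proof clarify
      fix m w assume "w\<^sup>2 = ?D m"
      thus "(m, (w - slope_B E m) / 2) \<in> V" using iff[of "(w - slope_B E m) / 2" m] unfolding half V_def by simp
    qed
  qed (simp_all only: split_beta fst_conv snd_conv half prod.collapse, use two in simp)
  hence 2: "card V = card {(m, w). w\<^sup>2 = ?D m}" by (rule bij_betw_same_card)
  have V: "V = X1 \<union> (\<lambda>m. (m, 0)) ` X0" by (auto simp: V_def X1_def X0_def slope_F_def)
  have "card V = card X1 + card ((\<lambda>m. (m, 0::'a)) ` X0)" unfolding V by (rule card_Un_disjoint) (auto simp: X1_def)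
  also have "card ((\<lambda>m. (m, 0::'a)) ` X0) = card X0" by (rule card_image) (auto simp: inj_on_def)
  finally have 3: "card V = card X1 + card X0" .
  have A: "affine_points E = Y1 \<union> (\<lambda>y. (0, y)) ` Y0" by (auto simp: affine_points_def Y1_def Y0_def)
  have "card (affine_points E) = card Y1 + card ((\<lambda>y. (0::'a, y)) ` Y0)" unfolding A by (rule card_Un_disjoint) (auto simp: Y1_def)
  also have "card ((\<lambda>y. (0::'a, y)) ` Y0) = card Y0" by (rule card_image) (auto simp: inj_on_def)
  finally have 4: "card (affine_points E) = card Y1 + card Y0" .
  have "bij_betw (\<lambda>(m, x). (x, m * x)) X1 Y1"
  proof (rule bij_betwI[where g = "\<lambda>(x, y). (y / x, x)"])
    show "(\<lambda>(m, x). (x, m * x)) \<in> X1 \<rightarrow> Y1" by (auto simp: X1_def Y1_def w_poly_line[OF a6])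
    show "(\<lambda>(x, y). (y / x, x)) \<in> Y1 \<rightarrow> X1"
    proof clarify
      fix x y assume "(x, y) \<in> Y1"
      hence "x \<noteq> 0" "w_poly E x ((y / x) * x) = 0" by (simp_all add: Y1_def)
      thus "(y / x, x) \<in> X1" unfolding w_poly_line[OF a6] by (simp add: X1_def)
    qed
  qed (auto simp: X1_def Y1_def)
  hence 5: "card X1 = card Y1" by (rule bij_betw_same_card)
  have w0: "w_poly E 0 y = y * (y + a3 E)" for y using a6 by (simp add: w_poly_def algebra_simps power2_eq_square)
  have 6: "card Y0 = card X0 + 1"
  proof (cases "a3 E = 0")
    case True
    have "a4 E \<noteq> 0"
    proof
      assume "a4 E = 0"
      hence "w_poly (map_weierstrass to_ac E) 0 0 = 0" "w_poly_dx (map_weierstrass to_ac E) 0 0 = 0" "w_poly_dy (map_weierstrass to_ac E) 0 0 = 0"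
        using True a6 by (simp_all add: w_poly_def w_poly_dx_def w_poly_dy_def weierstrass.map_sel)
      thus False using ell unfolding elliptic_def Let_def by blast
    qed
    hence "X0 = {}" using True by (simp add: X0_def slope_C_def)
    moreover have "Y0 = {0}" using True by (auto simp: Y0_def w0)
    ultimately show ?thesis by simp
  next
    case False
    have "a4 E - a3 E * m = 0 \<longleftrightarrow> m = a4 E / a3 E" for m
      using False by (auto simp: eq_divide_eq mult.commute)
    hence "X0 = {a4 E / a3 E}" by (simp add: X0_def slope_C_def)
    moreover have "Y0 = {0, - a3 E}" by (auto simp: Y0_def w0 add_eq_0_iff2)
    ultimately show ?thesis using False by simp
  qed
  show ?thesis using 1 2 3 4 5 6 by linarith
qed

text \<open>The coefficients of \<open>slope_quartic E\<close> can be solved successively for \<open>a\<^sub>1\<close>, \<open>a\<^sub>2\<close>, \<open>a\<^sub>3\<close>, \<open>a\<^sub>4\<close>.\<close>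

lemma card_monic:
  assumes odd: "odd (CARD('a::{field,finite}))"
  shows "card {f :: 'a quartic. has_distinct_roots f \<and> card (quartic_roots f) + 2 * card (quartic_squares f) = N \<and> lead f = 1}
    = card {E :: 'a weierstrass. elliptic E \<and> card (affine_points E) + 1 = N \<and> a6 E = 0}" (is "card ?L = card ?R")
proof -
  note two = odd_card_two_nonzero[OF odd]
  note four = four_nonzero[OF two]
  have "bij_betw slope_quartic ?R ?L"
    unfolding bij_betw_def
  proof
    show "inj_on slope_quartic ?R"
    proof (rule inj_onI)
      fix E E' :: "'a weierstrass" assume "E \<in> ?R" "E' \<in> ?R" "slope_quartic E = slope_quartic E'"
      thus "E = E'" using two four by (cases E; cases E') (auto simp: slope_quartic_def)
    qed
    show "slope_quartic ` ?R = ?L"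
    proof (intro equalityI subsetI)
      fix f assume f: "f \<in> ?L"
      obtain b c d e where q: "f = Quartic 1 b c d e" using f by (cases f) auto
      define s t where "s = b / 2" and "t = (s\<^sup>2 - c) / 2"
      define u v where "u = (d + 2 * s * t) / 4" and "v = (t\<^sup>2 - e) / 4"
      define E where "E = Weierstrass s t u v 0"
      have b: "b = 2 * s" using two by (simp add: s_def)
      have "2 * t = s\<^sup>2 - c" using two by (simp add: t_def)
      hence c: "c = s\<^sup>2 - 2 * t" by simp
      have "4 * u = d + 2 * s * t" "4 * v = t\<^sup>2 - e" using four by (simp_all add: u_def v_def)
      hence "d = 4 * u - 2 * s * t" "e = t\<^sup>2 - 4 * v" by simp_all
      hence E: "slope_quartic E = f" by (simp add: slope_quartic_def E_def q b c)
      have a6: "a6 E = 0" by (simp add: E_def)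
      have ell: "elliptic E" using f has_distinct_roots_slope_quartic[OF two a6] by (simp add: E)
      show "f \<in> slope_quartic ` ?R" using card_points_slope_quartic[OF odd a6 ell] f a6 ell
        by (intro image_eqI[of _ _ E]) (simp_all add: E)
    qed (auto simp: has_distinct_roots_slope_quartic[OF two] card_points_slope_quartic[OF odd] slope_quartic_def[THEN arg_cong, of lead])
  qed
  thus ?thesis by (simp add: bij_betw_same_card)
qed

lemma card_lead_square:
  fixes S :: "'a::{field,finite} quartic set"
  assumes odd: "odd (CARD('a))"
    and closed: "\<And>f u. u \<noteq> 0 \<Longrightarrow> f \<in> S \<Longrightarrow> map_quartic ((*) (u\<^sup>2)) f \<in> S"
  shows "2 * card {f \<in> S. nz_square (lead f)} = (CARD('a) - 1) * card {f \<in> S. lead f = 1}"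
proof -
  note [simp] = finite_quartics
  have lead_mult: "lead (map_quartic ((*) k) f) = k * lead f" for k and f :: "'a quartic" by (cases f) simp
  have mm: "map_quartic ((*) k) (map_quartic ((*) l) f) = map_quartic ((*) (k * l)) f" for k l and f :: "'a quartic"
    by (cases f) (simp add: mult.assoc)
  have m1: "map_quartic ((*) 1) f = f" for f :: "'a quartic" by (cases f) simp
  have fib: "card {f \<in> S. lead f = u\<^sup>2} = card {f \<in> S. lead f = 1}" if u: "u \<noteq> 0" for u
  proof -
    have "bij_betw (map_quartic ((*) ((1 / u)\<^sup>2))) {f \<in> S. lead f = u\<^sup>2} {f \<in> S. lead f = 1}"
    proof (rule bij_betwI[where g = "map_quartic ((*) (u\<^sup>2))"])
      show "map_quartic ((*) ((1 / u)\<^sup>2)) \<in> {f \<in> S. lead f = u\<^sup>2} \<rightarrow> {f \<in> S. lead f = 1}"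
        using closed[of "1 / u"] u by (auto simp: lead_mult power_divide)
      show "map_quartic ((*) (u\<^sup>2)) \<in> {f \<in> S. lead f = 1} \<rightarrow> {f \<in> S. lead f = u\<^sup>2}"
        using closed[of u] u by (auto simp: lead_mult)
    qed (use u in \<open>simp_all add: mm m1 power_divide\<close>)
    thus ?thesis by (rule bij_betw_same_card)
  qed
  let ?S = "{f \<in> S. nz_square (lead f)}"
  have "2 * card ?S = (\<Sum>f\<in>?S. 2)" by simp
  also have "\<dots> = (\<Sum>f\<in>?S. card {u. u\<^sup>2 = lead f})"
    by (rule sum.cong) (auto simp: card_square_roots[OF odd], auto simp: nz_square_def)
  also have "\<dots> = card (SIGMA f:?S. {u. u\<^sup>2 = lead f})" by simp
  also have "(SIGMA f:?S. {u. u\<^sup>2 = lead f}) = prod.swap ` (SIGMA u:UNIV - {0}. {f \<in> S. lead f = u\<^sup>2})"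
    by (auto simp: image_iff nz_square_def)
  also have "card \<dots> = card (SIGMA u:UNIV - {0}. {f \<in> S. lead f = u\<^sup>2})"
    by (rule card_image) simp
  also have "\<dots> = (\<Sum>u\<in>UNIV - {0}. card {f \<in> S. lead f = u\<^sup>2})" by simp
  also have "\<dots> = (\<Sum>u\<in>UNIV - {0::'a}. card {f \<in> S. lead f = 1})" by (rule sum.cong) (simp_all add: fib)
  also have "\<dots> = (CARD('a) - 1) * card {f \<in> S. lead f = 1}" by (simp add: card_Diff_subset)
  finally show ?thesis .
qed

text \<open>Translating a point to the origin is an isomorphism, and \<open>a\<^sub>6 = 0\<close> means that the origin lies on the
  curve.\<close>

lemma sum_affine_points:
  fixes S :: "'a::{field,finite} weierstrass set"
  assumes closed: "\<And>E E' \<phi>. E \<in> S \<Longrightarrow> ec_iso E E' \<phi> \<Longrightarrow> E' \<in> S"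
  shows "(\<Sum>E\<in>S. card (affine_points E)) = (CARD('a))\<^sup>2 * card {E \<in> S. a6 E = 0}"
proof -
  have fin: "finite A" for A :: "'a weierstrass set" using finite_weierstrass by (rule rev_finite_subset) simp
  have fib: "card {E \<in> S. (x, y) \<in> affine_points E} = card {E \<in> S. a6 E = 0}" for x y
  proof -
    define \<phi> \<psi> where "\<phi> = (1 :: 'a, x, 0 :: 'a, y)" and "\<psi> = (1 :: 'a, - x, 0 :: 'a, - y)"
    have u: "fst \<phi> \<noteq> 0" "fst \<psi> \<noteq> 0" by (simp_all add: \<phi>_def \<psi>_def)
    have inverse: "iso_inv \<phi> = \<psi>" "iso_inv \<psi> = \<phi>" by (simp_all add: \<phi>_def \<psi>_def iso_inv_def)
    have iso: "ec_iso E (transport \<phi> E) \<phi>" "ec_iso E (transport \<psi> E) \<psi>" for E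
      using u by (simp_all add: ec_iso_transport del: ec_iso.simps)
    have undo: "transport \<psi> (transport \<phi> E) = E" "transport \<phi> (transport \<psi> E) = E" for E
      using ec_iso_inv[OF iso(1)[of E]] ec_iso_inv[OF iso(2)[of E]] unfolding inverse ec_iso_transport by simp_all
    have a6: "a6 (transport \<phi> E) = - w_poly E x y" for E
      by (simp add: transport_def \<phi>_def w_poly_def algebra_simps eval_nat_numeral)
    have "bij_betw (transport \<phi>) {E \<in> S. (x, y) \<in> affine_points E} {E \<in> S. a6 E = 0}"
    proof (rule bij_betwI[where g = "transport \<psi>"])
      show "transport \<phi> \<in> {E \<in> S. (x, y) \<in> affine_points E} \<rightarrow> {E \<in> S. a6 E = 0}"
        using closed[OF _ iso(1)] by (auto simp: a6 affine_points_def)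
      show "transport \<psi> \<in> {E \<in> S. a6 E = 0} \<rightarrow> {E \<in> S. (x, y) \<in> affine_points E}"
      proof
        fix E assume E: "E \<in> {E \<in> S. a6 E = 0}"
        hence "w_poly (transport \<psi> E) x y = 0" using a6[of "transport \<psi> E"] by (simp add: undo)
        thus "transport \<psi> E \<in> {E \<in> S. (x, y) \<in> affine_points E}" using closed[OF _ iso(2)] E by (simp add: affine_points_def)
      qed
    qed (simp_all add: undo)
    thus ?thesis by (rule bij_betw_same_card)
  qed
  have "(\<Sum>E\<in>S. card (affine_points E)) = card (SIGMA E:S. affine_points E)" using fin by simp
  also have "(SIGMA E:S. affine_points E) = prod.swap ` (SIGMA z:UNIV. {E \<in> S. z \<in> affine_points E})"
    by (auto simp: image_iff)
  also have "card \<dots> = card (SIGMA z:UNIV. {E \<in> S. z \<in> affine_points E})" by (rule card_image) simp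
  also have "\<dots> = (\<Sum>z\<in>UNIV. card {E \<in> S. z \<in> affine_points E})" using fin by simp
  also have "\<dots> = (\<Sum>z\<in>(UNIV :: ('a \<times> 'a) set). card {E \<in> S. a6 E = 0})"
    by (rule sum.cong) (auto simp: fib)
  also have "\<dots> = (CARD('a))\<^sup>2 * card {E \<in> S. a6 E = 0}" by (simp add: power2_eq_square)
  finally show ?thesis .
qed


section \<open>Counting by number of points\<close>

text \<open>The number of points of \<open>w\<^sup>2 = f(x, y)\<close>: one above each root of \<open>f\<close> and two above each point where
  \<open>f\<close> is a nonzero square.\<close>

definition quartic_points :: "'a::{field,finite} quartic \<Rightarrow> nat" where
  "quartic_points f = card (quartic_roots f) + 2 * card (quartic_squares f)"

text \<open>Quartics with distinct roots, and smooth Weierstrass equations, with a given number of points.\<close>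

definition quartics_with :: "nat \<Rightarrow> 'a::{field,finite} quartic set" where
  "quartics_with N = {f. has_distinct_roots f \<and> quartic_points f = N}"

definition curves_with :: "nat \<Rightarrow> 'a::{field,finite} weierstrass set" where
  "curves_with N = {E. elliptic E \<and> card (affine_points E) + 1 = N}"

lemma curves_with_eq:
  assumes "odd (CARD('a::{field,finite}))"
  shows "curves_with N = {E :: 'a weierstrass. elliptic E \<and>
    card {x. sq_cubic E x = 0} + 1 + 2 * card {x. nz_square (sq_cubic E x)} = N}"
  unfolding curves_with_def card_affine_points[OF assms] by (simp add: add_ac)

lemma curves_with_iso:
  assumes "E \<in> curves_with N" "ec_iso E E' \<phi>"
  shows "E' \<in> curves_with N"
  using assms elliptic_iso[OF assms(2)] card_points_iso[OF assms(2)] by (simp add: curves_with_def)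

lemma sum_card_roots:
  fixes S :: "'a::{field,finite} quartic set"
  assumes "\<And>s f. move s f \<in> S \<longleftrightarrow> f \<in> S"
  shows "(\<Sum>f\<in>S. card (quartic_roots f)) = (CARD('a) + 1) * card {f \<in> S. lead f = 0}"
  unfolding quartic_sets by (rule double_count_points[where R = "\<lambda>x. x = 0", OF assms]) simp

lemma sum_card_squares:
  fixes S :: "'a::{field,finite} quartic set"
  assumes "\<And>s f. move s f \<in> S \<longleftrightarrow> f \<in> S"
  shows "(\<Sum>f\<in>S. card (quartic_squares f)) = (CARD('a) + 1) * card {f \<in> S. nz_square (lead f)}"
  unfolding quartic_sets by (rule double_count_points[where R = nz_square, OF assms nz_square_mult_power4])

text \<open>Both sides are \<open>q\<^sup>2\<close> times the number of quartics with a marked rational root; the marked root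
  corresponds to the point at infinity of the Weierstrass curve.\<close>

lemma card_quartics_with_roots:
  assumes odd: "odd (CARD('a::{field,finite}))"
  shows "(i + 1) * card {f \<in> quartics_with N :: 'a quartic set. card (quartic_roots f) = i + 1} * (CARD('a))\<^sup>2
    = (CARD('a) + 1) * (CARD('a) - 1) * card {E \<in> curves_with N :: 'a weierstrass set. card (two_points E) = i}"
proof -
  note two = odd_card_two_nonzero[OF odd]
  let ?S = "{f \<in> quartics_with N :: 'a quartic set. card (quartic_roots f) = i + 1}"
  let ?P = "\<lambda>r s. r = i + 1 \<and> r + 2 * s = N"
  have S: "?S = {f. has_distinct_roots f \<and> ?P (card (quartic_roots f)) (card (quartic_squares f))}"
    by (auto simp: quartics_with_def quartic_points_def)
  have closed: "move s f \<in> ?S \<longleftrightarrow> f \<in> ?S" for s f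
    unfolding S by (simp add: quartic_invariants_move)
  have "(i + 1) * card ?S = (\<Sum>f\<in>?S. card (quartic_roots f))" by simp
  also have "\<dots> = (CARD('a) + 1) * card {f \<in> ?S. lead f = 0}"
    by (rule sum_card_roots[OF closed])
  also have "{f \<in> ?S. lead f = 0} = {f. has_distinct_roots f \<and> ?P (card (quartic_roots f)) (card (quartic_squares f)) \<and> lead f = 0}"
    unfolding S by auto
  also have "card \<dots> = (CARD('a) - 1) * card {(a, b, c). separable_cubic a b c \<and>
        ?P (card {x::'a. cubic a b c x = 0} + 1) (card {x. nz_square (cubic a b c x)})}"
    by (rule card_lead_zero)
  finally have 1: "(i + 1) * card ?S = (CARD('a) + 1) * ((CARD('a) - 1) * card {(a, b, c). separable_cubic a b c \<and>
        ?P (card {x::'a. cubic a b c x = 0} + 1) (card {x. nz_square (cubic a b c x)})})" .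
  have "{E \<in> curves_with N :: 'a weierstrass set. card (two_points E) = i} =
    {E :: 'a weierstrass. elliptic E \<and> ?P (card {x. sq_cubic E x = 0} + 1) (card {x. nz_square (sq_cubic E x)})}"
    unfolding curves_with_eq[OF odd] card_two_points[OF two] by auto
  hence 2: "card {E \<in> curves_with N :: 'a weierstrass set. card (two_points E) = i} = (CARD('a))\<^sup>2 *
    card {(a, b, c). separable_cubic a b c \<and>
        ?P (card {x::'a. cubic a b c x = 0} + 1) (card {x. nz_square (cubic a b c x)})}"
    using card_weierstrass[OF two, of "\<lambda>r s. ?P (r + 1) s"] by simp
  show ?thesis unfolding 1 2 by (simp only: mult_ac)
qed

text \<open>Both sides, multiplied by \<open>N\<close>, are \<open>q\<^sup>2\<close> times the number of quartics with a marked point on their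
  curve.\<close>

lemma card_quartics_with:
  assumes odd: "odd (CARD('a::{field,finite}))" and N: "N > 0"
  shows "card (quartics_with N :: 'a quartic set) * (CARD('a))\<^sup>2
    = (CARD('a) + 1) * (CARD('a) - 1) * card (curves_with N :: 'a weierstrass set)"
proof -
  note two = odd_card_two_nonzero[OF odd]
  let ?q = "CARD('a)"
  let ?S = "quartics_with N :: 'a quartic set"
  let ?W = "curves_with N :: 'a weierstrass set"
  let ?P = "\<lambda>r s. r + 2 * s = N"
  have S: "?S = {f. has_distinct_roots f \<and> ?P (card (quartic_roots f)) (card (quartic_squares f))}"
    by (auto simp: quartics_with_def quartic_points_def)
  have closed: "move s f \<in> ?S \<longleftrightarrow> f \<in> ?S" for s f
    unfolding S by (simp add: quartic_invariants_move)
  have closed': "map_quartic ((*) (u\<^sup>2)) f \<in> ?S" if "u \<noteq> 0" "f \<in> ?S" for u f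
    using that unfolding S by (simp add: has_distinct_roots_mult quartic_roots_mult quartic_squares_mult)
  have r: "(\<Sum>f\<in>?S. card (quartic_roots f)) = (?q + 1) * card {f \<in> ?S. lead f = 0}"
    by (rule sum_card_roots[OF closed])
  have s: "(\<Sum>f\<in>?S. card (quartic_squares f)) = (?q + 1) * card {f \<in> ?S. nz_square (lead f)}"
    by (rule sum_card_squares[OF closed])
  have "N * card ?S = (\<Sum>f\<in>?S. card (quartic_roots f) + 2 * card (quartic_squares f))"
    by (simp add: S)
  also have "\<dots> = (?q + 1) * (card {f \<in> ?S. lead f = 0} + 2 * card {f \<in> ?S. nz_square (lead f)})"
    by (simp only: sum.distrib sum_distrib_left[symmetric] r s) (simp only: algebra_simps)
  also have "2 * card {f \<in> ?S. nz_square (lead f)} = (?q - 1) * card {f \<in> ?S. lead f = 1}"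
    by (rule card_lead_square[OF odd closed'])
  finally have 1: "N * card ?S = (?q + 1) * (card {f \<in> ?S. lead f = 0} + (?q - 1) * card {f \<in> ?S. lead f = 1})" .
  have "{f \<in> ?S. lead f = 0} = {f. has_distinct_roots f \<and> ?P (card (quartic_roots f)) (card (quartic_squares f)) \<and> lead f = 0}"
    unfolding S by auto
  hence 2: "card {f \<in> ?S. lead f = 0} = (?q - 1) * card {(a, b, c). separable_cubic a b c \<and>
        ?P (card {x::'a. cubic a b c x = 0} + 1) (card {x. nz_square (cubic a b c x)})}"
    using card_lead_zero[of ?P] by simp
  have 3: "card ?W = ?q\<^sup>2 * card {(a, b, c). separable_cubic a b c \<and>
        ?P (card {x::'a. cubic a b c x = 0} + 1) (card {x. nz_square (cubic a b c x)})}"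
    unfolding curves_with_eq[OF odd] using card_weierstrass[OF two, of "\<lambda>r s. ?P (r + 1) s"] by simp
  have "{f \<in> ?S. lead f = 1} = {f. has_distinct_roots f \<and> ?P (card (quartic_roots f)) (card (quartic_squares f)) \<and> lead f = 1}"
    unfolding S by auto
  moreover have "{E \<in> ?W. a6 E = 0} = {E. elliptic E \<and> card (affine_points E) + 1 = N \<and> a6 E = 0}"
    unfolding curves_with_def by auto
  ultimately have "card {f \<in> ?S. lead f = 1} = card {E \<in> ?W. a6 E = 0}"
    using card_monic[OF odd, of N] by simp
  moreover have "(\<Sum>E\<in>?W. card (affine_points E)) = ?q\<^sup>2 * card {E \<in> ?W. a6 E = 0}"
    by (rule sum_affine_points[OF curves_with_iso])
  moreover have "(\<Sum>E\<in>?W. card (affine_points E)) = (\<Sum>E\<in>?W. N - 1)"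
    by (rule sum.cong) (auto simp: curves_with_def)
  ultimately have 4: "?q\<^sup>2 * card {f \<in> ?S. lead f = 1} = (N - 1) * card ?W" by (simp add: mult.commute)
  have "N * (card ?S * ?q\<^sup>2) = (?q + 1) * (?q\<^sup>2 * card {f \<in> ?S. lead f = 0} + (?q - 1) * (?q\<^sup>2 * card {f \<in> ?S. lead f = 1}))"
    using arg_cong[OF 1, of "\<lambda>n. n * ?q\<^sup>2"] by (simp only: algebra_simps)
  also have "?q\<^sup>2 * card {f \<in> ?S. lead f = 0} = (?q - 1) * card ?W" unfolding 2 3 by (simp only: mult_ac)
  also have "(?q - 1) * card ?W + (?q - 1) * (?q\<^sup>2 * card {f \<in> ?S. lead f = 1}) = (?q - 1) * (N * card ?W)"
    unfolding 4 using N by (cases N) (simp_all add: algebra_simps)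
  finally have "N * (card ?S * ?q\<^sup>2) = N * ((?q + 1) * (?q - 1) * card ?W)" by (simp only: mult_ac)
  thus ?thesis using N by simp
qed

lemma curves_with_nonempty:
  assumes odd: "odd (CARD('a::{field,finite}))" and N: "N > 0" and S: "(quartics_with N :: 'a quartic set) \<noteq> {}"
  shows "(curves_with N :: 'a weierstrass set) \<noteq> {}"
proof
  assume "(curves_with N :: 'a weierstrass set) = {}"
  hence "card (quartics_with N :: 'a quartic set) * (CARD('a))\<^sup>2 = 0"
    using card_quartics_with[OF odd N] by simp
  hence "card (quartics_with N :: 'a quartic set) = 0" by simp
  thus False using S finite_quartics[of "quartics_with N :: 'a quartic set"] by simp
qed

lemma card_affine_points_le:
  fixes E :: "'a::{field,finite} weierstrass"
  assumes odd: "odd (CARD('a))"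
  shows "card (affine_points E) \<le> 2 * CARD('a)"
proof -
  let ?A = "{x. sq_cubic E x = 0}" and ?B = "{x. nz_square (sq_cubic E x)}"
  have "card ?A + card ?B = card (?A \<union> ?B)" by (rule card_Un_disjoint[symmetric]) (auto simp: nz_square_def)
  also have "\<dots> \<le> CARD('a)" by (rule card_mono) auto
  finally show ?thesis unfolding card_affine_points[OF odd] by linarith
qed

text \<open>The curve of a quartic with distinct roots always has a rational point.\<close>

lemma quartics_with_0:
  assumes odd: "odd (CARD('a::{field,finite}))"
  shows "quartics_with 0 = ({} :: 'a quartic set)"
proof (rule ccontr)
  let ?q = "CARD('a)"
  assume "quartics_with 0 \<noteq> ({} :: 'a quartic set)"
  then obtain f :: "'a quartic" where f: "f \<in> quartics_with 0" by blast
  hence z: "card (quartic_roots f) = 0" "card (quartic_squares f) = 0" and d: "has_distinct_roots f"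
    by (auto simp: quartics_with_def quartic_points_def)
  define n where "n = lead f"
  have n: "n \<noteq> 0" "\<not> nz_square n" using z unfolding card_quartic_sets n_def by (auto split: if_splits)
  have "{s. quartic_eval f (s, 1) = 0} = {}" "{s. nz_square (quartic_eval f (s, 1))} = {}"
    using z unfolding card_quartic_sets by simp_all
  hence ns: "quartic_eval f (s, 1) \<noteq> 0" "\<not> nz_square (quartic_eval f (s, 1))" for s by auto
  \<comment> \<open>Scaling by the nonsquare \<open>n\<close> turns all values of \<open>f\<close> into nonzero squares.\<close>
  define g where "g = map_quartic ((*) n) f"
  have ev: "quartic_eval g v = n * quartic_eval f v" for v by (simp add: g_def quartic_eval_mult)
  have lg: "lead g = n * n" using ev[of "(1, 0)"] by (simp add: quartic_eval_lead n_def)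
  have "nz_square (lead g)" unfolding lg by (rule nonsquare_mult_nonsquare[OF odd n n])
  moreover have "nz_square (quartic_eval g (s, 1))" for s
    unfolding ev by (rule nonsquare_mult_nonsquare[OF odd n ns])
  ultimately have sg: "card (quartic_squares g) = 1 + ?q" unfolding card_quartic_sets by simp
  hence "card (quartic_roots g) = 0" using card_quartic_sets_sum[of g] by simp
  hence "g \<in> quartics_with (2 * ?q + 2)"
    using sg d n(1) by (simp add: quartics_with_def quartic_points_def g_def has_distinct_roots_mult)
  hence "(curves_with (2 * ?q + 2) :: 'a weierstrass set) \<noteq> {}"
    by (intro curves_with_nonempty[OF odd]) auto
  then obtain E :: "'a weierstrass" where "E \<in> curves_with (2 * ?q + 2)" by blast
  thus False using card_affine_points_le[OF odd, of E] by (simp add: curves_with_def)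
qed

lemma curves_with_hasse:
  fixes E :: "'a::{field,finite} weierstrass"
  assumes odd: "odd (CARD('a))" and char: "CARD('a) = CHAR('a) ^ v" and E: "E \<in> curves_with N"
  shows "(int CARD('a) + 1 - int N)\<^sup>2 \<le> 4 * int CARD('a)"
proof -
  have "separable_cubic (sq_coeff2 E) (sq_coeff1 E) (sq_coeff0 E)"
    using E elliptic_iff_separable[OF odd_card_two_nonzero[OF odd]] by (simp add: curves_with_def)
  hence "(int CARD('a) - int (card (affine_points E)))\<^sup>2 \<le> 4 * int CARD('a)"
    unfolding separable_cubic_def by (intro hasse_bound[OF odd char _ card_affine_points[OF odd]]) blast
  thus ?thesis using E by (auto simp: curves_with_def)
qed

lemma quartics_with_hasse:
  fixes f :: "'a::{field,finite} quartic"
  assumes odd: "odd (CARD('a))" and char: "CARD('a) = CHAR('a) ^ v" and f: "f \<in> quartics_with N"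
  shows "(int CARD('a) + 1 - int N)\<^sup>2 \<le> 4 * int CARD('a)"
proof -
  have N: "N > 0" using f quartics_with_0[OF odd] by (cases N) auto
  have "(curves_with N :: 'a weierstrass set) \<noteq> {}"
    by (rule curves_with_nonempty[OF odd N]) (use f in blast)
  then obtain E :: "'a weierstrass" where "E \<in> curves_with N" by blast
  thus ?thesis by (rule curves_with_hasse[OF odd char])
qed

lemma card_two_points_cases:
  fixes E :: "'a::{field,finite} weierstrass"
  assumes odd: "odd (CARD('a))" and "elliptic E"
  shows "card (two_points E) \<in> {0, 1, 3}"
  unfolding card_two_points[OF odd_card_two_nonzero[OF odd]]
  by (rule card_cubic_roots) (use assms elliptic_iff_separable[OF odd_card_two_nonzero[OF odd], of E] in simp)

lemma card_quartic_roots_cases: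
  fixes f :: "'a::{field,finite} quartic"
  assumes odd: "odd (CARD('a))" and f: "has_distinct_roots f"
  shows "card (quartic_roots f) \<in> {0, 1, 2, 4}"
proof (cases "card (quartic_roots f)")
  case (Suc i)
  let ?N = "quartic_points f"
  have "f \<in> {f \<in> quartics_with ?N. card (quartic_roots f) = i + 1}" using f Suc by (simp add: quartics_with_def)
  hence "{f \<in> quartics_with ?N :: 'a quartic set. card (quartic_roots f) = i + 1} \<noteq> {}" by blast
  hence "card {f \<in> quartics_with ?N :: 'a quartic set. card (quartic_roots f) = i + 1} \<noteq> 0"
    unfolding card_eq_0_iff using finite_quartics by blast
  hence "(i + 1) * card {f \<in> quartics_with ?N :: 'a quartic set. card (quartic_roots f) = i + 1} * (CARD('a))\<^sup>2 \<noteq> 0"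
    by simp
  hence "card {E \<in> curves_with ?N :: 'a weierstrass set. card (two_points E) = i} \<noteq> 0"
    unfolding card_quartics_with_roots[OF odd] by (rule contrapos_nn) (simp only: mult_0_right)
  hence "{E \<in> curves_with ?N :: 'a weierstrass set. card (two_points E) = i} \<noteq> {}" by (rule contrapos_nn) (simp only: card.empty)
  then obtain E :: "'a weierstrass" where E: "E \<in> curves_with ?N" "card (two_points E) = i" by blast
  have "i \<in> {0, 1, 3}" using card_two_points_cases[OF odd, of E] E by (simp add: curves_with_def)
  thus ?thesis using Suc by auto
qed simp

section \<open>The weight enumerator\<close>

lemma const_qpoly_mult: "const_qpoly (a * b) = const_qpoly a * const_qpoly b"
  by (simp add: const_qpoly_def Poly_Mapping.mult_single)

lemma const_qpoly_add: "const_qpoly (a + b) = const_qpoly a + const_qpoly b"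
  by (simp add: const_qpoly_def Poly_Mapping.single_add)

lemma const_qpoly_of_nat: "const_qpoly (of_nat n) = of_nat n"
  by (simp add: const_qpoly_def)

text \<open>The monomial that a single quartic contributes to the weight enumerator.\<close>

definition quartic_monom :: "'a::{field,finite} quartic \<Rightarrow> qpoly" where
  "quartic_monom f = X_var ^ card (quartic_roots f) * Y_var ^ card (quartic_squares f) * Z_var ^ card (quartic_nonsquares f)"

lemma QR_enumerator_eq_sum:
  fixes S :: "'a::{field,finite} quartic set"
  shows "QR_enumerator S = (\<Sum>f\<in>S. quartic_monom f)"
proof -
  define g :: "'a quartic \<Rightarrow> nat \<times> nat \<times> nat" where
    "g f = (card (quartic_roots f), card (quartic_squares f), card (quartic_nonsquares f))" for f
  define T where "T = {(i, j, k). i + j + k = CARD('a) + 1}"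
  have "T \<subseteq> {..CARD('a) + 1} \<times> {..CARD('a) + 1} \<times> {..CARD('a) + 1}" by (auto simp: T_def)
  hence fin: "finite T" by (rule finite_subset) simp
  have gT: "g ` S \<subseteq> T" using card_quartic_sets_sum by (auto simp: g_def T_def)
  have "(\<Sum>f\<in>S. quartic_monom f) = (\<Sum>z\<in>T. \<Sum>f\<in>{f \<in> S. g f = z}. quartic_monom f)"
    by (rule sum.group[OF finite_quartics fin gT, symmetric])
  also have "\<dots> = QR_enumerator S"
    unfolding QR_enumerator_def T_def[symmetric]
  proof (rule sum.cong[OF refl])
    fix z :: "nat \<times> nat \<times> nat"
    obtain i j k where z: "z = (i, j, k)" by (metis prod_cases3)
    have "(\<Sum>f\<in>{f \<in> S. g f = z}. quartic_monom f) = (\<Sum>f\<in>{f \<in> S. g f = z}. X_var ^ i * Y_var ^ j * Z_var ^ k)"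
      by (rule sum.cong) (auto simp: quartic_monom_def g_def z)
    also have "\<dots> = of_nat (card {f \<in> S. g f = z}) * (X_var ^ i * Y_var ^ j * Z_var ^ k)" by simp
    also have "card {f \<in> S. g f = z} = QR_count S i j k"
      unfolding QR_count_def by (rule arg_cong[where f = card]) (auto simp: g_def z)
    finally show "(\<Sum>f\<in>{f \<in> S. g f = z}. quartic_monom f) =
      (case z of (i, j, k) \<Rightarrow> const_qpoly (of_nat (QR_count S i j k)) * X_var ^ i * Y_var ^ j * Z_var ^ k)"
      by (simp add: z const_qpoly_of_nat mult.assoc)
  qed
  finally show ?thesis by simp
qed

text \<open>The exponents are determined by the trace \<open>t\<close> and the number \<open>i\<close> of rational roots. The divisions by
  \<open>2\<close> are exact.\<close>

lemma quartic_monom_eq: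
  fixes f :: "'a::{field,finite} quartic"
  assumes "quartic_points f = N" "card (quartic_roots f) = i"
  defines "t \<equiv> int CARD('a) + 1 - int N"
  shows "quartic_monom f = monom3 (int i) ((int CARD('a) + 1 - int i - t) div 2) ((int CARD('a) + 1 - int i + t) div 2)"
proof -
  have 1: "i + 2 * card (quartic_squares f) = N" using assms by (simp add: quartic_points_def)
  have 2: "i + card (quartic_squares f) + card (quartic_nonsquares f) = CARD('a) + 1"
    using card_quartic_sets_sum[of f] assms by simp
  have "int CARD('a) + 1 - int i - t = 2 * int (card (quartic_squares f))" using 1 unfolding t_def by linarith
  moreover have "int CARD('a) + 1 - int i + t = 2 * int (card (quartic_nonsquares f))" using 1 2 unfolding t_def by linarith
  ultimately show ?thesis by (simp add: quartic_monom_def monom3_def assms(2))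
qed

lemma sum_quartic_monom:
  fixes t :: int
  assumes N: "int N = int CARD('a::{field,finite}) + 1 - t"
  shows "(\<Sum>f\<in>{f \<in> quartics_with N :: 'a quartic set. card (quartic_roots f) = i}. quartic_monom f) =
    const_qpoly (of_nat (card {f \<in> quartics_with N :: 'a quartic set. card (quartic_roots f) = i})) *
    monom3 (int i) ((int CARD('a) + 1 - int i - t) div 2) ((int CARD('a) + 1 - int i + t) div 2)"
proof -
  have t: "t = int CARD('a) + 1 - int N" using N by simp
  have "(\<Sum>f\<in>{f \<in> quartics_with N :: 'a quartic set. card (quartic_roots f) = i}. quartic_monom f) =
    (\<Sum>f\<in>{f \<in> quartics_with N :: 'a quartic set. card (quartic_roots f) = i}.
       monom3 (int i) ((int CARD('a) + 1 - int i - t) div 2) ((int CARD('a) + 1 - int i + t) div 2))"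
    by (rule sum.cong[OF refl]) (use quartic_monom_eq t in \<open>auto simp: quartics_with_def\<close>)
  thus ?thesis by (simp add: const_qpoly_of_nat)
qed

lemma N_A_card:
  assumes N: "int N = int CARD('a::{field,finite}) + 1 - t"
  shows "N_A TYPE('a) t * of_nat ((CARD('a) - 1) * CARD('a) ^ 3) = of_nat (card (curves_with N :: 'a weierstrass set))"
proof -
  have "curves_of_trace t = (curves_with N :: 'a weierstrass set)"
    unfolding curves_of_trace_def curves_with_def card_ec_group using N by auto
  moreover have "mass (curves_with N :: 'a weierstrass set) * of_nat ((CARD('a) - 1) * CARD('a) ^ 3) = of_nat (card (curves_with N :: 'a weierstrass set))"
    by (rule mass_eq_card[OF _ curves_with_iso]) (simp_all add: curves_with_def)
  ultimately show ?thesis by (simp add: N_A_def)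
qed

lemma N_A_2x2_card:
  assumes odd: "odd (CARD('a::{field,finite}))" and N: "int N = int CARD('a) + 1 - t"
  shows "N_A_2x2 TYPE('a) t * of_nat ((CARD('a) - 1) * CARD('a) ^ 3) =
    of_nat (card {E \<in> curves_with N :: 'a weierstrass set. card (two_points E) = 3})"
proof -
  let ?S = "{E \<in> curves_with N :: 'a weierstrass set. card (two_points E) = 3}"
  have "{E :: 'a weierstrass. E \<in> curves_of_trace t \<and>
     two_torsion E \<cong> integer_mod_group 2 \<times>\<times> integer_mod_group 2} = ?S"
    unfolding curves_of_trace_def curves_with_def card_ec_group using N two_torsion_klein[OF odd] by auto
  moreover have "mass ?S * of_nat ((CARD('a) - 1) * CARD('a) ^ 3) = of_nat (card ?S)"
  proof (rule mass_eq_card)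
    show "E' \<in> ?S" if "E \<in> ?S" "ec_iso E E' \<phi>" for E E' \<phi>
      using that(1) curves_with_iso[OF _ that(2)] card_points_iso(2)[OF that(2)] by simp
  qed (simp add: curves_with_def)
  ultimately show ?thesis by (simp add: N_A_2x2_def)
qed

text \<open>The order of the general linear group of degree \<open>2\<close> over a field with \<open>q\<close> elements.\<close>

abbreviation (input) gl2_order :: "nat \<Rightarrow> nat" where
  "gl2_order q \<equiv> (q - 1) ^ 2 * q * (q + 1)"

abbreviation quartics_with_roots :: "nat \<Rightarrow> nat \<Rightarrow> 'a::{field,finite} quartic set" where
  "quartics_with_roots N i \<equiv> {f \<in> quartics_with N. card (quartic_roots f) = i}"

abbreviation curves_with_torsion :: "nat \<Rightarrow> nat \<Rightarrow> 'a::{field,finite} weierstrass set" where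
  "curves_with_torsion N i \<equiv> {E \<in> curves_with N. card (two_points E) = i}"

lemma parity_roots:
  assumes odd: "odd (CARD('a::{field,finite}))" and N: "int N = int CARD('a) + 1 - t"
    and f: "f \<in> quartics_with N"
  shows "even (card (quartic_roots (f :: 'a quartic))) \<longleftrightarrow> even t"
proof -
  have "card (quartic_roots f) + 2 * card (quartic_squares f) = N" using f by (simp add: quartics_with_def quartic_points_def)
  hence "even (card (quartic_roots f)) \<longleftrightarrow> even (int N)" by (metis even_add even_mult_iff even_numeral even_of_nat)
  thus ?thesis unfolding N using odd by simp
qed

lemma parity_two_points:
  assumes odd: "odd (CARD('a::{field,finite}))" and N: "int N = int CARD('a) + 1 - t"
    and E: "E \<in> curves_with N"
  shows "even (card (two_points (E :: 'a weierstrass))) \<longleftrightarrow> odd t"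
proof -
  have "card (two_points E) + 1 + 2 * card {x. nz_square (sq_cubic E x)} = N"
    using E unfolding curves_with_eq[OF odd] card_two_points[OF odd_card_two_nonzero[OF odd]] by simp
  hence "even (card (two_points E) + 1) \<longleftrightarrow> even (int N)" by (metis even_add even_mult_iff even_numeral even_of_nat)
  thus ?thesis unfolding N using odd by auto
qed

lemma card_quartics_rat:
  assumes odd: "odd (CARD('a::{field,finite}))" and N: "int N = int CARD('a) + 1 - t"
    and N0: "N > 0"
  shows "rat_of_nat (card (quartics_with N :: 'a quartic set)) = rat_of_nat (gl2_order CARD('a)) * N_A TYPE('a) t"
proof -
  define q where "q = rat_of_nat CARD('a)"
  have q: "q \<noteq> 0" by (simp add: q_def)
  have q1: "rat_of_nat (CARD('a) - 1) = q - 1" by (simp add: q_def of_nat_diff Suc_leI)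
  have gl: "rat_of_nat (gl2_order CARD('a)) = (q - 1)\<^sup>2 * q * (q + 1)"
    by (simp only: of_nat_mult of_nat_power of_nat_add of_nat_1 q1 q_def[symmetric])
  have "rat_of_nat (card (quartics_with N :: 'a quartic set)) * q\<^sup>2 = (q + 1) * (q - 1) * rat_of_nat (card (curves_with N :: 'a weierstrass set))"
    using arg_cong[OF card_quartics_with[OF odd N0], of rat_of_nat]
    by (simp only: of_nat_mult of_nat_power of_nat_add of_nat_1 q1 q_def[symmetric])
  also have "rat_of_nat (card (curves_with N :: 'a weierstrass set)) = N_A TYPE('a) t * ((q - 1) * q ^ 3)"
    using N_A_card[OF N] by (simp add: q_def[symmetric] q1)
  also have "(q + 1) * (q - 1) * (N_A TYPE('a) t * ((q - 1) * q ^ 3)) = (rat_of_nat (gl2_order CARD('a)) * N_A TYPE('a) t) * q\<^sup>2"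
    unfolding gl by (simp add: power2_eq_square power3_eq_cube algebra_simps)
  finally show ?thesis using q by simp
qed

lemma card_quartics_roots_rat:
  assumes odd: "odd (CARD('a::{field,finite}))"
    and m: "m * rat_of_nat ((CARD('a) - 1) * CARD('a) ^ 3) = rat_of_nat (card (curves_with_torsion N i :: 'a weierstrass set))"
  shows "rat_of_nat (card (quartics_with_roots N (i + 1) :: 'a quartic set)) = rat_of_nat (gl2_order CARD('a)) * m / rat_of_nat (i + 1)"
proof -
  define q where "q = rat_of_nat CARD('a)"
  have q: "q \<noteq> 0" by (simp add: q_def)
  have q1: "rat_of_nat (CARD('a) - 1) = q - 1" by (simp add: q_def of_nat_diff Suc_leI)
  have gl: "rat_of_nat (gl2_order CARD('a)) = (q - 1)\<^sup>2 * q * (q + 1)"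
    by (simp only: of_nat_mult of_nat_power of_nat_add of_nat_1 q1 q_def[symmetric])
  have "rat_of_nat (i + 1) * rat_of_nat (card (quartics_with_roots N (i + 1) :: 'a quartic set)) * q\<^sup>2 = (q + 1) * (q - 1) * rat_of_nat (card (curves_with_torsion N i :: 'a weierstrass set))"
    using arg_cong[OF card_quartics_with_roots[OF odd, of i N], of rat_of_nat]
    by (simp only: of_nat_mult of_nat_power of_nat_add of_nat_1 q1 q_def[symmetric])
  also have "rat_of_nat (card (curves_with_torsion N i :: 'a weierstrass set)) = m * ((q - 1) * q ^ 3)"
    using m by (simp add: q_def[symmetric] q1)
  also have "(q + 1) * (q - 1) * (m * ((q - 1) * q ^ 3)) = (rat_of_nat (gl2_order CARD('a)) * m) * q\<^sup>2"
    unfolding gl by (simp add: power2_eq_square power3_eq_cube algebra_simps)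
  finally have "rat_of_nat (i + 1) * rat_of_nat (card (quartics_with_roots N (i + 1) :: 'a quartic set)) = rat_of_nat (gl2_order CARD('a)) * m" using q by simp
  thus ?thesis by (simp add: eq_divide_eq mult.commute del: of_nat_Suc of_nat_add)
qed

text \<open>For odd trace the number of rational roots is odd, hence \<open>1\<close>.\<close>

lemma sum_trace_odd:
  assumes odd: "odd (CARD('a::{field,finite}))" and N: "int N = int CARD('a) + 1 - t"
    and N0: "N > 0" and t2: "[t = 1] (mod 2)"
  shows "(\<Sum>f\<in>(quartics_with N :: 'a quartic set). quartic_monom f) = const_qpoly (rat_of_nat (gl2_order CARD('a))) *
     (const_qpoly (N_A TYPE('a) t) * monom3 1 ((int CARD('a) - t) div 2) ((int CARD('a) + t) div 2))"
proof -
  have t: "odd t" using t2 by (simp add: cong_def odd_iff_mod_2_eq_one)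
  have "card (quartic_roots f) = 1" if f: "f \<in> quartics_with N" for f :: "'a quartic"
    using card_quartic_roots_cases[OF odd, of f] parity_roots[OF odd N f] t f by (auto simp: quartics_with_def)
  hence S: "quartics_with N = (quartics_with_roots N 1 :: 'a quartic set)" by auto
  have "(\<Sum>f\<in>(quartics_with_roots N 1 :: 'a quartic set). quartic_monom f) = const_qpoly (rat_of_nat (card (quartics_with_roots N 1 :: 'a quartic set))) * monom3 1 ((int CARD('a) - t) div 2) ((int CARD('a) + t) div 2)"
    using sum_quartic_monom[OF N, of 1] by simp
  thus ?thesis unfolding S[symmetric] card_quartics_rat[OF odd N N0] const_qpoly_mult by (simp add: mult.assoc)
qed

text \<open>For even trace there are \<open>0\<close>, \<open>2\<close> or \<open>4\<close> rational roots. The last two numbers come from curves with one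
  and with three nontrivial rational two-torsion points, and the first one is obtained as a
  difference.\<close>

lemma sum_trace_even:
  assumes odd: "odd (CARD('a::{field,finite}))" and N: "int N = int CARD('a) + 1 - t"
    and N0: "N > 0" and t2: "[t = 0] (mod 2)"
  shows "(\<Sum>f\<in>(quartics_with N :: 'a quartic set). quartic_monom f) = const_qpoly (rat_of_nat (gl2_order CARD('a))) *
     (const_qpoly (N_A TYPE('a) t - N_A_2x2 TYPE('a) t) *
          (const_qpoly (1 / 2) * monom3 2 ((int CARD('a) - 1 - t) div 2) ((int CARD('a) - 1 + t) div 2)
         + const_qpoly (1 / 2) * monom3 0 ((int CARD('a) + 1 - t) div 2) ((int CARD('a) + 1 + t) div 2))
      + const_qpoly (N_A_2x2 TYPE('a) t) *
          (const_qpoly (1 / 4) * monom3 4 ((int CARD('a) - 3 - t) div 2) ((int CARD('a) - 3 + t) div 2)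
         + const_qpoly (3 / 4) * monom3 0 ((int CARD('a) + 1 - t) div 2) ((int CARD('a) + 1 + t) div 2)))"
proof -
  note fin = finite_quartics
  have finW: "finite A" for A :: "'a weierstrass set" using finite_weierstrass by (rule rev_finite_subset) simp
  have t: "even t" using t2 by (simp add: cong_def even_iff_mod_2_eq_zero)
  define n n4 where "n = N_A TYPE('a) t" and "n4 = N_A_2x2 TYPE('a) t"
  have "card (quartic_roots f) \<in> {0, 2, 4}" if f: "f \<in> quartics_with N" for f :: "'a quartic"
    using card_quartic_roots_cases[OF odd, of f] parity_roots[OF odd N f] t f by (auto simp: quartics_with_def)
  hence S: "quartics_with N = (quartics_with_roots N 0 :: 'a quartic set) \<union> (quartics_with_roots N 2 :: 'a quartic set) \<union> (quartics_with_roots N 4 :: 'a quartic set)" by blast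
  have "card (two_points E) \<in> {1, 3}" if E: "E \<in> curves_with N" for E :: "'a weierstrass"
    using card_two_points_cases[OF odd, of E] parity_two_points[OF odd N E] t E by (auto simp: curves_with_def)
  hence W: "curves_with N = (curves_with_torsion N 1 :: 'a weierstrass set) \<union> (curves_with_torsion N 3 :: 'a weierstrass set)" by blast
  have "card (curves_with N :: 'a weierstrass set) = card (curves_with_torsion N 1 :: 'a weierstrass set) + card (curves_with_torsion N 3 :: 'a weierstrass set)"
    by (subst W, rule card_Un_disjoint) (auto intro: finW)
  hence "(n - n4) * rat_of_nat ((CARD('a) - 1) * CARD('a) ^ 3) = rat_of_nat (card (curves_with_torsion N 1 :: 'a weierstrass set))"
    unfolding left_diff_distrib n_def n4_def N_A_card[OF N] N_A_2x2_card[OF odd N] by simp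
  from card_quartics_roots_rat[OF odd this] have c2: "rat_of_nat (card (quartics_with_roots N 2 :: 'a quartic set)) = rat_of_nat (gl2_order CARD('a)) * (n - n4) * (1 / 2)"
    unfolding one_add_one by simp
  have "3 + 1 = (4::nat)" by simp
  from card_quartics_roots_rat[OF odd N_A_2x2_card[OF odd N], unfolded this] have c4: "rat_of_nat (card (quartics_with_roots N 4 :: 'a quartic set)) = rat_of_nat (gl2_order CARD('a)) * n4 * (1 / 4)"
    by (simp add: n4_def)
  have "card (quartics_with N :: 'a quartic set) = card ((quartics_with_roots N 0 :: 'a quartic set) \<union> (quartics_with_roots N 2 :: 'a quartic set)) + card (quartics_with_roots N 4 :: 'a quartic set)"
    by (subst S, rule card_Un_disjoint) (auto intro: fin)
  also have "card ((quartics_with_roots N 0 :: 'a quartic set) \<union> (quartics_with_roots N 2 :: 'a quartic set)) = card (quartics_with_roots N 0 :: 'a quartic set) + card (quartics_with_roots N 2 :: 'a quartic set)"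
    by (rule card_Un_disjoint) (auto intro: fin)
  finally have "rat_of_nat (card (quartics_with N :: 'a quartic set)) = rat_of_nat (card (quartics_with_roots N 0 :: 'a quartic set)) + rat_of_nat (card (quartics_with_roots N 2 :: 'a quartic set)) + rat_of_nat (card (quartics_with_roots N 4 :: 'a quartic set))"
    by (simp only: of_nat_add)
  moreover have arith: "G * n - G * (n - n4) * (1 / 2) - G * n4 * (1 / 4) = G * ((n - n4) * (1 / 2) + n4 * (3 / 4))" for G
    by (simp add: field_simps)
  ultimately have "rat_of_nat (card (quartics_with_roots N 0 :: 'a quartic set)) = rat_of_nat (gl2_order CARD('a)) * n - rat_of_nat (gl2_order CARD('a)) * (n - n4) * (1 / 2) - rat_of_nat (gl2_order CARD('a)) * n4 * (1 / 4)"
    unfolding card_quartics_rat[OF odd N N0] c2 c4 n_def[symmetric] by linarith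
  hence c0: "rat_of_nat (card (quartics_with_roots N 0 :: 'a quartic set)) = rat_of_nat (gl2_order CARD('a)) * ((n - n4) * (1 / 2) + n4 * (3 / 4))"
    unfolding arith .
  have "(\<Sum>f\<in>(quartics_with N :: 'a quartic set). quartic_monom f) = (\<Sum>f\<in>(quartics_with_roots N 0 :: 'a quartic set) \<union> (quartics_with_roots N 2 :: 'a quartic set). quartic_monom f) + (\<Sum>f\<in>(quartics_with_roots N 4 :: 'a quartic set). quartic_monom f)"
    by (subst S, rule sum.union_disjoint) (auto intro: fin)
  also have "(\<Sum>f\<in>(quartics_with_roots N 0 :: 'a quartic set) \<union> (quartics_with_roots N 2 :: 'a quartic set). quartic_monom f) = (\<Sum>f\<in>(quartics_with_roots N 0 :: 'a quartic set). quartic_monom f) + (\<Sum>f\<in>(quartics_with_roots N 2 :: 'a quartic set). quartic_monom f)"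
    by (rule sum.union_disjoint) (auto intro: fin)
  finally have sum: "(\<Sum>f\<in>(quartics_with N :: 'a quartic set). quartic_monom f) =
    (\<Sum>f\<in>(quartics_with_roots N 0 :: 'a quartic set). quartic_monom f) + (\<Sum>f\<in>(quartics_with_roots N 2 :: 'a quartic set). quartic_monom f) + (\<Sum>f\<in>(quartics_with_roots N 4 :: 'a quartic set). quartic_monom f)" .
  have m: "int CARD('a) + 1 - 2 = int CARD('a) - 1" "int CARD('a) + 1 - 4 = int CARD('a) - 3" by simp_all
  have s0: "(\<Sum>f\<in>(quartics_with_roots N 0 :: 'a quartic set). quartic_monom f) = const_qpoly (rat_of_nat (card (quartics_with_roots N 0 :: 'a quartic set))) * monom3 0 ((int CARD('a) + 1 - t) div 2) ((int CARD('a) + 1 + t) div 2)"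
    using sum_quartic_monom[OF N, of 0] by simp
  have s2: "(\<Sum>f\<in>(quartics_with_roots N 2 :: 'a quartic set). quartic_monom f) = const_qpoly (rat_of_nat (card (quartics_with_roots N 2 :: 'a quartic set))) * monom3 2 ((int CARD('a) - 1 - t) div 2) ((int CARD('a) - 1 + t) div 2)"
    using sum_quartic_monom[OF N, of 2] by (simp only: of_nat_numeral m)
  have s4: "(\<Sum>f\<in>(quartics_with_roots N 4 :: 'a quartic set). quartic_monom f) = const_qpoly (rat_of_nat (card (quartics_with_roots N 4 :: 'a quartic set))) * monom3 4 ((int CARD('a) - 3 - t) div 2) ((int CARD('a) - 3 + t) div 2)"
    using sum_quartic_monom[OF N, of 4] by (simp only: of_nat_numeral m)
  show ?thesis
    unfolding sum s0 s2 s4 c0 c2 c4 const_qpoly_mult const_qpoly_add n_def[symmetric] n4_def[symmetric]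
    by (simp only: algebra_simps)
qed


theorem theorem4:
  fixes p v q :: nat
  assumes "prime p" and "odd p" and "v \<ge> 1" and "q = p ^ v"
    and "CARD('a::{field,finite}) = q"
  shows "QRS_C14 TYPE('a) = of_nat ((q - 1) ^ 2 * q * (q + 1)) *
    ((\<Sum>t \<in> {t::int. t ^ 2 \<le> 4 * int q \<and> [t = 1] (mod 2)}.
        const_qpoly (N_A TYPE('a) t) * monom3 1 ((int q - t) div 2) ((int q + t) div 2))
   + (\<Sum>t \<in> {t::int. t ^ 2 \<le> 4 * int q \<and> [t = 0] (mod 2)}.
        const_qpoly (N_A TYPE('a) t - N_A_2x2 TYPE('a) t) *
          (const_qpoly (1 / 2) * monom3 2 ((int q - 1 - t) div 2) ((int q - 1 + t) div 2)
         + const_qpoly (1 / 2) * monom3 0 ((int q + 1 - t) div 2) ((int q + 1 + t) div 2))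
      + const_qpoly (N_A_2x2 TYPE('a) t) *
          (const_qpoly (1 / 4) * monom3 4 ((int q - 3 - t) div 2) ((int q - 3 + t) div 2)
         + const_qpoly (3 / 4) * monom3 0 ((int q + 1 - t) div 2) ((int q + 1 + t) div 2))))"
    (is "_ = of_nat ?M * ((\<Sum>t\<in>?To. ?o t) + (\<Sum>t\<in>?Te. ?e t))")
proof -
  have q: "q = CARD('a)" using assms(5) by simp
  have odd: "odd (CARD('a))" using assms by simp
  have "CHAR('a) dvd p ^ v" using CHAR_dvd_CARD[where 'a='a] assms by simp
  moreover have "prime CHAR('a)" using prime_CHAR_semidom[where ?'a='a] finite_imp_CHAR_pos[where ?'a='a] by simp
  ultimately have "CHAR('a) = p" using assms(1) prime_dvd_power primes_dvd_imp_eq by blast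
  hence char: "CARD('a) = CHAR('a) ^ v" using assms by simp
  have "card {0::'a, 1} \<le> CARD('a)" by (rule card_mono) auto
  hence q2: "q \<ge> 2" by (simp add: q)
  have M: "const_qpoly (of_nat ?M) = of_nat ?M" by (rule const_qpoly_of_nat)
  define T where "T = {t::int. t ^ 2 \<le> 4 * int q}"
  \<comment> \<open>This ensures that \<open>q + 1 - t\<close>, the number of points, is positive.\<close>
  have bound: "\<bar>t\<bar> \<le> int q" if "t \<in> T" for t
  proof (rule ccontr)
    assume "\<not> \<bar>t\<bar> \<le> int q"
    hence "\<bar>t\<bar>\<^sup>2 \<ge> (int q + 1)\<^sup>2" by (intro power_mono) auto
    hence "t\<^sup>2 \<ge> (int q + 1)\<^sup>2" by simp
    moreover have "(int q + 1)\<^sup>2 = 4 * int q + (int q - 1)\<^sup>2" by (simp add: power2_eq_square algebra_simps)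
    moreover have "(int q - 1)\<^sup>2 > 0" using q2 by simp
    ultimately show False using that[unfolded T_def mem_Collect_eq] by linarith
  qed
  have finT: "finite T" by (rule finite_subset[of _ "{- int q..int q}"]) (use bound in \<open>force+\<close>)
  define S where "S = {f :: 'a quartic. has_distinct_roots f}"
  define tr where "tr f = int q + 1 - int (quartic_points f)" for f :: "'a quartic"
  have trT: "tr ` S \<subseteq> T"
    using quartics_with_hasse[OF odd char] by (auto simp: tr_def S_def T_def quartics_with_def q)
  have fib: "{f \<in> S. tr f = t} = quartics_with (nat (int q + 1 - t))" and N: "int (nat (int q + 1 - t)) = int CARD('a) + 1 - t"
    and N0: "nat (int q + 1 - t) > 0" if "t \<in> T" for t
    using bound[OF that] by (auto simp: S_def tr_def quartics_with_def q)
  have o: "(\<Sum>f\<in>{f \<in> S. tr f = t}. quartic_monom f) = of_nat ?M * ?o t" if "t \<in> ?To" for t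
  proof -
    have t: "t \<in> T" "[t = 1] (mod 2)" using that by (simp_all add: T_def)
    show ?thesis using sum_trace_odd[OF odd N[OF t(1)] N0[OF t(1)] t(2)]
      by (simp only: fib[OF t(1)] M q[symmetric])
  qed
  have e: "(\<Sum>f\<in>{f \<in> S. tr f = t}. quartic_monom f) = of_nat ?M * ?e t" if "t \<in> ?Te" for t
  proof -
    have t: "t \<in> T" "[t = 0] (mod 2)" using that by (simp_all add: T_def)
    show ?thesis using sum_trace_even[OF odd N[OF t(1)] N0[OF t(1)] t(2)]
      by (simp only: fib[OF t(1)] M q[symmetric])
  qed
  have T: "T = ?To \<union> ?Te" by (auto simp: T_def cong_def)
  have "QRS_C14 TYPE('a) = (\<Sum>f\<in>S. quartic_monom f)"
    unfolding QRS_C14_def QR_enumerator_eq_sum S_def ..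
  also have "\<dots> = (\<Sum>t\<in>T. \<Sum>f\<in>{f \<in> S. tr f = t}. quartic_monom f)"
    by (rule sum.group[OF finite_quartics finT trT, symmetric])
  also have "\<dots> = (\<Sum>t\<in>?To. \<Sum>f\<in>{f \<in> S. tr f = t}. quartic_monom f) + (\<Sum>t\<in>?Te. \<Sum>f\<in>{f \<in> S. tr f = t}. quartic_monom f)"
    unfolding T by (rule sum.union_disjoint) (use finT in \<open>auto simp: T cong_def\<close>)
  also have "(\<Sum>t\<in>?To. \<Sum>f\<in>{f \<in> S. tr f = t}. quartic_monom f) = of_nat ?M * (\<Sum>t\<in>?To. ?o t)"
    unfolding sum_distrib_left by (rule sum.cong[OF refl o])
  also have "(\<Sum>t\<in>?Te. \<Sum>f\<in>{f \<in> S. tr f = t}. quartic_monom f) = of_nat ?M * (\<Sum>t\<in>?Te. ?e t)"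
    unfolding sum_distrib_left by (rule sum.cong[OF refl e])
  finally show ?thesis unfolding distrib_left .
qed

end
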